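(* Let $n\ge1$ be an integer and let $\Gamma$ be a discrete group of type $F_{n+1}$. The following hold: (1) For every positive hermitian functional $\phi:\operatorname{im}D_{n-1}\to\mathbb{R}$ there exist a unitary representation $\pi$ of $\Gamma$ and a cyclic cocycle $z\in Z^n(\Gamma,\pi)$ such that $$\phi(d_{n-1}^*ad_{n-1})=\langle\pi(a)z,z\rangle\quad\text{for every }a\in\mathbb{M}_{k_n}(\mathbb{R}\Gamma).$$ (2) Suppose that $\mathcal{SC}_n=\ker D_{n-1}$. For every unitary representation $\pi$ of $\Gamma$ and every cocycle $z\in Z^n(\Gamma,\pi)$, the functional $\phi:\operatorname{im}D_{n-1}\to\mathbb{R}$ defined by $$\phi(d_{n-1}^*ad_{n-1})=\langle\pi(a)z,z\rangle\quad\text{for every }a\in\mathbb{M}_{k_n}(\mathbb{R}\Gamma)$$ is well-defined, positive and hermitian.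
   Context: $\mathbb{R}\Gamma$ is the real group algebra with involution $(\sum a_\gamma\gamma)^*=\sum a_\gamma\gamma^{-1}$; $\mathbb{M}_{k\times l}(\mathbb{R}\Gamma)$ denotes $k\times l$ matrices over $\mathbb{R}\Gamma$, $\mathbb{M}_k=\mathbb{M}_{k\times k}$, and for a matrix $x$, $x^*$ is the transpose of $x$ with the involution applied to each entry. $\Sigma^2\mathbb{M}_k(\mathbb{R}\Gamma)$ is the set of finite sums $\sum_i a_i^*a_i$ with $a_i\in\mathbb{M}_k(\mathbb{R}\Gamma)$. Finiteness: $\Gamma$ is of type $F_m$ if it acts freely by simplicial automorphisms on a locally finite contractible simplicial complex $X$ such that, for every $n\le m$, the set $X^{(n)}$ of $n$-simplices has a finite number $k_n$ of $\Gamma$-orbits. Fix such an $X$ (with $m=n+1$). Codifferentials: fix a $\Gamma$-invariant orientation of the simplices of $X$ and representatives $\tau^n_1,\dots,\tau^n_{k_n}$ of the $\Gamma$-orbits in $X^{(n)}$. Writing the simplicial boundary as $\partial\tau^{n+1}_i=\sum_{j}\sum_{\gamma\in\Gamma}\varepsilon_{ij}(\gamma)\,\gamma\tau^n_j$, let $d_n\in\mathbb{M}_{k_{n+1}\times k_n}(\mathbb{R}\Gamma)$ be the matrix with entries $(d_n)_{ij}=\sum_\gamma\varepsilon_{ij}(\gamma)\gamma$. Then $d_nd_{n-1}=0$. Define $D_n:\mathbb{M}_{k_{n+1}}(\mathbb{R}\Gamma)\to\mathbb{M}_{k_n}(\mathbb{R}\Gamma)$ by $D_n(a)=d_n^*ad_n$,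 and the split conjugation space $$\mathcal{SC}_n=\{d_n^*x+yd_n:\ x\in\mathbb{M}_{k_{n+1}\times k_n}(\mathbb{R}\Gamma),\ y\in\mathbb{M}_{k_n\times k_{n+1}}(\mathbb{R}\Gamma)\}\subseteq\mathbb{M}_{k_n}(\mathbb{R}\Gamma).$$ Functionals: a linear functional $\phi$ on a $*$-invariant linear subspace $V\subseteq\mathbb{M}_k(\mathbb{R}\Gamma)$ is hermitian if $\phi(a^* )=\phi(a)$ for all $a\in V$, and positive if $\phi(a)\ge0$ for all $a\in V\cap\Sigma^2\mathbb{M}_k(\mathbb{R}\Gamma)$. Representations: Hilbert spaces are real, so a unitary representation $(\pi,\mathcal{H})$ is a homomorphism from $\Gamma$ to the group of surjective linear isometries of a real Hilbert space. Extend $\pi$ linearly to $\mathbb{R}\Gamma$ and apply it entrywise to matrices, so $\pi(d_n):\mathcal{H}^{k_n}\to\mathcal{H}^{k_{n+1}}$. Put $Z^n(\Gamma,\pi)=\ker\pi(d_n)\subseteq\mathcal{H}^{k_n}$. A vector $z\in\mathcal{H}^{k_n}$ is cyclic if $\pi(\mathbb{M}_{k_n}(\mathbb{R}\Gamma))z$ is dense in $\mathcal{H}^{k_n}$. *)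

theory Defs
  imports
    "HOL-Analysis.Analysis"
    "HOL-Library.Poly_Mapping"
    "HOL-Combinatorics.Permutations"
    "Jordan_Normal_Form.Matrix"
begin

no_notation vec_nth (infixl \<open>$\<close> 90)
hide_const (open) Finite_Cartesian_Product.vec Finite_Cartesian_Product.mat

section \<open>The Hilbert space of square-summable families\<close>

text \<open>HOL cannot quantify existentially over types, so the Hilbert space whose existence is
  asserted is a closed subspace of a fixed one.  For a cyclic vector of $H^k$, the space $H$ is
  the closed span of $|\Gamma| \cdot k$ vectors, so that the square-summable families
  indexed by $\Gamma \times \mathbb{N}$ leave enough room.\<close>

typedef 'i ell2 = "{f :: 'i \<Rightarrow> real. (\<lambda>i. (f i)\<^sup>2) summable_on UNIV}"
  morphisms ell2_apply Abs_ell2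
  by (rule exI[of _ "\<lambda>_. 0"]) simp

setup_lifting type_definition_ell2

lemma ell2_summable_mult:
  fixes f g :: "'i \<Rightarrow> real"
  assumes "(\<lambda>i. (f i)\<^sup>2) summable_on UNIV" "(\<lambda>i. (g i)\<^sup>2) summable_on UNIV"
  shows "(\<lambda>i. f i * g i) summable_on UNIV"
proof -
  have "(\<lambda>i. (f i)\<^sup>2 + (g i)\<^sup>2) summable_on UNIV"
    using assms by (rule summable_on_add)
  then have "(\<lambda>i. norm (f i * g i)) summable_on UNIV"
  proof (rule Infinite_Sum.abs_summable_on_comparison_test')
    fix i
    have "0 \<le> (\<bar>f i\<bar> - \<bar>g i\<bar>)\<^sup>2" by simp
    then have "2 * (\<bar>f i\<bar> * \<bar>g i\<bar>) \<le> (f i)\<^sup>2 + (g i)\<^sup>2"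
      by (simp add: power2_diff)
    moreover have "0 \<le> \<bar>f i\<bar> * \<bar>g i\<bar>" by simp
    ultimately show "norm (f i * g i) \<le> (f i)\<^sup>2 + (g i)\<^sup>2"
      unfolding real_norm_def abs_mult by linarith
  qed
  then show ?thesis by (rule Infinite_Sum.abs_summable_summable)
qed

lemma ell2_summable_add:
  fixes f g :: "'i \<Rightarrow> real"
  assumes "(\<lambda>i. (f i)\<^sup>2) summable_on UNIV" "(\<lambda>i. (g i)\<^sup>2) summable_on UNIV"
  shows "(\<lambda>i. (f i + g i)\<^sup>2) summable_on UNIV"
proof -
  have "(\<lambda>i. ((f i)\<^sup>2 + (g i)\<^sup>2) + 2 * (f i * g i)) summable_on UNIV"
    by (intro summable_on_add summable_on_cmult_right ell2_summable_mult assms)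
  then show ?thesis by (simp add: power2_sum mult.assoc)
qed

lemma ell2_summable_scale:
  fixes f :: "'i \<Rightarrow> real"
  assumes "(\<lambda>i. (f i)\<^sup>2) summable_on UNIV"
  shows "(\<lambda>i. (c * f i)\<^sup>2) summable_on UNIV"
  using summable_on_cmult_right[OF assms, of "c\<^sup>2"] by (simp add: power_mult_distrib)

instantiation ell2 :: (type) real_vector
begin
lift_definition zero_ell2 :: "'a ell2" is "\<lambda>_. 0" by simp
lift_definition plus_ell2 :: "'a ell2 \<Rightarrow> 'a ell2 \<Rightarrow> 'a ell2" is "\<lambda>f g i. f i + g i"
  by (rule ell2_summable_add)
lift_definition uminus_ell2 :: "'a ell2 \<Rightarrow> 'a ell2" is "\<lambda>f i. - f i" by simp
lift_definition minus_ell2 :: "'a ell2 \<Rightarrow> 'a ell2 \<Rightarrow> 'a ell2" is "\<lambda>f g i. f i - g i"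
  using ell2_summable_add[of _ "\<lambda>i. - _ i"] by simp
lift_definition scaleR_ell2 :: "real \<Rightarrow> 'a ell2 \<Rightarrow> 'a ell2" is "\<lambda>c f i. c * f i"
  by (rule ell2_summable_scale)
instance
  by standard (transfer; simp add: fun_eq_iff algebra_simps)+
end

instantiation ell2 :: (type) real_inner
begin
lift_definition inner_ell2 :: "'a ell2 \<Rightarrow> 'a ell2 \<Rightarrow> real" is
  "\<lambda>f g. \<Sum>\<^sub>\<infinity>i. f i * g i" .
definition norm_ell2 :: "'a ell2 \<Rightarrow> real" where "norm_ell2 x = sqrt (inner x x)"
definition dist_ell2 :: "'a ell2 \<Rightarrow> 'a ell2 \<Rightarrow> real" where "dist_ell2 x y = norm (x - y)"
definition sgn_ell2 :: "'a ell2 \<Rightarrow> 'a ell2" where "sgn_ell2 x = x /\<^sub>R norm x"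
definition uniformity_ell2 :: "('a ell2 \<times> 'a ell2) filter" where
  "uniformity_ell2 = (INF e\<in>{0<..}. principal {(x, y). dist x y < e})"
definition open_ell2 :: "'a ell2 set \<Rightarrow> bool" where
  "open_ell2 U \<longleftrightarrow> (\<forall>x\<in>U. \<forall>\<^sub>F (x', y) in uniformity. x' = x \<longrightarrow> y \<in> U)"
instance
proof
  fix x y z :: "'a ell2" and r :: real and U :: "'a ell2 set"
  show "dist x y = norm (x - y)" by (simp add: dist_ell2_def)
  show "sgn x = x /\<^sub>R norm x" by (simp add: sgn_ell2_def)
  show "uniformity = (INF e\<in>{0<..}. principal {(x, y :: 'a ell2). dist x y < e})"
    by (simp add: uniformity_ell2_def)
  show "open U \<longleftrightarrow> (\<forall>x\<in>U. \<forall>\<^sub>F (x', y) in uniformity. x' = x \<longrightarrow> y \<in> U)"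
    by (simp add: open_ell2_def)
  show "norm x = sqrt (inner x x)" by (simp add: norm_ell2_def)
  show "inner x y = inner y x" by transfer (simp add: mult.commute)
  show "inner (x + y) z = inner x z + inner y z"
    by transfer (simp add: distrib_right infsum_add ell2_summable_mult)
  show "inner (r *\<^sub>R x) y = r * inner x y"
    by transfer (simp add: mult.assoc infsum_cmult_right ell2_summable_mult)
  show "0 \<le> inner x x"
    by transfer (simp add: infsum_nonneg)
  show "inner x x = 0 \<longleftrightarrow> x = 0"
  proof
    assume "inner x x = 0"
    then show "x = 0"
    proof transfer
      fix f :: "'a \<Rightarrow> real"
      assume f: "(\<lambda>i. (f i)\<^sup>2) summable_on UNIV" "(\<Sum>\<^sub>\<infinity>i. f i * f i) = 0"
      have "f i * f i = 0" for i
        by (rule nonneg_infsum_le_0D[where A = UNIV])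
          (use f in \<open>auto simp: power2_eq_square\<close>)
      then show "f = (\<lambda>_. 0)" by auto
    qed
  qed (transfer, simp)
qed
end

lemma ell2_sum_le_norm:
  assumes "finite F"
  shows "(\<Sum>i\<in>F. (ell2_apply x i)\<^sup>2) \<le> (norm x)\<^sup>2"
proof -
  have s: "(\<lambda>i. (ell2_apply x i)\<^sup>2) summable_on UNIV" using ell2_apply by auto
  have "(norm x)\<^sup>2 = (\<Sum>\<^sub>\<infinity>i. (ell2_apply x i)\<^sup>2)"
    unfolding power2_norm_eq_inner by (simp add: inner_ell2.rep_eq power2_eq_square)
  then show ?thesis using finite_sum_le_infsum[OF s assms] by simp
qed

lemma ell2_norm_leI:
  assumes "\<And>F. finite F \<Longrightarrow> (\<Sum>i\<in>F. (ell2_apply x i)\<^sup>2) \<le> e\<^sup>2" "0 \<le> e"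
  shows "norm x \<le> e"
proof -
  have s: "(\<lambda>i. (ell2_apply x i)\<^sup>2) summable_on UNIV" using ell2_apply by auto
  have "(norm x)\<^sup>2 = (\<Sum>\<^sub>\<infinity>i. (ell2_apply x i)\<^sup>2)"
    unfolding power2_norm_eq_inner by (simp add: inner_ell2.rep_eq power2_eq_square)
  also have "\<dots> \<le> e\<^sup>2" by (rule infsum_le_finite_sums[OF s]) (use assms in auto)
  finally show ?thesis using assms(2) by (rule power2_le_imp_le)
qed

instance ell2 :: (type) complete_space
proof
  fix X :: "nat \<Rightarrow> 'a ell2"
  assume C: "Cauchy X"
  have coord: "\<bar>ell2_apply (X m) i - ell2_apply (X n) i\<bar> \<le> norm (X m - X n)" for m n i
    using ell2_sum_le_norm[of "{i}" "X m - X n"]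
    by (simp add: minus_ell2.rep_eq abs_le_square_iff[symmetric])
  have "Cauchy (\<lambda>n. ell2_apply (X n) i)" for i
  proof (rule metric_CauchyI)
    fix e :: real assume "0 < e"
    then obtain M where "\<forall>m\<ge>M. \<forall>n\<ge>M. dist (X m) (X n) < e"
      using C metric_CauchyD by blast
    then show "\<exists>M. \<forall>m\<ge>M. \<forall>n\<ge>M. dist (ell2_apply (X m) i) (ell2_apply (X n) i) < e"
      unfolding dist_norm real_norm_def using coord le_less_trans by blast
  qed
  then have "\<exists>l. (\<lambda>n. ell2_apply (X n) i) \<longlonglongrightarrow> l" for i
    using Cauchy_convergent convergent_def by blast
  then obtain f where f: "\<And>i. (\<lambda>n. ell2_apply (X n) i) \<longlonglongrightarrow> f i" by metis
  have bound: "(\<Sum>i\<in>F. (ell2_apply (X n) i - f i)\<^sup>2) \<le> e\<^sup>2"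
    if "finite F" "\<forall>m\<ge>M. norm (X n - X m) < e" "0 < e" for F n M e
  proof (rule tendsto_upperbound)
    show "(\<lambda>m. \<Sum>i\<in>F. (ell2_apply (X n) i - ell2_apply (X m) i)\<^sup>2)
        \<longlonglongrightarrow> (\<Sum>i\<in>F. (ell2_apply (X n) i - f i)\<^sup>2)"
      by (intro tendsto_intros f)
    show "\<forall>\<^sub>F m in sequentially. (\<Sum>i\<in>F. (ell2_apply (X n) i - ell2_apply (X m) i)\<^sup>2) \<le> e\<^sup>2"
      unfolding eventually_sequentially
    proof (intro exI allI impI)
      fix m assume "M \<le> m"
      then have "(norm (X n - X m))\<^sup>2 \<le> e\<^sup>2" using that by (intro power_mono) (auto intro: less_imp_le)
      then show "(\<Sum>i\<in>F. (ell2_apply (X n) i - ell2_apply (X m) i)\<^sup>2) \<le> e\<^sup>2"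
        using ell2_sum_le_norm[OF that(1), of "X n - X m"] by (simp add: minus_ell2.rep_eq)
    qed
  qed simp
  have ex: "\<exists>M. \<forall>n\<ge>M. \<forall>m\<ge>M. norm (X n - X m) < e" if "0 < e" for e
    using metric_CauchyD[OF C that] by (simp add: dist_norm)
  obtain M where M: "\<forall>n\<ge>M. \<forall>m\<ge>M. norm (X n - X m) < 1" using ex[of 1] by auto
  have "(\<lambda>i. (ell2_apply (X M) i - f i)\<^sup>2) summable_on UNIV"
  proof (rule nonneg_bdd_above_summable_on)
    show "bdd_above (sum (\<lambda>i. (ell2_apply (X M) i - f i)\<^sup>2) ` {F. F \<subseteq> UNIV \<and> finite F})"
      by (rule bdd_aboveI[where M = "1\<^sup>2"]) (use bound[where n = M and e = 1] M in auto)
  qed simp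
  then have "(\<lambda>i. (- (ell2_apply (X M) i - f i) + ell2_apply (X M) i)\<^sup>2) summable_on UNIV"
    by (intro ell2_summable_add) (use ell2_apply[of "X M"] in \<open>auto simp: power2_commute\<close>)
  then have l: "ell2_apply (Abs_ell2 f) = f" by (intro Abs_ell2_inverse) simp
  have "X \<longlonglongrightarrow> Abs_ell2 f"
  proof (rule metric_LIMSEQ_I)
    fix r :: real assume "0 < r"
    then obtain N where N: "\<forall>n\<ge>N. \<forall>m\<ge>N. norm (X n - X m) < r / 2" using ex[of "r / 2"] by auto
    have "norm (X n - Abs_ell2 f) \<le> r / 2" if "N \<le> n" for n
    proof (rule ell2_norm_leI)
      fix F :: "'a set" assume "finite F"
      then have "(\<Sum>i\<in>F. (ell2_apply (X n) i - f i)\<^sup>2) \<le> (r / 2)\<^sup>2"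
        by (rule bound) (use N that \<open>0 < r\<close> in \<open>blast, linarith\<close>)
      then show "(\<Sum>i\<in>F. (ell2_apply (X n - Abs_ell2 f) i)\<^sup>2) \<le> (r / 2)\<^sup>2"
        by (simp only: minus_ell2.rep_eq l)
    qed (use \<open>0 < r\<close> in linarith)
    moreover have "r / 2 < r" using \<open>0 < r\<close> by simp
    ultimately have "dist (X n) (Abs_ell2 f) < r" if "N \<le> n" for n
      unfolding dist_norm by (rule le_less_trans) (rule that)
    then show "\<exists>no. \<forall>n\<ge>no. dist (X n) (Abs_ell2 f) < r" by blast
  qed
  then show "convergent X" by (auto simp: convergent_def)
qed


section \<open>Simplicial complexes\<close>

definition abstract_complex :: "'v set set \<Rightarrow> bool" where
  "abstract_complex X \<longleftrightarrow>
     (\<forall>\<sigma>\<in>X. finite \<sigma> \<and> \<sigma> \<noteq> {} \<and> (\<forall>\<rho>. \<rho> \<subseteq> \<sigma> \<and> \<rho> \<noteq> {} \<longrightarrow> \<rho> \<in> X))"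

definition locally_finite_complex :: "'v set set \<Rightarrow> bool" where
  "locally_finite_complex X \<longleftrightarrow> (\<forall>v. finite {\<sigma>\<in>X. v \<in> \<sigma>})"

definition simplices :: "'v set set \<Rightarrow> nat \<Rightarrow> 'v set set" where
  "simplices X n = {\<sigma>\<in>X. card \<sigma> = n + 1}"

text \<open>The points of a closed simplex in barycentric coordinates; for finite \<open>\<sigma>\<close> the subspace
  topology from \<open>'v \<Rightarrow> real\<close> is the Euclidean one.\<close>

definition simplex_points :: "'v set \<Rightarrow> ('v \<Rightarrow> real) set" where
  "simplex_points \<sigma> = {f. (\<forall>v. 0 \<le> f v) \<and> {v. f v \<noteq> 0} \<subseteq> \<sigma> \<and> sum f \<sigma> = 1}"

text \<open>The geometric realization with its weak (coherent) topology.\<close>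

definition realization_open :: "'v set set \<Rightarrow> ('v \<Rightarrow> real) set \<Rightarrow> bool" where
  "realization_open X U \<longleftrightarrow>
     U \<subseteq> (\<Union>\<sigma>\<in>X. simplex_points \<sigma>) \<and>
     (\<forall>\<sigma>\<in>X. openin (top_of_set (simplex_points \<sigma>)) (U \<inter> simplex_points \<sigma>))"

definition realization :: "'v set set \<Rightarrow> ('v \<Rightarrow> real) topology" where
  "realization X = topology (realization_open X)"

lemma istopology_realization: "istopology (realization_open (X :: 'v set set))"
  unfolding istopology_def
proof (intro conjI allI impI)
  fix S T :: "('v \<Rightarrow> real) set"
  assume S: "realization_open X S" and T: "realization_open X T"
  have "S \<inter> T \<inter> A = (S \<inter> A) \<inter> (T \<inter> A)" for A by blast
  then show "realization_open X (S \<inter> T)"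
    using S T unfolding realization_open_def by (auto intro: openin_Int)
next
  fix \<K> :: "('v \<Rightarrow> real) set set"
  assume K: "\<forall>K\<in>\<K>. realization_open X K"
  show "realization_open X (\<Union>\<K>)"
    unfolding realization_open_def
  proof (intro conjI ballI)
    show "\<Union>\<K> \<subseteq> (\<Union>\<sigma>\<in>X. simplex_points \<sigma>)"
      using K unfolding realization_open_def by blast
    fix \<sigma> assume "\<sigma> \<in> X"
    then have "openin (top_of_set (simplex_points \<sigma>)) (\<Union>K\<in>\<K>. K \<inter> simplex_points \<sigma>)"
      using K unfolding realization_open_def by (intro openin_Union) blast
    then show "openin (top_of_set (simplex_points \<sigma>)) (\<Union>\<K> \<inter> simplex_points \<sigma>)"
      by (simp only: Int_Union2)
  qed
qed

lemma openin_realization: "openin (realization X) U \<longleftrightarrow> realization_open X U"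
  by (simp add: realization_def istopology_realization)

lemma topspace_realization: "topspace (realization X) = (\<Union>\<sigma>\<in>X. simplex_points \<sigma>)"
proof -
  have "simplex_points \<tau> \<inter> (\<Union>\<sigma>\<in>X. simplex_points \<sigma>) = simplex_points \<tau>" if "\<tau> \<in> X" for \<tau>
    using that by blast
  then have "realization_open X (\<Union>\<sigma>\<in>X. simplex_points \<sigma>)"
    by (simp add: realization_open_def Int_commute)
  then show ?thesis
    unfolding topspace_def openin_realization by (auto simp: realization_open_def)
qed

text \<open>\<^const>\<open>contractible_space\<close> also holds of the empty space, which is excluded here.\<close>

definition contractible_complex :: "'v set set \<Rightarrow> bool" where
  "contractible_complex X \<longleftrightarrow> X \<noteq> {} \<and> contractible_space (realization X)"


section \<open>Groups of type F\<close>

text \<open>The discrete group is written additively, as an element of the not necessarily commutative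
  class \<^class>\<open>group_add\<close>; its group algebra is then \<open>'g \<Rightarrow>\<^sub>0 real\<close> with the convolution product.
  A simplicial action is given by its effect on the vertices.\<close>

definition simplicial_action :: "'v set set \<Rightarrow> ('g::group_add \<Rightarrow> 'v \<Rightarrow> 'v) \<Rightarrow> bool" where
  "simplicial_action X act \<longleftrightarrow>
     (\<forall>v\<in>\<Union>X. act 0 v = v) \<and>
     (\<forall>\<gamma> \<delta>. \<forall>v\<in>\<Union>X. act (\<gamma> + \<delta>) v = act \<gamma> (act \<delta> v)) \<and>
     (\<forall>\<gamma>. \<forall>\<sigma>\<in>X. act \<gamma> ` \<sigma> \<in> X)"

text \<open>Freeness on the realization: an element fixing a point stabilizes the simplex carrying that
  point, and an element stabilizing a simplex as a set fixes its barycentre.\<close>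

definition free_action :: "'v set set \<Rightarrow> ('g::group_add \<Rightarrow> 'v \<Rightarrow> 'v) \<Rightarrow> bool" where
  "free_action X act \<longleftrightarrow> (\<forall>\<gamma>. \<forall>\<sigma>\<in>X. act \<gamma> ` \<sigma> = \<sigma> \<longrightarrow> \<gamma> = 0)"

definition simplex_orbit :: "('g \<Rightarrow> 'v \<Rightarrow> 'v) \<Rightarrow> 'v set \<Rightarrow> 'v set set" where
  "simplex_orbit act \<sigma> = range (\<lambda>\<gamma>. act \<gamma> ` \<sigma>)"

definition orbits :: "'v set set \<Rightarrow> ('g \<Rightarrow> 'v \<Rightarrow> 'v) \<Rightarrow> nat \<Rightarrow> 'v set set set" where
  "orbits X act n = simplex_orbit act ` simplices X n"

definition num_orbits :: "'v set set \<Rightarrow> ('g \<Rightarrow> 'v \<Rightarrow> 'v) \<Rightarrow> nat \<Rightarrow> nat" where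
  "num_orbits X act n = card (orbits X act n)"

text \<open>\<open>X\<close> with the action \<open>act\<close> witnesses that the group is of type $F_m$.\<close>

definition type_F_complex :: "nat \<Rightarrow> 'v set set \<Rightarrow> ('g::group_add \<Rightarrow> 'v \<Rightarrow> 'v) \<Rightarrow> bool" where
  "type_F_complex m X act \<longleftrightarrow>
     abstract_complex X \<and> locally_finite_complex X \<and> contractible_complex X \<and>
     simplicial_action X act \<and> free_action X act \<and> (\<forall>n\<le>m. finite (orbits X act n))"


section \<open>Orientations and codifferentials\<close>

text \<open>For \<open>xs\<close> with distinct entries there is at most one permutation turning \<open>xs\<close> into \<open>ys\<close>;
  \<open>rel_sign xs ys\<close> is its sign, and 0 if there is none.\<close>

definition rel_sign :: "'v list \<Rightarrow> 'v list \<Rightarrow> int" where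
  "rel_sign xs ys = (\<Sum>p | p permutes {..<length xs} \<and> permute_list p xs = ys. sign p)"

text \<open>An orientation of a simplex is a class of orderings of its vertices up to even permutations;
  \<open>ori \<sigma>\<close> is an ordering in the chosen class.\<close>

definition invariant_orientation ::
  "'v set set \<Rightarrow> ('g::group_add \<Rightarrow> 'v \<Rightarrow> 'v) \<Rightarrow> ('v set \<Rightarrow> 'v list) \<Rightarrow> bool" where
  "invariant_orientation X act ori \<longleftrightarrow>
     (\<forall>\<sigma>\<in>X. distinct (ori \<sigma>) \<and> set (ori \<sigma>) = \<sigma> \<and>
        (\<forall>\<gamma>. rel_sign (map (act \<gamma>) (ori \<sigma>)) (ori (act \<gamma> ` \<sigma>)) = 1))"

definition orbit_representatives ::
  "nat \<Rightarrow> 'v set set \<Rightarrow> ('g \<Rightarrow> 'v \<Rightarrow> 'v) \<Rightarrow> (nat \<Rightarrow> nat \<Rightarrow> 'v set) \<Rightarrow> bool" where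
  "orbit_representatives m X act \<tau> \<longleftrightarrow>
     (\<forall>n\<le>m. (\<forall>i<num_orbits X act n. \<tau> n i \<in> simplices X n) \<and>
        bij_betw (\<lambda>i. simplex_orbit act (\<tau> n i)) {..<num_orbits X act n} (orbits X act n))"

text \<open>Simplicial chains have the simplices with their chosen orientation as basis: the ordered
  simplex $[v_0,\dots,v_p]$ is \<open>\<plusminus>\<close> the basis element, according to its orientation, and its
  boundary is $\sum_i (-1)^i [v_0,\dots,\widehat{v_i},\dots,v_p]$.\<close>

definition ordered_simplex :: "('v set \<Rightarrow> 'v list) \<Rightarrow> int \<Rightarrow> 'v list \<Rightarrow> 'v set \<Rightarrow>\<^sub>0 int" where
  "ordered_simplex ori c xs = Poly_Mapping.single (set xs) (c * rel_sign xs (ori (set xs)))"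

definition boundary :: "('v set \<Rightarrow> 'v list) \<Rightarrow> 'v set \<Rightarrow> 'v set \<Rightarrow>\<^sub>0 int" where
  "boundary ori \<sigma> =
     (\<Sum>i<length (ori \<sigma>). ordered_simplex ori ((-1) ^ i) (take i (ori \<sigma>) @ drop (Suc i) (ori \<sigma>)))"

text \<open>The coefficients in $\partial\tau^{n+1}_i = \sum_j \sum_\gamma \varepsilon_{ij}(\gamma)\,
  \gamma\tau^n_j$; by freeness, the simplices $\gamma\tau^n_j$ are pairwise distinct.\<close>

definition boundary_coeff ::
  "('g \<Rightarrow> 'v \<Rightarrow> 'v) \<Rightarrow> ('v set \<Rightarrow> 'v list) \<Rightarrow> (nat \<Rightarrow> nat \<Rightarrow> 'v set) \<Rightarrow> nat \<Rightarrow> nat \<Rightarrow> nat \<Rightarrow> 'g \<Rightarrow> int" where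
  "boundary_coeff act ori \<tau> n i j \<gamma> =
     Poly_Mapping.lookup (boundary ori (\<tau> (n + 1) i)) (act \<gamma> ` \<tau> n j)"

lemma face_simplex:
  assumes X: "abstract_complex X" and or: "invariant_orientation X act ori"
    and s: "\<sigma> \<in> simplices X (n + 1)" and r: "\<rho> \<in> Poly_Mapping.keys (boundary ori \<sigma>)"
  shows "\<rho> \<in> simplices X n"
proof -
  let ?del = "\<lambda>i. take i (ori \<sigma>) @ drop (Suc i) (ori \<sigma>)"
  have sX: "\<sigma> \<in> X" and c: "card \<sigma> = n + 2" using s by (auto simp: simplices_def)
  have d: "distinct (ori \<sigma>)" "set (ori \<sigma>) = \<sigma>"
    using or sX by (auto simp: invariant_orientation_def)
  have len: "length (ori \<sigma>) = n + 2" using d c distinct_card by metis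
  have "\<rho> \<in> (\<Union>i<length (ori \<sigma>). Poly_Mapping.keys (ordered_simplex ori ((-1) ^ i) (?del i)))"
    using r unfolding boundary_def by (rule subsetD[OF keys_sum])
  then obtain i where i: "i < length (ori \<sigma>)" "\<rho> = set (?del i)"
    by (auto simp: ordered_simplex_def split: if_splits)
  have dd: "distinct (?del i)"
  proof -
    have "distinct (take i (ori \<sigma>) @ ori \<sigma> ! i # drop (Suc i) (ori \<sigma>))"
      by (subst id_take_nth_drop[OF i(1), symmetric]) (rule d(1))
    then show ?thesis by simp
  qed
  have ss: "set (?del i) \<subseteq> \<sigma>"
    using set_take_subset[of i "ori \<sigma>"] set_drop_subset[of "Suc i" "ori \<sigma>"] d(2) by simp
  have "card \<rho> = length (?del i)" unfolding i(2) by (rule distinct_card[OF dd])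
  then have "card \<rho> = n + 1" using i(1) len by simp
  moreover from this have "\<rho> \<noteq> {}" by auto
  ultimately show ?thesis using X sX ss unfolding i(2) simplices_def abstract_complex_def by blast
qed

lemma boundary_expansion:
  assumes F: "type_F_complex (n + 1) X act" and or: "invariant_orientation X act ori"
    and reps: "orbit_representatives (n + 1) X act \<tau>" and i: "i < num_orbits X act (n + 1)"
  shows "\<And>j. j < num_orbits X act n \<Longrightarrow> finite {\<gamma>. boundary_coeff act ori \<tau> n i j \<gamma> \<noteq> 0}"
    and "boundary ori (\<tau> (n + 1) i) =
      (\<Sum>j<num_orbits X act n. \<Sum>\<gamma> | boundary_coeff act ori \<tau> n i j \<gamma> \<noteq> 0.
        Poly_Mapping.single (act \<gamma> ` \<tau> n j) (boundary_coeff act ori \<tau> n i j \<gamma>))"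
proof -
  let ?B = "boundary ori (\<tau> (n + 1) i)" and ?k = "num_orbits X act n"
  let ?G = "\<lambda>j. {\<gamma>. boundary_coeff act ori \<tau> n i j \<gamma> \<noteq> 0}"
  let ?P = "Sigma {..<?k} ?G" and ?f = "\<lambda>(j, \<gamma>). act \<gamma> ` \<tau> n j"
  have X: "abstract_complex X" and sa: "simplicial_action X act" and fr: "free_action X act"
    using F by (auto simp: type_F_complex_def)
  have tX: "\<tau> n j \<in> simplices X n" if "j < ?k" for j
    using reps that by (auto simp: orbit_representatives_def)
  have bij: "bij_betw (\<lambda>i. simplex_orbit act (\<tau> n i)) {..<?k} (orbits X act n)"
    using reps by (auto simp: orbit_representatives_def)
  have comp: "act \<gamma> ` act \<delta> ` \<sigma> = act (\<gamma> + \<delta>) ` \<sigma>" if "\<sigma> \<in> X" for \<gamma> \<delta> \<sigma>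
    unfolding image_image by (rule image_cong) (use sa that in \<open>auto simp: simplicial_action_def\<close>)
  have act0: "act 0 ` \<sigma> = \<sigma>" if "\<sigma> \<in> X" for \<sigma>
    using sa that by (force simp: simplicial_action_def)
  have eqD: "j = j' \<and> \<gamma> = \<gamma>'"
    if "j < ?k" "j' < ?k" "act \<gamma> ` \<tau> n j = act \<gamma>' ` \<tau> n j'" for j j' \<gamma> \<gamma>'
  proof -
    have t: "\<tau> n j \<in> X" "\<tau> n j' \<in> X" using tX that by (auto simp: simplices_def)
    have e: "act (\<delta> + \<gamma>) ` \<tau> n j = act (\<delta> + \<gamma>') ` \<tau> n j'" for \<delta>
      using that(3) comp[OF t(1)] comp[OF t(2)] by metis
    have "simplex_orbit act (\<tau> n j) = simplex_orbit act (\<tau> n j')"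
      unfolding simplex_orbit_def
    proof (intro equalityI subsetI; elim imageE; clarify)
      fix \<delta>
      show "act \<delta> ` \<tau> n j \<in> range (\<lambda>\<gamma>. act \<gamma> ` \<tau> n j')"
        using e[of "\<delta> - \<gamma>"] by auto
      show "act \<delta> ` \<tau> n j' \<in> range (\<lambda>\<gamma>. act \<gamma> ` \<tau> n j)"
        using e[of "\<delta> - \<gamma>'"] by (auto simp: image_iff) metis
    qed
    then have j: "j = j'" using bij that(1,2) by (auto simp: bij_betw_def inj_on_def)
    have "act (- \<gamma>' + \<gamma>) ` \<tau> n j = \<tau> n j" using e[of "- \<gamma>'"] j act0 t by simp
    then have "- \<gamma>' + \<gamma> = 0" using fr t by (auto simp: free_action_def)
    then show ?thesis using j by (metis add.inverse_inverse eq_neg_iff_add_eq_0 neg_eq_iff_add_eq_0)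
  qed
  have inj: "inj_on ?f ?P" by (auto simp: inj_on_def dest: eqD)
  have img: "?f ` ?P = Poly_Mapping.keys ?B"
  proof (intro equalityI subsetI)
    fix \<rho> assume "\<rho> \<in> ?f ` ?P"
    then show "\<rho> \<in> Poly_Mapping.keys ?B" by (auto simp: boundary_coeff_def in_keys_iff)
  next
    fix \<rho> assume r: "\<rho> \<in> Poly_Mapping.keys ?B"
    have "\<tau> (n + 1) i \<in> simplices X (n + 1)"
      using reps i by (auto simp: orbit_representatives_def)
    then have rX: "\<rho> \<in> simplices X n" using face_simplex[OF X or _ r] by blast
    then have "simplex_orbit act \<rho> \<in> (\<lambda>i. simplex_orbit act (\<tau> n i)) ` {..<?k}"
      using bij by (auto simp: orbits_def bij_betw_def)
    then obtain j where j: "j < ?k" "simplex_orbit act \<rho> = simplex_orbit act (\<tau> n j)" by blast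
    have "\<rho> = act 0 ` \<rho>" using act0 rX by (simp add: simplices_def)
    then have "\<rho> \<in> simplex_orbit act \<rho>" unfolding simplex_orbit_def by (rule range_eqI)
    then have "\<rho> \<in> simplex_orbit act (\<tau> n j)" by (simp only: j(2))
    then obtain \<gamma> where g: "\<rho> = act \<gamma> ` \<tau> n j" unfolding simplex_orbit_def by blast
    then have "(j, \<gamma>) \<in> ?P" using j(1) r by (simp add: boundary_coeff_def in_keys_iff)
    then show "\<rho> \<in> ?f ` ?P" unfolding g by (rule rev_image_eqI) simp
  qed
  have finP: "finite ?P" using inj img finite_imageD finite_keys by metis
  have fin: "finite (?G j)" if "j < ?k" for j
  proof (rule finite_subset)
    show "?G j \<subseteq> snd ` ?P" using that by force
  qed (use finP in blast)
  then show "\<And>j. j < ?k \<Longrightarrow> finite (?G j)" .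
  have "?B = (\<Sum>\<rho>\<in>Poly_Mapping.keys ?B. Poly_Mapping.single \<rho> (Poly_Mapping.lookup ?B \<rho>))"
    by (rule poly_mapping_eqI)
      (simp add: lookup_sum lookup_single when_def in_keys_iff sum.delta)
  also have "\<dots> = (\<Sum>p\<in>?P. Poly_Mapping.single (?f p) (Poly_Mapping.lookup ?B (?f p)))"
    unfolding img[symmetric] using inj by (simp add: sum.reindex)
  also have "\<dots> = (\<Sum>j<?k. \<Sum>\<gamma>\<in>?G j. Poly_Mapping.single (act \<gamma> ` \<tau> n j) (boundary_coeff act ori \<tau> n i j \<gamma>))"
    by (subst sum.Sigma) (use fin in \<open>auto simp: boundary_coeff_def intro!: sum.cong\<close>)
  finally show "?B = \<dots>" .
qed

definition codifferential ::
  "'v set set \<Rightarrow> ('g::group_add \<Rightarrow> 'v \<Rightarrow> 'v) \<Rightarrow> ('v set \<Rightarrow> 'v list) \<Rightarrow> (nat \<Rightarrow> nat \<Rightarrow> 'v set) \<Rightarrow>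
     nat \<Rightarrow> ('g \<Rightarrow>\<^sub>0 real) mat" where
  "codifferential X act ori \<tau> n =
     Matrix.mat (num_orbits X act (n + 1)) (num_orbits X act n)
       (\<lambda>(i, j). \<Sum>\<gamma> | boundary_coeff act ori \<tau> n i j \<gamma> \<noteq> 0.
          Poly_Mapping.single \<gamma> (of_int (boundary_coeff act ori \<tau> n i j \<gamma>)))"


section \<open>Matrices over the group algebra\<close>

definition group_alg_star :: "('g::group_add \<Rightarrow>\<^sub>0 real) \<Rightarrow> ('g \<Rightarrow>\<^sub>0 real)" where
  "group_alg_star x = Poly_Mapping.map_key uminus x"

definition mat_star :: "('g::group_add \<Rightarrow>\<^sub>0 real) mat \<Rightarrow> ('g \<Rightarrow>\<^sub>0 real) mat" where
  "mat_star A = map_mat group_alg_star (transpose_mat A)"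

inductive_set sums_of_squares :: "nat \<Rightarrow> ('g::group_add \<Rightarrow>\<^sub>0 real) mat set" for k where
  zero: "0\<^sub>m k k \<in> sums_of_squares k"
| add: "a \<in> carrier_mat k k \<Longrightarrow> s \<in> sums_of_squares k \<Longrightarrow>
    mat_star a * a + s \<in> sums_of_squares k"

text \<open>In the following four definitions \<open>d\<close> is to be a codifferential $d_n$, whose format
  $k_{n+1} \times k_n$ determines the domains.\<close>

definition conj_map :: "('g::group_add \<Rightarrow>\<^sub>0 real) mat \<Rightarrow> ('g \<Rightarrow>\<^sub>0 real) mat \<Rightarrow> ('g \<Rightarrow>\<^sub>0 real) mat" where
  "conj_map d a = mat_star d * a * d"

definition im_conj :: "('g::group_add \<Rightarrow>\<^sub>0 real) mat \<Rightarrow> ('g \<Rightarrow>\<^sub>0 real) mat set" where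
  "im_conj d = conj_map d ` carrier_mat (dim_row d) (dim_row d)"

definition ker_conj :: "('g::group_add \<Rightarrow>\<^sub>0 real) mat \<Rightarrow> ('g \<Rightarrow>\<^sub>0 real) mat set" where
  "ker_conj d =
     {a \<in> carrier_mat (dim_row d) (dim_row d). conj_map d a = 0\<^sub>m (dim_col d) (dim_col d)}"

definition split_conj_space :: "('g::group_add \<Rightarrow>\<^sub>0 real) mat \<Rightarrow> ('g \<Rightarrow>\<^sub>0 real) mat set" where
  "split_conj_space d =
     {mat_star d * x + y * d | x y.
        x \<in> carrier_mat (dim_row d) (dim_col d) \<and> y \<in> carrier_mat (dim_col d) (dim_row d)}"

text \<open>A functional is a function on all matrices of which only the values on the subspace \<open>V\<close>
  matter; real scalars \<open>c\<close> act as \<open>single 0 c\<close>.\<close>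

definition linear_functional ::
  "('g::group_add \<Rightarrow>\<^sub>0 real) mat set \<Rightarrow> (('g \<Rightarrow>\<^sub>0 real) mat \<Rightarrow> real) \<Rightarrow> bool" where
  "linear_functional V \<phi> \<longleftrightarrow>
     (\<forall>a\<in>V. \<forall>b\<in>V. \<phi> (a + b) = \<phi> a + \<phi> b) \<and>
     (\<forall>c. \<forall>a\<in>V. \<phi> (Poly_Mapping.single 0 c \<cdot>\<^sub>m a) = c * \<phi> a)"

definition hermitian_functional ::
  "('g::group_add \<Rightarrow>\<^sub>0 real) mat set \<Rightarrow> (('g \<Rightarrow>\<^sub>0 real) mat \<Rightarrow> real) \<Rightarrow> bool" where
  "hermitian_functional V \<phi> \<longleftrightarrow> (\<forall>a\<in>V. \<phi> (mat_star a) = \<phi> a)"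

definition positive_functional ::
  "nat \<Rightarrow> ('g::group_add \<Rightarrow>\<^sub>0 real) mat set \<Rightarrow> (('g \<Rightarrow>\<^sub>0 real) mat \<Rightarrow> real) \<Rightarrow> bool" where
  "positive_functional k V \<phi> \<longleftrightarrow> (\<forall>a \<in> V \<inter> sums_of_squares k. 0 \<le> \<phi> a)"


section \<open>Representations and cocycles\<close>

text \<open>A real Hilbert space is a closed subspace \<open>H\<close> of a complete real inner product space.\<close>

definition unitary_rep ::
  "'h::{real_inner,complete_space} set \<Rightarrow> ('g::group_add \<Rightarrow> 'h \<Rightarrow> 'h) \<Rightarrow> bool" where
  "unitary_rep H \<pi> \<longleftrightarrow>
     Real_Vector_Spaces.subspace H \<and> closed H \<and>
     (\<forall>\<gamma>. \<pi> \<gamma> ` H = H \<and>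
        (\<forall>x\<in>H. \<forall>y\<in>H. \<pi> \<gamma> (x + y) = \<pi> \<gamma> x + \<pi> \<gamma> y) \<and>
        (\<forall>c. \<forall>x\<in>H. \<pi> \<gamma> (c *\<^sub>R x) = c *\<^sub>R \<pi> \<gamma> x) \<and>
        (\<forall>x\<in>H. norm (\<pi> \<gamma> x) = norm x)) \<and>
     (\<forall>x\<in>H. \<pi> 0 x = x) \<and>
     (\<forall>\<gamma> \<delta>. \<forall>x\<in>H. \<pi> (\<gamma> + \<delta>) x = \<pi> \<gamma> (\<pi> \<delta> x))"

definition rep_alg :: "('g \<Rightarrow> 'h \<Rightarrow> 'h) \<Rightarrow> ('g::group_add \<Rightarrow>\<^sub>0 real) \<Rightarrow> 'h \<Rightarrow> 'h::real_vector" where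
  "rep_alg \<pi> a x = (\<Sum>\<gamma>\<in>Poly_Mapping.keys a. Poly_Mapping.lookup a \<gamma> *\<^sub>R \<pi> \<gamma> x)"

definition rep_mat ::
  "('g \<Rightarrow> 'h \<Rightarrow> 'h) \<Rightarrow> ('g::group_add \<Rightarrow>\<^sub>0 real) mat \<Rightarrow> 'h vec \<Rightarrow> 'h::real_vector vec" where
  "rep_mat \<pi> A z =
     Matrix.vec (dim_row A) (\<lambda>i. \<Sum>j<dim_col A. rep_alg \<pi> (A $$ (i, j)) (z $ j))"

definition vecs_over :: "'h set \<Rightarrow> nat \<Rightarrow> 'h vec set" where
  "vecs_over H k = {z \<in> carrier_vec k. \<forall>i<k. z $ i \<in> H}"

definition vec_inner :: "'h::real_inner vec \<Rightarrow> 'h vec \<Rightarrow> real" where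
  "vec_inner z w = (\<Sum>i<dim_vec z. inner (z $ i) (w $ i))"

definition cocycles ::
  "'h::real_vector set \<Rightarrow> ('g \<Rightarrow> 'h \<Rightarrow> 'h) \<Rightarrow> ('g::group_add \<Rightarrow>\<^sub>0 real) mat \<Rightarrow> 'h vec set" where
  "cocycles H \<pi> d = {z \<in> vecs_over H (dim_col d). rep_mat \<pi> d z = 0\<^sub>v (dim_row d)}"

definition cyclic_vec ::
  "'h::real_inner set \<Rightarrow> ('g::group_add \<Rightarrow> 'h \<Rightarrow> 'h) \<Rightarrow> nat \<Rightarrow> 'h vec \<Rightarrow> bool" where
  "cyclic_vec H \<pi> k z \<longleftrightarrow>
     (\<forall>w\<in>vecs_over H k. \<forall>e>0. \<exists>a\<in>carrier_mat k k.
        L2_set (\<lambda>i. norm (rep_mat \<pi> a z $ i - w $ i)) {..<k} < e)"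

end

theory Submission
  imports Defs "HOL-Homology.Homology"
begin

text \<open>Part (1) is a GNS construction: $a \mapsto \phi(d_{n-1}^* a d_{n-1})$ is given by the numbers
  $K((\gamma,j),(\delta,i)) = \phi(d_{n-1}^* E_{ij}(\delta^{-1}\gamma) d_{n-1})$, a positive definite
  $\Gamma$-invariant kernel, which is realized by vectors of a Hilbert space; \<open>z\<close> consists of the vectors
  at $\gamma = 1$, and $\|\pi(d_n) z\|^2 = 0$ because $d_n d_{n-1} = 0$.

  For part (2), the functional is well defined since $\langle \pi(a)z, z\rangle = 0$ for
  $a \in \mathcal{SC}_n$.  Positivity needs the acyclicity of \<open>X\<close>: if
  $d_{n-1}^* a d_{n-1} = \sum b_i^* b_i$, then the rows of the $b_i$ are (reduced) cycles, so that
  $b_i = c_i d_{n-1}$ and $\phi(\sum b_i^* b_i) = \sum \|\pi(c_i) z\|^2$.  Acyclicity of the simplicial chains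
  comes from singular homology: a simplicial cycle is a singular boundary in the contractible
  realization, an iterated subdivision of the bounding chain is pushed back to the vertices of \<open>X\<close>, and
  by Sperner's lemma this recovers the given cycle.  Integral fillings, chosen simplex by simplex, form
  a chain contraction, which extends to real coefficients.\<close>

no_notation vec_nth (infixl \<open>$\<close> 90)
hide_const (open) Finite_Cartesian_Product.vec Finite_Cartesian_Product.mat

section \<open>Positive definite kernels\<close>

text \<open>The usual GNS space, a completed quotient of the group algebra, would be a new type,
  whereas the representation has to live on a closed subspace of the fixed space of families on
  \<Gamma> x nat. Hence vectors with the prescribed inner products are built inside that space;
  \<Gamma> may be uncountable, so Zorn's lemma takes the place of a step-by-step orthogonalization.

  In part (2) the obstacle is that d* a d may be a sum of squares without a being one. The
  hypothesis on the kernel allows a to be replaced by any other preimage, so one that is a sum of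
  squares has to be found, and for this each b_i is divided by d_{n-1} on the right. But the rows of
  c in b = c d can be chosen one by one, and solving for a single row is a question about real
  chains, for which a real-linear contraction suffices.\<close>

lemma in_span_imageE:
  fixes f :: "'a \<Rightarrow> 'b::real_vector"
  assumes "x \<in> span (f ` T)"
  obtains F c where "finite F" "F \<subseteq> T" "x = (\<Sum>t\<in>F. c t *\<^sub>R f t)"
proof -
  obtain S r where S: "finite S" "S \<subseteq> f ` T" "x = (\<Sum>a\<in>S. r a *\<^sub>R a)"
    using assms unfolding span_explicit by auto
  \<comment> \<open>Choosing one index for each vector turns coefficients of vectors into
    coefficients of indices, the form in which positivity of a kernel is stated.\<close>
  obtain U where U: "U \<subseteq> T" "inj_on f U" "S = f ` U"
    using S(2) subset_image_inj by metis
  have "finite U" using S(1) U finite_imageD by blast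
  then show ?thesis
    using that[of U "\<lambda>t. r (f t)"] U S(3) by (simp add: sum.reindex)
qed

lemma closed_inner_right_eq: "closed {x :: 'a::real_inner. inner x y = c}"
  by (rule closed_Collect_eq) (intro continuous_intros)+

lemma closed_subspace_orthogonal:
  fixes y :: "'h::real_inner"
  assumes "\<And>x. x \<in> V \<Longrightarrow> inner x y = 0" "z \<in> closure (span V)"
  shows "inner z y = 0"
proof -
  have "span V \<subseteq> {x. inner x y = 0}"
    by (rule span_minimal)
      (use assms in \<open>auto simp: subspace_def inner_left_distrib\<close>)
  then have "closure (span V) \<subseteq> {x. inner x y = 0}"
    by (rule closure_minimal) (rule closed_inner_right_eq)
  then show ?thesis using assms by blast
qed

text \<open>\<open>W\<close> is the graph of the functional; the representing vector is the limit of a minimizing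
  sequence of $\|y\|^2 - 2r$ over $(y, r) \in W$.\<close>

lemma riesz_on_subspace:
  fixes W :: "('h::{real_inner,complete_space} \<times> real) set"
  assumes W: "subspace W"
    and bd: "\<And>y r. (y, r) \<in> W \<Longrightarrow> 0 \<le> M - 2 * r + inner y y"
  obtains p where "p \<in> closure (fst ` W)" "\<And>y r. (y, r) \<in> W \<Longrightarrow> inner p y = r" "inner p p \<le> M"
proof -
  define Q where "Q = (\<lambda>w :: 'h \<times> real. inner (fst w) (fst w) - 2 * snd w)"
  define m where "m = Inf (Q ` W)"
  have 0: "0 \<in> W" using W by (rule subspace_0)
  have "- M \<le> Q w" if "w \<in> W" for w
    using bd[of "fst w" "snd w"] that by (simp add: Q_def)
  then have bb: "bdd_below (Q ` W)" by (intro bdd_belowI2)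
  have m_le: "m \<le> Q w" if "w \<in> W" for w
    unfolding m_def using bb that by (intro cInf_lower) auto
  have "\<exists>w\<in>W. Q w < m + 1 / real (Suc n)" for n
    using cInf_lessD[of "Q ` W" "m + 1 / real (Suc n)"] 0 unfolding m_def by auto
  then obtain w where w: "\<And>n. w n \<in> W" "\<And>n. Q (w n) < m + 1 / real (Suc n)" by metis
  have Qlim: "(\<lambda>n. Q (w n)) \<longlonglongrightarrow> m"
  proof (rule tendsto_sandwich[of "\<lambda>_. m"])
    show "(\<lambda>n. m + 1 / real (Suc n)) \<longlonglongrightarrow> m"
      using tendsto_add[OF tendsto_const LIMSEQ_inverse_real_of_nat, of m] by (simp add: inverse_eq_divide)
    show "\<forall>\<^sub>F n in sequentially. m \<le> Q (w n)" using m_le w(1) by auto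
    show "\<forall>\<^sub>F n in sequentially. Q (w n) \<le> m + 1 / real (Suc n)"
      using w(2) by (auto intro!: always_eventually less_imp_le)
  qed simp
  \<comment> \<open>The midpoint of two elements of \<open>W\<close> is in \<open>W\<close>; with
    the parallelogram law this makes the first components of a minimizing sequence Cauchy.\<close>
  have par: "(norm (fst v - fst u))\<^sup>2 \<le> 2 * (Q v - m) + 2 * (Q u - m)" if "v \<in> W" "u \<in> W" for u v
  proof -
    have "(1 / 2) *\<^sub>R (v + u) \<in> W"
      using W that by (intro subspace_scale subspace_add)
    from m_le[OF this]
    have "4 * m \<le> 2 * Q v + 2 * Q u - inner (fst v - fst u) (fst v - fst u)"
      by (simp add: Q_def inner_add inner_diff inner_commute algebra_simps)
    then show ?thesis unfolding power2_norm_eq_inner by simp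
  qed
  have "Cauchy (\<lambda>n. fst (w n))"
  proof (rule metric_CauchyI)
    fix e :: real assume e: "0 < e"
    then have "\<forall>\<^sub>F n in sequentially. Q (w n) < m + e\<^sup>2 / 4"
      by (intro order_tendstoD[OF Qlim]) simp
    then obtain N where N: "\<And>n. n \<ge> N \<Longrightarrow> Q (w n) < m + e\<^sup>2 / 4"
      unfolding eventually_sequentially by blast
    have "dist (fst (w i)) (fst (w j)) < e" if "i \<ge> N" "j \<ge> N" for i j
    proof -
      have "(norm (fst (w i) - fst (w j)))\<^sup>2 < e\<^sup>2"
        using par[OF w(1)[of i] w(1)[of j]] N[OF that(1)] N[OF that(2)] by argo
      then show ?thesis unfolding dist_norm using e by (simp add: power2_less_imp_less)
    qed
    then show "\<exists>N. \<forall>i\<ge>N. \<forall>j\<ge>N. dist (fst (w i)) (fst (w j)) < e" by blast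
  qed
  then obtain p where p: "(\<lambda>n. fst (w n)) \<longlonglongrightarrow> p"
    using Cauchy_convergent convergent_def by blast
  have pc: "p \<in> closure (fst ` W)"
    using p w(1) unfolding closure_sequential by (intro exI[of _ "\<lambda>n. fst (w n)"]) auto
  have rep: "inner p y = r" if yr: "(y, r) \<in> W" for y r
  proof -
    \<comment> \<open>First variation. The limit \<open>p\<close> need not be the first component of
      an element of \<open>W\<close>, so the minimizing sequence is perturbed before passing to the
      limit. A quadratic in \<open>t\<close> without constant term that is nonnegative everywhere
      has no linear term.\<close>
    have q: "0 \<le> 2 * t * (inner p y - r) + t\<^sup>2 * inner y y" for t
    proof -
      have "m \<le> Q (w n + t *\<^sub>R (y, r))" for n
        by (intro m_le subspace_add[OF W] subspace_scale[OF W] w yr)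
      then have "m \<le> Q (w n) + 2 * t * (inner (fst (w n)) y - r) + t\<^sup>2 * inner y y" for n
        by (simp add: Q_def inner_add inner_commute algebra_simps power2_eq_square)
      moreover have "(\<lambda>n. Q (w n) + 2 * t * (inner (fst (w n)) y - r) + t\<^sup>2 * inner y y)
          \<longlonglongrightarrow> m + 2 * t * (inner p y - r) + t\<^sup>2 * inner y y"
        by (intro tendsto_intros Qlim p)
      ultimately have "m \<le> m + 2 * t * (inner p y - r) + t\<^sup>2 * inner y y"
        by (intro LIMSEQ_le_const) auto
      then show ?thesis by simp
    qed
    show ?thesis
    proof (rule ccontr)
      assume ne: "inner p y \<noteq> r"
      define a where "a = inner p y - r"
      \<comment> \<open>The test value will be \<open>t = - a / b\<close>; the summand 1 keeps
        \<open>b\<close> positive when \<open>y = 0\<close>.\<close>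
      define b where "b = inner y y + 1"
      have b: "b > 0" unfolding b_def by (simp add: add_nonneg_pos)
      have "0 \<le> 2 * (- a / b) * a + (- a / b)\<^sup>2 * inner y y" using q[of "- a / b"] by (simp add: a_def)
      also have "\<dots> \<le> 2 * (- a / b) * a + (- a / b)\<^sup>2 * b"
        by (intro add_left_mono mult_left_mono) (auto simp: b_def)
      also have "\<dots> = - a\<^sup>2 / b" using b by (simp add: power2_eq_square field_simps)
      finally have "a\<^sup>2 \<le> 0" using b by (simp add: field_simps)
      then show False using ne by (simp add: a_def)
    qed
  qed
  \<comment> \<open>Since the second component on \<open>W\<close> is now known to be the inner
    product with \<open>p\<close>, the hypothesis along the minimizing sequence tends to
    \<open>0 \<le> M - inner p p\<close>.\<close>
  have "0 \<le> M - 2 * inner p (fst (w n)) + inner (fst (w n)) (fst (w n))" for n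
    using bd[of "fst (w n)" "snd (w n)"] rep[of "fst (w n)" "snd (w n)"] w(1)[of n] by simp
  moreover have "(\<lambda>n. M - 2 * inner p (fst (w n)) + inner (fst (w n)) (fst (w n)))
      \<longlonglongrightarrow> M - 2 * inner p p + inner p p"
    by (intro tendsto_intros p)
  ultimately have "0 \<le> M - 2 * inner p p + inner p p"
    by (intro LIMSEQ_le_const) auto
  then have "inner p p \<le> M" by simp
  with pc rep show ?thesis by (rule that)
qed

definition psd_kernel :: "('i \<Rightarrow> 'i \<Rightarrow> real) \<Rightarrow> bool" where
  "psd_kernel K \<longleftrightarrow> (\<forall>s t. K s t = K t s) \<and>
     (\<forall>F c. finite F \<longrightarrow> 0 \<le> (\<Sum>s\<in>F. \<Sum>t\<in>F. c s * c t * K s t))"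

text \<open>\<open>p\<close> is the projection that a vector for the index \<open>s\<close> must
  have on the closed span of the others; \<open>kernel_realization\<close> adds the missing squared
  length \<open>K s s - inner p p\<close> in a new direction. Describing the functional
  \<open>e t \<mapsto> K s t\<close> by its graph spares a separate proof that it respects linear
  relations among the \<open>e t\<close>: the Riesz argument yields this as well.\<close>

lemma kernel_extension:
  fixes e :: "'i \<Rightarrow> 'h::{real_inner,complete_space}"
  assumes K: "psd_kernel K" and s: "s \<notin> T"
    and e: "\<And>t u. t \<in> T \<Longrightarrow> u \<in> T \<Longrightarrow> inner (e t) (e u) = K t u"
  obtains p where "p \<in> closure (span (e ` T))"
    "\<And>t. t \<in> T \<Longrightarrow> inner p (e t) = K s t" "inner p p \<le> K s s"
proof -
  let ?f = "\<lambda>t. (e t, K s t)"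
  let ?W = "span (?f ` T)"
  have bd: "0 \<le> K s s - 2 * r + inner y y" if yr: "(y, r) \<in> ?W" for y r
  proof -
    obtain F c where F: "finite F" "F \<subseteq> T" "(y, r) = (\<Sum>t\<in>F. c t *\<^sub>R ?f t)"
      using in_span_imageE[OF yr] by metis
    have y: "y = (\<Sum>t\<in>F. c t *\<^sub>R e t)" and r: "r = (\<Sum>t\<in>F. c t * K s t)"
      using arg_cong[OF F(3), of fst] arg_cong[OF F(3), of snd] by (simp_all add: fst_sum snd_sum)
    have sym: "K t u = K u t" for t u using K by (auto simp: psd_kernel_def)
    have yy: "inner y y = (\<Sum>t\<in>F. \<Sum>u\<in>F. c t * c u * K t u)"
      unfolding y inner_sum_left inner_sum_right
      using F(2) sym by (auto intro!: sum.cong simp: e subset_iff)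
    \<comment> \<open>With these coefficients positivity of \<open>K\<close> says that the squared
      norm expected of e_s - y is nonnegative.\<close>
    define c' where "c' = (\<lambda>t. if t = s then 1 else - c t)"
    have sF: "s \<notin> F" using s F(2) by blast
    have symF: "K t s = K s t" if "t \<in> F" for t by (rule sym)
    have [simp]: "c' s = 1" by (simp add: c'_def)
    have cF: "t \<in> F \<Longrightarrow> c' t = - c t" for t using sF by (auto simp: c'_def)
    have "0 \<le> (\<Sum>t\<in>insert s F. \<Sum>u\<in>insert s F. c' t * c' u * K t u)"
      using K F(1) unfolding psd_kernel_def by blast
    also have "\<dots> = K s s + (\<Sum>u\<in>F. c' u * K s u) + ((\<Sum>t\<in>F. c' t * K s t) + (\<Sum>t\<in>F. \<Sum>u\<in>F. c' t * c' u * K t u))"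
      using F(1) sF symF by (simp add: sum.distrib cong: sum.cong)
    also have "\<dots> = K s s - 2 * r + inner y y"
      unfolding yy r by (simp add: cF sum_negf cong: sum.cong)
    finally show ?thesis .
  qed
  obtain p where p: "p \<in> closure (fst ` ?W)" "\<And>y r. (y, r) \<in> ?W \<Longrightarrow> inner p y = r" "inner p p \<le> K s s"
    using riesz_on_subspace[OF subspace_span bd] by blast
  have "fst ` ?W = span (fst ` ?f ` T)"
    by (rule linear_span_image[symmetric])
      (simp add: bounded_linear.linear bounded_linear_fst)
  then have "fst ` ?W = span (e ` T)" by (simp add: image_image)
  with p(1) have "p \<in> closure (span (e ` T))" by simp
  moreover have "inner p (e t) = K s t" if "t \<in> T" for t
    using p(2) that by (intro p(2) span_base) auto
  ultimately show ?thesis using p(3) by (rule that)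
qed

text \<open>The families already constructed are ordered by inclusion of their graphs; the basis vectors
  \<open>b i\<close> of indices not yet used are kept orthogonal to them, so that there is room for the next one.\<close>

lemma kernel_realization:
  fixes b :: "'i \<Rightarrow> 'h::{real_inner,complete_space}"
  assumes K: "psd_kernel K"
    and b: "\<And>i j. inner (b i) (b j) = (if i = j then 1 else 0)"
  obtains e :: "'i \<Rightarrow> 'h" where "\<And>s t. inner (e s) (e t) = K s t"
proof -
  define A where "A = {G :: ('i \<times> 'h) set.
    (\<forall>(s, x)\<in>G. \<forall>(t, y)\<in>G. inner x y = K s t) \<and> (\<forall>(s, x)\<in>G. \<forall>i. i \<notin> Domain G \<longrightarrow> inner x (b i) = 0)}"
  have "\<exists>M\<in>A. \<forall>G\<in>A. M \<subseteq> G \<longrightarrow> G = M"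
  proof (rule subset_Zorn)
    fix C assume "subset.chain A C"
    then have CA: "C \<subseteq> A" and ch: "\<And>G H. G \<in> C \<Longrightarrow> H \<in> C \<Longrightarrow> G \<subseteq> H \<or> H \<subseteq> G"
      unfolding subset_chain_def by auto
    have "\<Union>C \<in> A"
      unfolding A_def
    proof (intro CollectI conjI ballI; clarify)
      fix s x t y G H assume *: "(s, x) \<in> G" "G \<in> C" "(t, y) \<in> H" "H \<in> C"
      then obtain G' where "G' \<in> C" "(s, x) \<in> G'" "(t, y) \<in> G'" using ch[of G H] by blast
      then show "inner x y = K s t" using CA unfolding A_def by blast
    next
      fix s x i G assume *: "(s, x) \<in> G" "G \<in> C" "i \<notin> Domain (\<Union>C)"
      then have "i \<notin> Domain G" by blast
      then show "inner x (b i) = 0" using * CA unfolding A_def by blast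
    qed
    then show "\<exists>U\<in>A. \<forall>G\<in>C. G \<subseteq> U" by blast
  qed
  then obtain M where M: "M \<in> A" and max: "\<And>G. G \<in> A \<Longrightarrow> M \<subseteq> G \<Longrightarrow> G = M" by blast
  define T where "T = Domain M"
  define e where "e = (\<lambda>t. SOME x. (t, x) \<in> M)"
  have eM: "(t, e t) \<in> M" if "t \<in> T" for t
    using that unfolding e_def T_def by (auto intro: someI)
  have Me: "x = e t" "t \<in> T" if "(t, x) \<in> M" for t x
  proof -
    show t: "t \<in> T" using that by (auto simp: T_def)
    \<comment> \<open>A member of \<open>A\<close> is single-valued: vectors with the same index
      \<open>t\<close> have all their inner products equal to \<open>K t t\<close>, so their
      difference has norm 0.\<close>
    have i: "inner u v = K t t" if "(t, u) \<in> M" "(t, v) \<in> M" for u v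
      using M that unfolding A_def by blast
    have "inner (x - e t) (x - e t) = 0"
      using i that eM[OF t] by (simp add: inner_diff)
    then show "x = e t" by simp
  qed
  have ee: "inner (e t) (e u) = K t u" if "t \<in> T" "u \<in> T" for t u
    using M eM[OF that(1)] eM[OF that(2)] unfolding A_def by blast
  have eb: "inner (e t) (b i) = 0" if "t \<in> T" "i \<notin> T" for t i
    using M eM[OF that(1)] that(2) unfolding A_def T_def by blast
  have "T = UNIV"
  proof (rule ccontr)
    assume "T \<noteq> UNIV"
    then obtain s where s: "s \<notin> T" by blast
    obtain p where p: "p \<in> closure (span (e ` T))"
        "\<And>t. t \<in> T \<Longrightarrow> inner p (e t) = K s t" "inner p p \<le> K s s"
      using kernel_extension[OF K s ee] by blast
    have pb: "inner p (b i) = 0" if "i \<notin> T" for i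
      by (rule closed_subspace_orthogonal[OF _ p(1)]) (use eb that in auto)
    define x where "x = p + sqrt (K s s - inner p p) *\<^sub>R b s"
    have xe: "inner x (e t) = K s t" if "t \<in> T" for t
      using p(2)[OF that] eb[OF that s] by (simp add: x_def inner_add inner_commute)
    have xx: "inner x x = K s s"
      using p(3) pb[OF s] b by (simp add: x_def inner_add inner_commute)
    have xb: "inner x (b i) = 0" if "i \<notin> insert s T" for i
      using that pb[of i] b[of s i] by (auto simp: x_def inner_add)
    have sym: "K t u = K u t" for t u using K by (auto simp: psd_kernel_def)
    have "insert (s, x) M \<in> A"
      unfolding A_def
    proof (intro CollectI conjI ballI; clarify)
      fix t y u z assume "(t, y) \<in> insert (s, x) M" "(u, z) \<in> insert (s, x) M"
      then show "inner y z = K t u"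
        by (metis Me Pair_inject ee inner_commute insert_iff sym xe xx)
    next
      fix t y i assume "(t, y) \<in> insert (s, x) M" "i \<notin> Domain (insert (s, x) M)"
      then show "inner y (b i) = 0" using xb eb Me unfolding T_def by (metis Domain_insert Pair_inject insert_iff)
    qed
    then have "insert (s, x) M = M" by (rule max) blast
    then show False using s by (auto simp: T_def)
  qed
  then show ?thesis using ee that by blast
qed

section \<open>An orthonormal family, isometries of closed spans, and invariant kernels as unitary
  representations\<close>

lift_definition ell2_unit :: "'i \<Rightarrow> 'i ell2" is "\<lambda>i j. if j = i then 1 else 0"
  by (rule summable_on_cong_neutral[THEN iffD1, OF _ _ _ summable_on_finite[of "{i}" for i]]) auto

lemma inner_ell2_unit: "inner (ell2_unit i) (ell2_unit j) = (if i = j then 1 else 0)"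
proof transfer
  fix i j :: 'a
  have "(\<Sum>\<^sub>\<infinity>l. (if l = i then 1 else 0) * (if l = j then 1 else 0 :: real)) =
      (\<Sum>\<^sub>\<infinity>l\<in>{i}. (if l = i then 1 else 0) * (if l = j then 1 else 0))"
    by (rule infsum_cong_neutral) auto
  then show "(\<Sum>\<^sub>\<infinity>l. (if l = i then 1 else 0) * (if l = j then 1 else 0 :: real)) =
      (if i = j then 1 else 0)" by simp
qed

text \<open>The graph of the extended isometry is the closed span of the pairs \<open>(e s, e (\<sigma> s))\<close>.\<close>

lemma isometry_extension:
  fixes e :: "'i \<Rightarrow> 'h::{real_inner,complete_space}"
  assumes iso: "\<And>s t. inner (e (\<sigma> s)) (e (\<sigma> t)) = inner (e s) (e t)"
    and x: "x \<in> closure (span (range e))"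
  obtains y where "y \<in> closure (span (range e))"
    "\<And>s. inner y (e (\<sigma> s)) = inner x (e s)" "norm y = norm x"
proof -
  let ?V = "span (range e)"
  let ?G = "span (range (\<lambda>s. (e s, e (\<sigma> s))))"
  have sub: "subspace {p. snd p \<in> ?V \<and> (\<forall>s. inner (fst p) (e s) = inner (snd p) (e (\<sigma> s)))}"
    by (auto simp: subspace_def inner_left_distrib
        span_zero span_add span_scale)
  have G1: "?G \<subseteq> {p. snd p \<in> ?V \<and> (\<forall>s. inner (fst p) (e s) = inner (snd p) (e (\<sigma> s)))}"
    by (rule span_minimal[OF _ sub]) (auto simp: iso span_base)
  \<comment> \<open>\<open>G1\<close> compares an arbitrary pair with the generators only. Linearity
    in the second argument extends the comparison to two arbitrary pairs, and taking them equal
    shows that the relation preserves norms.\<close>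
  have Gq: "?G \<subseteq> {p. inner (fst q) (fst p) = inner (snd q) (snd p)}" if "q \<in> ?G" for q
  proof (rule span_minimal)
    show "range (\<lambda>s. (e s, e (\<sigma> s))) \<subseteq> {p. inner (fst q) (fst p) = inner (snd q) (snd p)}"
      using subsetD[OF G1 that] by auto
  qed (auto simp: subspace_def inner_right_distrib)
  have G2: "norm (fst p) = norm (snd p)" if "p \<in> ?G" for p
    using subsetD[OF Gq[OF that] that] by (simp add: norm_eq_sqrt_inner)
  have "fst ` ?G = span (fst ` range (\<lambda>s. (e s, e (\<sigma> s))))"
    by (rule linear_span_image[symmetric])
      (simp add: bounded_linear.linear bounded_linear_fst)
  then have fG: "fst ` ?G = ?V" by (simp add: image_image)
  obtain u where u: "\<And>n. u n \<in> ?V" "u \<longlonglongrightarrow> x"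
    using x unfolding closure_sequential by blast
  have "\<exists>v. (u n, v) \<in> ?G" for n using u(1)[of n] unfolding fG[symmetric] by force
  then obtain v where v: "\<And>n. (u n, v n) \<in> ?G" by metis
  have nuv: "norm (v i - v j) = norm (u i - u j)" for i j
    using G2[OF span_diff[OF v[of i] v[of j]]] by simp
  have "Cauchy u" using u(2) by (rule LIMSEQ_imp_Cauchy)
  then have "Cauchy v" unfolding Cauchy_def dist_norm nuv .
  then obtain y where y: "v \<longlonglongrightarrow> y" using Cauchy_convergent convergent_def by blast
  have "y \<in> closure ?V"
    using y subsetD[OF G1 v] unfolding closure_sequential by (intro exI[of _ v]) auto
  moreover have "inner y (e (\<sigma> s)) = inner x (e s)" for s
  proof (rule LIMSEQ_unique)
    show "(\<lambda>n. inner (v n) (e (\<sigma> s))) \<longlonglongrightarrow> inner y (e (\<sigma> s))" by (intro tendsto_intros y)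
    have eq: "inner (v n) (e (\<sigma> s)) = inner (u n) (e s)" for n using subsetD[OF G1 v[of n]] by auto
    then show "(\<lambda>n. inner (v n) (e (\<sigma> s))) \<longlonglongrightarrow> inner x (e s)" unfolding eq by (intro tendsto_intros u)
  qed
  moreover have "norm y = norm x"
  proof (rule LIMSEQ_unique)
    show "(\<lambda>n. norm (v n)) \<longlonglongrightarrow> norm y" by (intro tendsto_intros y)
    have eq: "norm (v n) = norm (u n)" for n using G2[OF v[of n]] by simp
    then show "(\<lambda>n. norm (v n)) \<longlonglongrightarrow> norm x" unfolding eq by (intro tendsto_intros u)
  qed
  ultimately show ?thesis by (rule that)
qed

lemma subspace_closure:
  fixes V :: "'h::real_normed_vector set"
  assumes "subspace V"
  shows "subspace (closure V)"
proof (rule subspaceI)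
  show "0 \<in> closure V" using assms closure_subset subspace_0 by blast
next
  fix x y assume "x \<in> closure V" "y \<in> closure V"
  then obtain f g where "\<And>n. f n \<in> V" "f \<longlonglongrightarrow> x" "\<And>n. g n \<in> V" "g \<longlonglongrightarrow> y"
    unfolding closure_sequential by blast
  then show "x + y \<in> closure V"
    unfolding closure_sequential
    by (intro exI[of _ "\<lambda>n. f n + g n"]) (auto intro: tendsto_add subspace_add[OF assms])
next
  fix x and c :: real assume "x \<in> closure V"
  then obtain f where "\<And>n. f n \<in> V" "f \<longlonglongrightarrow> x"
    unfolding closure_sequential by blast
  then show "c *\<^sub>R x \<in> closure V"
    unfolding closure_sequential
    by (intro exI[of _ "\<lambda>n. c *\<^sub>R f n"]) (auto intro: tendsto_scaleR subspace_scale[OF assms])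
qed

lemma orthogonal_imp_eq:
  fixes e :: "'i \<Rightarrow> 'h::real_inner"
  assumes "x \<in> closure (span (range e))" "y \<in> closure (span (range e))"
    and "\<And>s. inner x (e s) = inner y (e s)"
  shows "x = y"
proof -
  have xy: "x - y \<in> closure (span (range e))"
    using assms(1,2) subspace_closure[OF subspace_span] by (intro subspace_diff)
  have es: "inner (e s) (x - y) = 0" for s using assms(3)[of s] by (simp add: inner_diff inner_commute)
  have "inner (x - y) (x - y) = 0"
    by (rule closed_subspace_orthogonal[OF _ xy]) (use es in auto)
  then show ?thesis by simp
qed

text \<open>A vector of the closed span is determined by its inner products with the
  \<open>e s\<close>, and for \<open>\<pi> \<gamma> x\<close> these are the inner products of
  \<open>x\<close> at the indices shifted by \<open>- \<gamma>\<close>. Linearity and the group law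
  are checked on these numbers; surjectivity then comes from the group law.\<close>

lemma unitary_rep_of_kernel:
  fixes e :: "'g::group_add \<times> 'j \<Rightarrow> 'h::{real_inner,complete_space}"
  assumes inv: "\<And>\<gamma> \<delta> \<epsilon> i j. inner (e (\<gamma> + \<delta>, i)) (e (\<gamma> + \<epsilon>, j)) = inner (e (\<delta>, i)) (e (\<epsilon>, j))"
  obtains \<pi> where "unitary_rep (closure (span (range e))) \<pi>"
    "\<And>\<gamma> \<delta> j. \<pi> \<gamma> (e (\<delta>, j)) = e (\<gamma> + \<delta>, j)"
proof -
  let ?H = "closure (span (range e))"
  define \<sigma> :: "'g \<Rightarrow> 'g \<times> 'j \<Rightarrow> 'g \<times> 'j" where "\<sigma> = (\<lambda>\<gamma> s. (\<gamma> + fst s, snd s))"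
  have \<sigma>\<sigma>: "\<sigma> \<gamma> (\<sigma> \<delta> s) = \<sigma> (\<gamma> + \<delta>) s" and \<sigma>0: "\<sigma> 0 s = s" for \<gamma> \<delta> s
    by (simp_all add: \<sigma>_def add.assoc)
  have iso: "inner (e (\<sigma> \<gamma> s)) (e (\<sigma> \<gamma> t)) = inner (e s) (e t)" for \<gamma> s t
    using inv by (cases s; cases t) (simp add: \<sigma>_def)
  have ex: "\<exists>y. y \<in> ?H \<and> (\<forall>s. inner y (e (\<sigma> \<gamma> s)) = inner x (e s)) \<and> norm y = norm x"
    if "x \<in> ?H" for x \<gamma>
    using isometry_extension[of e "\<sigma> \<gamma>" x, OF iso that] by blast
  define \<pi> where "\<pi> = (\<lambda>\<gamma> x. SOME y. y \<in> ?H \<and> (\<forall>s. inner y (e (\<sigma> \<gamma> s)) = inner x (e s)) \<and> norm y = norm x)"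
  have "\<pi> \<gamma> x \<in> ?H \<and> (\<forall>s. inner (\<pi> \<gamma> x) (e (\<sigma> \<gamma> s)) = inner x (e s)) \<and> norm (\<pi> \<gamma> x) = norm x"
    if "x \<in> ?H" for x \<gamma>
    unfolding \<pi>_def by (rule someI_ex, rule ex) (rule that)
  then have \<pi>: "\<And>x \<gamma>. x \<in> ?H \<Longrightarrow> \<pi> \<gamma> x \<in> ?H"
    "\<And>x \<gamma> s. x \<in> ?H \<Longrightarrow> inner (\<pi> \<gamma> x) (e (\<sigma> \<gamma> s)) = inner x (e s)"
    "\<And>x \<gamma>. x \<in> ?H \<Longrightarrow> norm (\<pi> \<gamma> x) = norm x" by blast+
  have H: "subspace ?H" by (intro subspace_closure subspace_span)
  have eH: "e s \<in> ?H" for s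
    by (meson closure_subset span_base rangeI subsetD)
  have inner_\<pi>: "inner (\<pi> \<gamma> x) (e s) = inner x (e (\<sigma> (- \<gamma>) s))" if "x \<in> ?H" for x \<gamma> s
    using \<pi>(2)[OF that, of \<gamma> "\<sigma> (- \<gamma>) s"] by (simp add: \<sigma>\<sigma> \<sigma>0)
  have p0: "\<pi> 0 x = x" if "x \<in> ?H" for x
    by (rule orthogonal_imp_eq[OF \<pi>(1)[OF that] that]) (simp add: inner_\<pi> that \<sigma>0)
  have pp: "\<pi> (\<gamma> + \<delta>) x = \<pi> \<gamma> (\<pi> \<delta> x)" if "x \<in> ?H" for \<gamma> \<delta> x
    by (rule orthogonal_imp_eq[of _ e]) (use that in \<open>simp_all add: \<pi>(1) inner_\<pi> \<sigma>\<sigma> minus_add\<close>)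
  have "unitary_rep ?H \<pi>"
    unfolding unitary_rep_def
  proof (intro conjI allI ballI H closed_closure)
    fix \<gamma>
    show "\<pi> \<gamma> ` ?H = ?H"
    proof (intro equalityI subsetI)
      fix x assume x: "x \<in> ?H"
      then have "x = \<pi> \<gamma> (\<pi> (- \<gamma>) x)" using pp[of x \<gamma> "- \<gamma>"] p0 by simp
      then show "x \<in> \<pi> \<gamma> ` ?H" using \<pi>(1)[OF x] by blast
    qed (use \<pi>(1) in blast)
  next
    fix \<gamma> x y assume "x \<in> ?H" "y \<in> ?H"
    then show "\<pi> \<gamma> (x + y) = \<pi> \<gamma> x + \<pi> \<gamma> y"
      by (intro orthogonal_imp_eq[of _ e]) (simp_all add: \<pi>(1) inner_\<pi> inner_left_distrib subspace_add[OF H])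
  next
    fix \<gamma> c x assume "x \<in> ?H"
    then show "\<pi> \<gamma> (c *\<^sub>R x) = c *\<^sub>R \<pi> \<gamma> x"
      by (intro orthogonal_imp_eq[of _ e]) (simp_all add: \<pi>(1) inner_\<pi> subspace_scale[OF H])
  qed (use \<pi>(3) p0 pp in auto)
  moreover have "\<pi> \<gamma> (e (\<delta>, j)) = e (\<gamma> + \<delta>, j)" for \<gamma> \<delta> j
  proof (rule orthogonal_imp_eq[OF \<pi>(1)[OF eH] eH])
    fix s
    show "inner (\<pi> \<gamma> (e (\<delta>, j))) (e s) = inner (e (\<gamma> + \<delta>, j)) (e s)"
      using inner_\<pi>[OF eH] iso[of \<gamma> "(\<delta>, j)" "\<sigma> (- \<gamma>) s"] by (simp add: \<sigma>\<sigma> \<sigma>0) (simp add: \<sigma>_def)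
  qed
  ultimately show ?thesis by (rule that)
qed

section \<open>The group algebra and its matrices\<close>

lemma poly_mapping_sum_singles:
  "a = (\<Sum>\<gamma>\<in>Poly_Mapping.keys a. Poly_Mapping.single \<gamma> (Poly_Mapping.lookup a \<gamma>))"
  by (rule poly_mapping_eqI) (simp add: lookup_sum lookup_single when_def in_keys_iff sum.delta)

lemma poly_mapping_single_induct [case_names single add]:
  fixes a :: "'a \<Rightarrow>\<^sub>0 'b::comm_monoid_add"
  assumes s: "\<And>\<gamma> c. P (Poly_Mapping.single \<gamma> c)" and a: "\<And>a b. P a \<Longrightarrow> P b \<Longrightarrow> P (a + b)"
  shows "P a"
proof -
  have "P (\<Sum>\<gamma>\<in>F. Poly_Mapping.single \<gamma> (Poly_Mapping.lookup a \<gamma>))" if "finite F" for F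
    using that
  proof induction
    case empty
    show ?case using s[of undefined 0] by simp
  next
    case (insert \<gamma> F)
    then show ?case by (simp add: s a)
  qed
  then show ?thesis using poly_mapping_sum_singles[of a] by (metis finite_keys)
qed

lemma index_mat_mult_sum:
  assumes "A \<in> carrier_mat m n" "B \<in> carrier_mat n p" "i < m" "j < p"
  shows "(A * B) $$ (i, j) = (\<Sum>l<n. A $$ (i, l) * B $$ (l, j))"
  using assms by (simp add: scalar_prod_def atLeast0LessThan)

lemma smult_mat_mult_assoc:
  fixes A :: "'a::semiring_0 mat"
  assumes A: "A \<in> carrier_mat m n" and B: "B \<in> carrier_mat n p"
  shows "c \<cdot>\<^sub>m A * B = c \<cdot>\<^sub>m (A * B)"
proof (rule eq_matI)
  fix i j assume "i < dim_row (c \<cdot>\<^sub>m (A * B))" "j < dim_col (c \<cdot>\<^sub>m (A * B))"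
  then have ij: "i < m" "j < p" using A B by auto
  have "(c \<cdot>\<^sub>m A * B) $$ (i, j) = (\<Sum>l<n. (c \<cdot>\<^sub>m A) $$ (i, l) * B $$ (l, j))"
    using ij by (intro index_mat_mult_sum[OF _ B]) (use A in auto)
  also have "\<dots> = c * (A * B) $$ (i, j)"
    using ij A unfolding index_mat_mult_sum[OF A B ij] by (simp add: sum_distrib_left mult.assoc)
  also have "\<dots> = (c \<cdot>\<^sub>m (A * B)) $$ (i, j)" using ij A B by (intro index_smult_mat(1)[symmetric]) auto
  finally show "(c \<cdot>\<^sub>m A * B) $$ (i, j) = (c \<cdot>\<^sub>m (A * B)) $$ (i, j)" .
qed (use assms in auto)

lemma inj_uminus_group: "inj (uminus :: 'g::group_add \<Rightarrow> 'g)"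
  by (rule injI) simp

lemma lookup_group_alg_star [simp]:
  "Poly_Mapping.lookup (group_alg_star a) \<gamma> = Poly_Mapping.lookup a (- \<gamma>)"
  unfolding group_alg_star_def by (simp add: map_key.rep_eq inj_uminus_group)

lemma group_alg_star_add: "group_alg_star (a + b) = group_alg_star a + group_alg_star b"
  by (rule poly_mapping_eqI) (simp add: lookup_add)

lemma group_alg_star_zero [simp]: "group_alg_star 0 = 0"
  by (rule poly_mapping_eqI) simp

lemma group_alg_star_sum: "group_alg_star (sum f F) = (\<Sum>i\<in>F. group_alg_star (f i))"
  by (induction F rule: infinite_finite_induct) (simp_all add: group_alg_star_add)

lemma group_alg_star_star [simp]: "group_alg_star (group_alg_star a) = a"
  by (rule poly_mapping_eqI) simp

lemma group_alg_star_single: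
  "group_alg_star (Poly_Mapping.single \<gamma> c) = Poly_Mapping.single (- \<gamma>) c"
  by (rule poly_mapping_eqI) (auto simp: lookup_single when_def)

lemma group_alg_star_mult:
  "group_alg_star (a * b) = group_alg_star b * group_alg_star a"
proof (induction a rule: poly_mapping_single_induct)
  case (single \<gamma> c)
  show ?case
    by (induction b rule: poly_mapping_single_induct)
      (simp_all add: group_alg_star_add group_alg_star_single mult_single minus_add mult.commute
        distrib_left distrib_right)
next
  case (add a b)
  then show ?case by (simp add: group_alg_star_add distrib_left distrib_right)
qed

lemma dim_mat_star [simp]: "dim_row (mat_star A) = dim_col A" "dim_col (mat_star A) = dim_row A"
  by (simp_all add: mat_star_def)

lemma mat_star_carrier [simp, intro]: "A \<in> carrier_mat m n \<Longrightarrow> mat_star A \<in> carrier_mat n m"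
  by auto

lemma index_mat_star [simp]:
  "i < dim_col A \<Longrightarrow> j < dim_row A \<Longrightarrow> mat_star A $$ (i, j) = group_alg_star (A $$ (j, i))"
  by (simp add: mat_star_def)

lemma mat_star_star [simp]: "mat_star (mat_star A) = A"
  by (rule eq_matI) auto

lemma mat_star_mult:
  assumes "A \<in> carrier_mat m n" "B \<in> carrier_mat n p"
  shows "mat_star (A * B) = mat_star B * mat_star A"
proof (rule eq_matI)
  fix i j assume "i < dim_row (mat_star B * mat_star A)" "j < dim_col (mat_star B * mat_star A)"
  then have ij: "i < p" "j < m" using assms by auto
  have "mat_star (A * B) $$ (i, j) = group_alg_star ((A * B) $$ (j, i))"
    using assms ij by (intro index_mat_star) auto
  also have "\<dots> = (\<Sum>l<n. group_alg_star (B $$ (l, i)) * group_alg_star (A $$ (j, l)))"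
    using index_mat_mult_sum[OF assms ij(2,1)] by (simp add: group_alg_star_sum group_alg_star_mult)
  also have "\<dots> = (mat_star B * mat_star A) $$ (i, j)"
    using assms ij by (subst index_mat_mult_sum[of _ p n _ m]) auto
  finally show "mat_star (A * B) $$ (i, j) = (mat_star B * mat_star A) $$ (i, j)" .
qed (use assms in auto)

lemma conj_map_star:
  assumes "d \<in> carrier_mat k l" "a \<in> carrier_mat k k"
  shows "mat_star (conj_map d a) = conj_map d (mat_star a)"
proof -
  have "mat_star (mat_star d * a * d) = mat_star d * mat_star (mat_star d * a)"
    using assms by (intro mat_star_mult) auto
  also have "mat_star (mat_star d * a) = mat_star a * mat_star (mat_star d)"
    using assms by (intro mat_star_mult) auto
  also have "mat_star d * (mat_star a * mat_star (mat_star d)) = mat_star d * mat_star a * d"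
    using assms by (subst assoc_mult_mat[of _ l k _ k _ l]) auto
  finally show ?thesis unfolding conj_map_def .
qed

lemma conj_map_add:
  assumes "d \<in> carrier_mat k l" "a \<in> carrier_mat k k" "b \<in> carrier_mat k k"
  shows "conj_map d (a + b) = conj_map d a + conj_map d b"
proof -
  have "mat_star d * (a + b) = mat_star d * a + mat_star d * b"
    using assms by (intro mult_add_distrib_mat[of _ l k _ k]) auto
  moreover have "(mat_star d * a + mat_star d * b) * d = mat_star d * a * d + mat_star d * b * d"
    using assms by (intro add_mult_distrib_mat[of _ l k _ _ l] mult_carrier_mat[of _ l k]) auto
  ultimately show ?thesis unfolding conj_map_def by simp
qed

lemma conj_map_carrier: "d \<in> carrier_mat k l \<Longrightarrow> a \<in> carrier_mat k k \<Longrightarrow> conj_map d a \<in> carrier_mat l l"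
  unfolding conj_map_def by (metis mat_star_carrier mult_carrier_mat)

lemma conj_map_square:
  assumes d: "d \<in> carrier_mat k l" and c: "c \<in> carrier_mat r k"
  shows "conj_map d (mat_star c * c) = mat_star (c * d) * (c * d)"
proof -
  have "mat_star (c * d) * (c * d) = mat_star d * mat_star c * (c * d)"
    using c d by (subst mat_star_mult[of _ r k _ l]) auto
  also have "\<dots> = mat_star d * (mat_star c * (c * d))"
    using c d by (intro assoc_mult_mat[of _ l k _ r _ l]) auto
  also have "mat_star c * (c * d) = (mat_star c * c) * d"
    using c d by (intro assoc_mult_mat[symmetric, of _ k r _ k _ l]) auto
  also have "mat_star d * ((mat_star c * c) * d) = mat_star d * (mat_star c * c) * d"
    using c d by (intro assoc_mult_mat[symmetric, of _ l k _ k _ l]) auto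
  finally show ?thesis by (simp add: conj_map_def)
qed

lemma conj_map_conj_map:
  assumes d: "d \<in> carrier_mat k l" and e: "e \<in> carrier_mat l r" and a: "a \<in> carrier_mat k k"
  shows "conj_map e (conj_map d a) = conj_map (d * e) a"
proof -
  have "conj_map (d * e) a = mat_star e * mat_star d * a * (d * e)"
    unfolding conj_map_def using d e by (subst mat_star_mult[of _ k l _ r]) auto
  also have "mat_star e * mat_star d * a = mat_star e * (mat_star d * a)"
    using d e a by (intro assoc_mult_mat[of _ r l _ k _ k]) auto
  also have "mat_star e * (mat_star d * a) * (d * e) = mat_star e * (mat_star d * a * (d * e))"
    using d e a by (intro assoc_mult_mat[of _ r l _ k _ r] mult_carrier_mat[of _ l k]) auto
  also have "mat_star d * a * (d * e) = mat_star d * a * d * e"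
    using d e a by (intro assoc_mult_mat[symmetric, of _ l k _ l _ r] mult_carrier_mat[of _ l k]) auto
  also have "mat_star e * (mat_star d * a * d * e) = mat_star e * (mat_star d * a * d) * e"
    using d e a by (intro assoc_mult_mat[symmetric, of _ r l _ l _ r] mult_carrier_mat[of _ l k]) auto
  finally show ?thesis by (simp add: conj_map_def)
qed

text \<open>Real scalars are multiples of the unit of the group algebra, hence central; this is what
  makes \<open>conj_map\<close> real-linear although matrix entries do not commute.\<close>

lemma single_zero_commute:
  fixes a :: "'g::monoid_add \<Rightarrow>\<^sub>0 real"
  shows "Poly_Mapping.single 0 c * a = a * Poly_Mapping.single 0 c"
  by (induction a rule: poly_mapping_single_induct)
    (simp_all add: mult_single mult.commute distrib_left distrib_right)

lemma mult_single_zero_left_commute: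
  fixes a :: "'g::monoid_add \<Rightarrow>\<^sub>0 real"
  shows "a * (Poly_Mapping.single 0 c * b) = Poly_Mapping.single 0 c * (a * b)"
  by (metis mult.assoc single_zero_commute)

lemma conj_map_smult:
  assumes "d \<in> carrier_mat k l" "a \<in> carrier_mat k k"
  shows "conj_map d (Poly_Mapping.single 0 c \<cdot>\<^sub>m a) = Poly_Mapping.single 0 c \<cdot>\<^sub>m conj_map d a"
proof -
  have "mat_star d * (Poly_Mapping.single 0 c \<cdot>\<^sub>m a) = Poly_Mapping.single 0 c \<cdot>\<^sub>m (mat_star d * a)"
  proof (rule eq_matI)
    fix i j assume "i < dim_row (Poly_Mapping.single 0 c \<cdot>\<^sub>m (mat_star d * a))"
      "j < dim_col (Poly_Mapping.single 0 c \<cdot>\<^sub>m (mat_star d * a))"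
    then have ij: "i < l" "j < k" using assms by auto
    show "(mat_star d * (Poly_Mapping.single 0 c \<cdot>\<^sub>m a)) $$ (i, j) =
        (Poly_Mapping.single 0 c \<cdot>\<^sub>m (mat_star d * a)) $$ (i, j)"
      using assms ij
      by (simp add: index_mat_mult_sum[of _ l k _ k] sum_distrib_left mult_single_zero_left_commute
          del: index_mult_mat(1))
  qed (use assms in auto)
  moreover have "Poly_Mapping.single 0 c \<cdot>\<^sub>m (mat_star d * a) * d = Poly_Mapping.single 0 c \<cdot>\<^sub>m (mat_star d * a * d)"
    using assms by (intro smult_mat_mult_assoc[of _ l k _ l] mult_carrier_mat[of _ l k]) auto
  ultimately show ?thesis unfolding conj_map_def by simp
qed

section \<open>Matrices over the group algebra as operators on powers of a Hilbert space\<close>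

lemma rep_alg_superset:
  assumes "finite S" "Poly_Mapping.keys a \<subseteq> S"
  shows "rep_alg \<pi> a x = (\<Sum>\<gamma>\<in>S. Poly_Mapping.lookup a \<gamma> *\<^sub>R \<pi> \<gamma> x)"
  unfolding rep_alg_def using assms by (intro sum.mono_neutral_left) (auto simp: in_keys_iff)

lemma rep_alg_add: "rep_alg \<pi> (a + b) x = rep_alg \<pi> a x + rep_alg \<pi> b x"
proof -
  let ?S = "Poly_Mapping.keys a \<union> Poly_Mapping.keys b"
  have "rep_alg \<pi> c x = (\<Sum>\<gamma>\<in>?S. Poly_Mapping.lookup c \<gamma> *\<^sub>R \<pi> \<gamma> x)" if "c \<in> {a, b, a + b}" for c
    using that keys_add[of a b] by (intro rep_alg_superset) auto
  then show ?thesis by (simp add: lookup_add scaleR_add_left sum.distrib)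
qed

lemma rep_alg_zero [simp]: "rep_alg \<pi> 0 x = 0"
  by (simp add: rep_alg_def)

lemma rep_alg_single [simp]: "rep_alg \<pi> (Poly_Mapping.single \<gamma> c) x = c *\<^sub>R \<pi> \<gamma> x"
  by (subst rep_alg_superset[of "{\<gamma>}"]) auto

lemma rep_alg_sum: "rep_alg \<pi> (sum f F) x = (\<Sum>i\<in>F. rep_alg \<pi> (f i) x)"
  by (induction F rule: infinite_finite_induct) (simp_all add: rep_alg_add)

locale unitary_representation =
  fixes H :: "'h::{real_inner,complete_space} set" and \<pi> :: "'g::group_add \<Rightarrow> 'h \<Rightarrow> 'h"
  assumes rep: "unitary_rep H \<pi>"
begin

lemma subspace_H: "subspace H" using rep by (simp add: unitary_rep_def)

lemmas H_zero = subspace_0[OF subspace_H]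
lemmas H_add = subspace_add[OF subspace_H]
lemmas H_scale = subspace_scale[OF subspace_H]
lemmas H_sum = subspace_sum[OF subspace_H]

lemma \<pi>_in: "x \<in> H \<Longrightarrow> \<pi> \<gamma> x \<in> H" using rep unfolding unitary_rep_def by blast

lemma \<pi>_add: "x \<in> H \<Longrightarrow> y \<in> H \<Longrightarrow> \<pi> \<gamma> (x + y) = \<pi> \<gamma> x + \<pi> \<gamma> y"
  and \<pi>_scale: "x \<in> H \<Longrightarrow> \<pi> \<gamma> (c *\<^sub>R x) = c *\<^sub>R \<pi> \<gamma> x"
  and \<pi>_norm: "x \<in> H \<Longrightarrow> norm (\<pi> \<gamma> x) = norm x"
  and \<pi>_0: "x \<in> H \<Longrightarrow> \<pi> 0 x = x"
  and \<pi>_plus: "x \<in> H \<Longrightarrow> \<pi> (\<gamma> + \<delta>) x = \<pi> \<gamma> (\<pi> \<delta> x)"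
  using rep unfolding unitary_rep_def by blast+

lemma \<pi>_inner: "x \<in> H \<Longrightarrow> y \<in> H \<Longrightarrow> inner (\<pi> \<gamma> x) (\<pi> \<gamma> y) = inner x y"
  using \<pi>_norm[of "x + y" \<gamma>] \<pi>_norm[of x \<gamma>] \<pi>_norm[of y \<gamma>] H_add[of x y]
  by (simp add: \<pi>_add norm_eq_sqrt_inner inner_add inner_commute)

lemma \<pi>_adjoint: "x \<in> H \<Longrightarrow> y \<in> H \<Longrightarrow> inner (\<pi> \<gamma> x) y = inner x (\<pi> (- \<gamma>) y)"
  using \<pi>_inner[of "\<pi> \<gamma> x" y "- \<gamma>"] by (simp add: \<pi>_in \<pi>_plus[symmetric] \<pi>_0)

lemma rep_alg_in: "x \<in> H \<Longrightarrow> rep_alg \<pi> a x \<in> H"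
  unfolding rep_alg_def by (intro H_sum H_scale \<pi>_in)

lemma rep_alg_plus: "x \<in> H \<Longrightarrow> y \<in> H \<Longrightarrow> rep_alg \<pi> a (x + y) = rep_alg \<pi> a x + rep_alg \<pi> a y"
  by (simp add: rep_alg_def \<pi>_add scaleR_add_right sum.distrib)

lemma rep_alg_scale: "x \<in> H \<Longrightarrow> rep_alg \<pi> a (c *\<^sub>R x) = c *\<^sub>R rep_alg \<pi> a x"
  by (simp add: rep_alg_def \<pi>_scale scaleR_sum_right mult.commute)

lemma rep_alg_sum_right:
  "(\<And>i. i \<in> F \<Longrightarrow> f i \<in> H) \<Longrightarrow> rep_alg \<pi> a (sum f F) = (\<Sum>i\<in>F. rep_alg \<pi> a (f i))"
proof (induction F rule: infinite_finite_induct)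
  case empty
  show ?case using rep_alg_scale[OF H_zero, of a 0] by simp
qed (use rep_alg_scale[OF H_zero, of a 0] in \<open>simp_all add: rep_alg_plus H_sum\<close>)

lemma rep_alg_mult: "x \<in> H \<Longrightarrow> rep_alg \<pi> (a * b) x = rep_alg \<pi> a (rep_alg \<pi> b x)"
proof (induction a rule: poly_mapping_single_induct)
  case (single \<gamma> c)
  then show ?case
    by (induction b rule: poly_mapping_single_induct)
      (simp_all add: mult_single \<pi>_plus \<pi>_scale \<pi>_in distrib_left rep_alg_add rep_alg_in \<pi>_add scaleR_add_right)
qed (simp add: distrib_right rep_alg_add)

lemma rep_alg_adjoint:
  "x \<in> H \<Longrightarrow> y \<in> H \<Longrightarrow> inner (rep_alg \<pi> a x) y = inner x (rep_alg \<pi> (group_alg_star a) y)"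
  by (induction a rule: poly_mapping_single_induct)
    (simp_all add: \<pi>_adjoint group_alg_star_single group_alg_star_add rep_alg_add inner_add)

lemma rep_mat_vecs: "z \<in> vecs_over H n \<Longrightarrow> A \<in> carrier_mat m n \<Longrightarrow> rep_mat \<pi> A z \<in> vecs_over H m"
  by (auto simp: vecs_over_def rep_mat_def intro!: H_sum rep_alg_in)

lemma rep_mat_mult:
  assumes "A \<in> carrier_mat m n" "B \<in> carrier_mat n p" "z \<in> vecs_over H p"
  shows "rep_mat \<pi> (A * B) z = rep_mat \<pi> A (rep_mat \<pi> B z)"
proof (rule eq_vecI)
  fix i assume "i < dim_vec (rep_mat \<pi> A (rep_mat \<pi> B z))"
  then have i: "i < m" using assms by (simp add: rep_mat_def)
  have zH: "z $ j \<in> H" if "j < p" for j using assms that by (simp add: vecs_over_def)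
  have "rep_mat \<pi> (A * B) z $ i = (\<Sum>j<p. \<Sum>l<n. rep_alg \<pi> (A $$ (i, l)) (rep_alg \<pi> (B $$ (l, j)) (z $ j)))"
    using assms i zH
    by (simp add: rep_mat_def index_mat_mult_sum[of _ m n _ p] rep_alg_sum rep_alg_mult del: index_mult_mat(1))
  also have "\<dots> = (\<Sum>l<n. \<Sum>j<p. rep_alg \<pi> (A $$ (i, l)) (rep_alg \<pi> (B $$ (l, j)) (z $ j)))"
    by (rule sum.swap)
  also have "\<dots> = rep_mat \<pi> A (rep_mat \<pi> B z) $ i"
    using assms i by (simp add: rep_mat_def) (intro sum.cong refl rep_alg_sum_right[symmetric] rep_alg_in zH, simp)
  finally show "rep_mat \<pi> (A * B) z $ i = rep_mat \<pi> A (rep_mat \<pi> B z) $ i" .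
qed (use assms in \<open>simp add: rep_mat_def\<close>)

lemma vec_inner_adjoint:
  assumes "A \<in> carrier_mat m n" "z \<in> vecs_over H n" "w \<in> vecs_over H m"
  shows "vec_inner (rep_mat \<pi> A z) w = vec_inner z (rep_mat \<pi> (mat_star A) w)"
proof -
  have dim: "dim_row A = m" "dim_col A = n" "dim_vec z = n" "dim_vec w = m"
    and H: "\<And>j. j < n \<Longrightarrow> z $ j \<in> H" "\<And>i. i < m \<Longrightarrow> w $ i \<in> H"
    using assms by (auto simp: vecs_over_def)
  have "vec_inner (rep_mat \<pi> A z) w = (\<Sum>i<m. \<Sum>j<n. inner (z $ j) (rep_alg \<pi> (mat_star A $$ (j, i)) (w $ i)))"
    using H by (simp add: vec_inner_def rep_mat_def inner_sum_left rep_alg_adjoint dim)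
  also have "\<dots> = (\<Sum>j<n. \<Sum>i<m. inner (z $ j) (rep_alg \<pi> (mat_star A $$ (j, i)) (w $ i)))"
    by (rule sum.swap)
  also have "\<dots> = vec_inner z (rep_mat \<pi> (mat_star A) w)"
    by (simp add: vec_inner_def rep_mat_def inner_sum_right dim)
  finally show ?thesis .
qed

lemma vec_inner_mat_star_mult:
  assumes "A \<in> carrier_mat m n" "B \<in> carrier_mat m n" "z \<in> vecs_over H n" "w \<in> vecs_over H n"
  shows "vec_inner (rep_mat \<pi> (mat_star A * B) z) w = vec_inner (rep_mat \<pi> B z) (rep_mat \<pi> A w)"
proof -
  have "rep_mat \<pi> (mat_star A * B) z = rep_mat \<pi> (mat_star A) (rep_mat \<pi> B z)"
    using assms by (intro rep_mat_mult[of _ n m _ n]) auto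
  then show ?thesis
    using vec_inner_adjoint[of "mat_star A" n m "rep_mat \<pi> B z" w] rep_mat_vecs[OF assms(3,2)] assms by simp
qed

end

lemma vec_inner_commute: "dim_vec z = dim_vec w \<Longrightarrow> vec_inner z w = vec_inner w z"
  by (simp add: vec_inner_def inner_commute)

lemma vec_inner_rep_mat_add:
  assumes "a \<in> carrier_mat k k" "b \<in> carrier_mat k k"
  shows "vec_inner (rep_mat \<pi> (a + b) z) w = vec_inner (rep_mat \<pi> a z) w + vec_inner (rep_mat \<pi> b z) w"
  using assms by (simp add: vec_inner_def rep_mat_def rep_alg_add sum.distrib inner_add)

lemma vec_inner_self_nonneg: "0 \<le> vec_inner z z"
  by (simp add: vec_inner_def sum_nonneg)

lemma vec_inner_self_eq_0:
  assumes "vec_inner z z = 0"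
  shows "z = 0\<^sub>v (dim_vec z)"
proof (rule eq_vecI)
  fix i assume "i < dim_vec (0\<^sub>v (dim_vec z) :: 'a vec)"
  then show "z $ i = 0\<^sub>v (dim_vec z) $ i"
    using assms by (simp add: vec_inner_def sum_nonneg_eq_0_iff)
qed simp

lemma sums_of_squares_carrier: "s \<in> sums_of_squares k \<Longrightarrow> s \<in> carrier_mat k k"
  by (induction rule: sums_of_squares.induct) auto

text \<open>A positive additive functional \<open>T\<close> vanishing on \<open>s\<close> vanishes on each of its squares, so that
  all of them are factored through \<open>d\<close>.\<close>

lemma sums_of_squares_factor:
  fixes d :: "('g::group_add \<Rightarrow>\<^sub>0 real) mat" and T :: "('g \<Rightarrow>\<^sub>0 real) mat \<Rightarrow> real"
  assumes d: "d \<in> carrier_mat k l"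
    and Tadd: "\<And>a b. a \<in> carrier_mat l l \<Longrightarrow> b \<in> carrier_mat l l \<Longrightarrow> T (a + b) = T a + T b"
    and Tpos: "\<And>b. b \<in> carrier_mat l l \<Longrightarrow> 0 \<le> T (mat_star b * b)"
    and fac: "\<And>b. b \<in> carrier_mat l l \<Longrightarrow> T (mat_star b * b) = 0 \<Longrightarrow> \<exists>c\<in>carrier_mat l k. b = c * d"
    and s: "s \<in> sums_of_squares l" "T s = 0"
  shows "\<exists>t\<in>carrier_mat k k. s = conj_map d t \<and>
    (\<forall>\<Psi>. (\<forall>a\<in>carrier_mat k k. \<forall>b\<in>carrier_mat k k. \<Psi> (a + b) = \<Psi> a + \<Psi> b) \<longrightarrow>
       (\<forall>c\<in>carrier_mat l k. 0 \<le> \<Psi> (mat_star c * c)) \<longrightarrow> 0 \<le> (\<Psi> t :: real))"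
proof -
  have T0: "T (0\<^sub>m l l) = 0" using Tadd[of "0\<^sub>m l l" "0\<^sub>m l l"] by simp
  have nonneg: "0 \<le> T s" if "s \<in> sums_of_squares l" for s
    using that
  proof induction
    case (add a s)
    then show ?case using Tpos[of a] by (subst Tadd) (auto simp: sums_of_squares_carrier)
  qed (simp add: T0)
  show ?thesis
    using s
  proof induction
    case zero
    show ?case
    proof (intro bexI[of _ "0\<^sub>m k k"] conjI allI impI)
      show "0\<^sub>m l l = conj_map d (0\<^sub>m k k)" using d by (simp add: conj_map_def)
      fix \<Psi> :: "('g \<Rightarrow>\<^sub>0 real) mat \<Rightarrow> real"
      assume "\<forall>a\<in>carrier_mat k k. \<forall>b\<in>carrier_mat k k. \<Psi> (a + b) = \<Psi> a + \<Psi> b"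
      from this[rule_format, of "0\<^sub>m k k" "0\<^sub>m k k"] show "0 \<le> \<Psi> (0\<^sub>m k k)" by simp
    qed simp
  next
    case (add a s)
    have sc: "s \<in> carrier_mat l l" using add by (simp add: sums_of_squares_carrier)
    have "T (mat_star a * a) + T s = 0" using add(1,4) sc by (subst Tadd[symmetric]) auto
    then have T: "T (mat_star a * a) = 0" "T s = 0" using Tpos[OF add(1)] nonneg[OF add(2)] by auto
    obtain c where c: "c \<in> carrier_mat l k" "a = c * d" using fac[OF add(1) T(1)] by blast
    obtain t where t: "t \<in> carrier_mat k k" "s = conj_map d t"
      "\<And>\<Psi>. (\<forall>a\<in>carrier_mat k k. \<forall>b\<in>carrier_mat k k. \<Psi> (a + b) = \<Psi> a + \<Psi> b) \<Longrightarrow>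
       (\<forall>c\<in>carrier_mat l k. 0 \<le> \<Psi> (mat_star c * c)) \<Longrightarrow> 0 \<le> (\<Psi> t :: real)"
      using add(3)[OF T(2)] by blast
    have cc: "mat_star c * c \<in> carrier_mat k k" using c by auto
    have "mat_star a * a = conj_map d (mat_star c * c)"
      unfolding c(2) by (rule conj_map_square[OF d c(1), symmetric])
    then have "mat_star a * a + s = conj_map d (mat_star c * c + t)"
      using conj_map_add[OF d cc t(1)] t(2) by simp
    \<comment> \<open>The quantified \<open>\<Psi>\<close> serves as a certificate that
      \<open>t\<close> is made up of squares \<open>mat_star c * c\<close>; each step of the
      induction adds one of them.\<close>
    moreover have "0 \<le> \<Psi> (mat_star c * c + t)"
      if "\<forall>a\<in>carrier_mat k k. \<forall>b\<in>carrier_mat k k. \<Psi> (a + b) = \<Psi> a + \<Psi> b"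
        "\<forall>c\<in>carrier_mat l k. 0 \<le> \<Psi> (mat_star c * c)" for \<Psi> :: "('g \<Rightarrow>\<^sub>0 real) mat \<Rightarrow> real"
    proof -
      have "\<Psi> (mat_star c * c + t) = \<Psi> (mat_star c * c) + \<Psi> t" using that cc t(1) by blast
      then show ?thesis using that c(1) t(3)[of \<Psi>] by (simp add: add_nonneg_nonneg)
    qed
    ultimately show ?case using cc t(1) by (intro bexI[of _ "mat_star c * c + t"]) auto
  qed
qed

section \<open>The GNS construction\<close>

lemma rep_alg_scale_left: "rep_alg \<pi> (Poly_Mapping.single 0 c * a) x = c *\<^sub>R rep_alg \<pi> a x"
  by (induction a rule: poly_mapping_single_induct)
    (simp_all add: mult_single distrib_left rep_alg_add scaleR_add_right)

lemma vec_inner_rep_mat_smult: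
  assumes "a \<in> carrier_mat k k"
  shows "vec_inner (rep_mat \<pi> (Poly_Mapping.single 0 c \<cdot>\<^sub>m a) z) w = c * vec_inner (rep_mat \<pi> a z) w"
  using assms
  by (simp add: vec_inner_def rep_mat_def rep_alg_scale_left scaleR_sum_right[symmetric] sum_distrib_left)

text \<open>A finitely supported real family on \<Gamma> x {0..k-1} is the same as a row
  \<open>v\<close> over the group algebra, and the quadratic form of the kernel at this family is
  \<open>\<psi> (mat_star v * v)\<close>. This is why positivity is asked for single rows.\<close>

lemma gns_construction:
  fixes \<psi> :: "('g::group_add \<Rightarrow>\<^sub>0 real) mat \<Rightarrow> real"
  assumes add: "\<And>a b. a \<in> carrier_mat k k \<Longrightarrow> b \<in> carrier_mat k k \<Longrightarrow> \<psi> (a + b) = \<psi> a + \<psi> b"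
    and scale: "\<And>c a. a \<in> carrier_mat k k \<Longrightarrow> \<psi> (Poly_Mapping.single 0 c \<cdot>\<^sub>m a) = c * \<psi> a"
    and herm: "\<And>a. a \<in> carrier_mat k k \<Longrightarrow> \<psi> (mat_star a) = \<psi> a"
    and pos: "\<And>v. v \<in> carrier_mat 1 k \<Longrightarrow> 0 \<le> \<psi> (mat_star v * v)"
  obtains H :: "('g \<times> nat) ell2 set" and \<pi> z where
    "unitary_rep H \<pi>" "z \<in> vecs_over H k" "cyclic_vec H \<pi> k z"
    "\<And>a. a \<in> carrier_mat k k \<Longrightarrow> \<psi> a = vec_inner (rep_mat \<pi> a z) z"
proof -
  have sum: "\<psi> (Matrix.mat k k (\<lambda>p. \<Sum>s\<in>F. Poly_Mapping.single 0 (c s) * f s p)) =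
      (\<Sum>s\<in>F. c s * \<psi> (Matrix.mat k k (f s)))" if "finite F"
    for F :: "'s set" and c and f :: "'s \<Rightarrow> nat \<times> nat \<Rightarrow> 'g \<Rightarrow>\<^sub>0 real"
    using that
  proof induction
    case empty
    have "\<psi> (0\<^sub>m k k) = 0" using add[of "0\<^sub>m k k" "0\<^sub>m k k"] by simp
    then show ?case by (simp add: zero_mat_def)
  next
    case (insert x F)
    have "Matrix.mat k k (\<lambda>p. \<Sum>s\<in>insert x F. Poly_Mapping.single 0 (c s) * f s p) =
        Poly_Mapping.single 0 (c x) \<cdot>\<^sub>m Matrix.mat k k (f x) +
        Matrix.mat k k (\<lambda>p. \<Sum>s\<in>F. Poly_Mapping.single 0 (c s) * f s p)"
      using insert by (intro eq_matI) auto
    then show ?case using insert by (simp add: add scale)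
  qed
  \<comment> \<open>Elementary matrices, given by their entries: for \<open>(i, j)\<close> outside
    the format the matrix \<open>Matrix.mat k k (E i j \<gamma>)\<close> is zero, so that the kernel
    can be indexed by all natural numbers.\<close>
  define E :: "nat \<Rightarrow> nat \<Rightarrow> 'g \<Rightarrow> nat \<times> nat \<Rightarrow> 'g \<Rightarrow>\<^sub>0 real"
    where "E = (\<lambda>i j \<gamma> p. if p = (i, j) then Poly_Mapping.single \<gamma> 1 else 0)"
  define \<kappa> where "\<kappa> = (\<lambda>i j \<gamma>. \<psi> (Matrix.mat k k (E i j \<gamma>)))"
  have expand: "\<psi> a = (\<Sum>i<k. \<Sum>j<k. \<Sum>\<gamma>\<in>Poly_Mapping.keys (a $$ (i, j)). Poly_Mapping.lookup (a $$ (i, j)) \<gamma> * \<kappa> i j \<gamma>)"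
    if a: "a \<in> carrier_mat k k" for a
  proof -
    let ?F = "SIGMA i:{..<k}. SIGMA j:{..<k}. Poly_Mapping.keys (a $$ (i, j))"
    let ?c = "\<lambda>(i, j, \<gamma>). Poly_Mapping.lookup (a $$ (i, j)) \<gamma>"
    let ?f = "\<lambda>(i, j, \<gamma>). E i j \<gamma>"
    have sumF: "(\<Sum>s\<in>?F. g s) = (\<Sum>i<k. \<Sum>j<k. \<Sum>\<gamma>\<in>Poly_Mapping.keys (a $$ (i, j)). g (i, j, \<gamma>))"
      for g :: "nat \<times> nat \<times> 'g \<Rightarrow> 'z::comm_monoid_add"
      by (simp add: sum.Sigma finite_SigmaI)
    have "a = Matrix.mat k k (\<lambda>p. \<Sum>s\<in>?F. Poly_Mapping.single 0 (?c s) * ?f s p)"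
    proof (rule eq_matI)
      fix i j assume "i < dim_row (Matrix.mat k k (\<lambda>p. \<Sum>s\<in>?F. Poly_Mapping.single 0 (?c s) * ?f s p))"
        "j < dim_col (Matrix.mat k k (\<lambda>p. \<Sum>s\<in>?F. Poly_Mapping.single 0 (?c s) * ?f s p))"
      then have ij: "i < k" "j < k" by auto
      have single: "(\<Sum>\<gamma>\<in>Poly_Mapping.keys (a $$ (i', j')). Poly_Mapping.single 0 (Poly_Mapping.lookup (a $$ (i', j')) \<gamma>) *
          E i' j' \<gamma> (i, j)) = (if i' = i then if j' = j then a $$ (i', j') else 0 else 0)" for i' j'
        by (simp add: E_def mult_single poly_mapping_sum_singles[symmetric])
      have "(\<Sum>s\<in>?F. Poly_Mapping.single 0 (?c s) * ?f s (i, j)) =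
          (\<Sum>i'<k. if i' = i then \<Sum>j'<k. if j' = j then a $$ (i', j') else 0 else 0)"
        unfolding sumF by (intro sum.cong refl) (auto simp: single)
      also have "\<dots> = a $$ (i, j)" using ij by simp
      finally show "a $$ (i, j) = Matrix.mat k k (\<lambda>p. \<Sum>s\<in>?F. Poly_Mapping.single 0 (?c s) * ?f s p) $$ (i, j)"
        using ij by simp
    qed (use a in auto)
    then have "\<psi> a = (\<Sum>s\<in>?F. ?c s * \<psi> (Matrix.mat k k (?f s)))"
      using sum[of ?F ?c ?f] by (simp add: finite_SigmaI)
    then show ?thesis unfolding sumF by (simp add: \<kappa>_def)
  qed
  have \<kappa>_star: "\<kappa> j i (- \<gamma>) = \<kappa> i j \<gamma>" for i j \<gamma>
  proof -
    have "mat_star (Matrix.mat k k (E i j \<gamma>)) = Matrix.mat k k (E j i (- \<gamma>))"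
      by (rule eq_matI) (auto simp: E_def group_alg_star_single)
    then show ?thesis unfolding \<kappa>_def using herm[of "Matrix.mat k k (E i j \<gamma>)"] by simp
  qed
  \<comment> \<open>Forced by the aim: for s = (\<gamma>, j) and t = (\<delta>, i) the value must be
    the inner product of \<pi>(\<gamma>) z_j and \<pi>(\<delta>) z_i. Moving \<pi>(\<delta>) to the
    left gives \<pi>(- \<delta> + \<gamma>) z_j against z_i, which is the contribution of the entry
    (i, j).\<close>
  define K :: "'g \<times> nat \<Rightarrow> 'g \<times> nat \<Rightarrow> real"
    where "K = (\<lambda>s t. \<kappa> (snd t) (snd s) (- fst t + fst s))"
  have K: "psd_kernel K"
    unfolding psd_kernel_def
  proof (intro conjI allI impI)
    fix s t show "K s t = K t s"
      using \<kappa>_star[of "snd s" "snd t" "- fst t + fst s"] by (simp add: K_def minus_add)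
  next
    fix F :: "('g \<times> nat) set" and c :: "'g \<times> nat \<Rightarrow> real" assume F: "finite F"
    define v where "v = Matrix.mat 1 k (\<lambda>(_, j). \<Sum>s\<in>F. if snd s = j then Poly_Mapping.single (fst s) (c s) else 0)"
    have v: "v \<in> carrier_mat 1 k" by (simp add: v_def)
    have "mat_star v * v = Matrix.mat k k (\<lambda>p. \<Sum>q\<in>F \<times> F. Poly_Mapping.single 0 (c (fst q) * c (snd q)) *
        E (snd (snd q)) (snd (fst q)) (- fst (snd q) + fst (fst q)) p)" (is "_ = Matrix.mat k k ?g")
    proof (rule eq_matI)
      fix i j assume "i < dim_row (Matrix.mat k k ?g)" "j < dim_col (Matrix.mat k k ?g)"
      then have ij: "i < k" "j < k" by auto
      have "(mat_star v * v) $$ (i, j) = mat_star v $$ (i, 0) * v $$ (0, j)"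
        using v ij by (subst index_mat_mult_sum[of _ k 1 _ k]) auto
      also have "mat_star v $$ (i, 0) = (\<Sum>t\<in>F. if snd t = i then Poly_Mapping.single (- fst t) (c t) else 0)"
        using v ij by (simp add: v_def group_alg_star_sum if_distrib[of group_alg_star] group_alg_star_single cong: if_cong)
      also have "v $$ (0, j) = (\<Sum>s\<in>F. if snd s = j then Poly_Mapping.single (fst s) (c s) else 0)"
        using ij by (simp add: v_def)
      also have "(\<Sum>t\<in>F. if snd t = i then Poly_Mapping.single (- fst t) (c t) else 0) *
          (\<Sum>s\<in>F. if snd s = j then Poly_Mapping.single (fst s) (c s) else 0) =
          (\<Sum>t\<in>F. \<Sum>s\<in>F. Poly_Mapping.single 0 (c s * c t) * E (snd t) (snd s) (- fst t + fst s) (i, j))"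
        unfolding sum_product by (intro sum.cong refl) (auto simp: E_def mult_single mult.commute)
      also have "\<dots> = (\<Sum>s\<in>F. \<Sum>t\<in>F. Poly_Mapping.single 0 (c s * c t) * E (snd t) (snd s) (- fst t + fst s) (i, j))"
        by (rule sum.swap)
      also have "\<dots> = ?g (i, j)" by (simp add: sum.cartesian_product case_prod_beta)
      finally show "(mat_star v * v) $$ (i, j) = Matrix.mat k k ?g $$ (i, j)" using ij by simp
    qed (use v in auto)
    then have "\<psi> (mat_star v * v) = (\<Sum>q\<in>F \<times> F. c (fst q) * c (snd q) * K (fst q) (snd q))"
      using F sum[of "F \<times> F"] by (simp add: K_def \<kappa>_def)
    also have "\<dots> = (\<Sum>s\<in>F. \<Sum>t\<in>F. c s * c t * K s t)"
      by (simp add: sum.cartesian_product case_prod_beta)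
    finally show "0 \<le> (\<Sum>s\<in>F. \<Sum>t\<in>F. c s * c t * K s t)" using pos[OF v] by simp
  qed
  obtain e :: "'g \<times> nat \<Rightarrow> ('g \<times> nat) ell2" where e: "\<And>s t. inner (e s) (e t) = K s t"
    using kernel_realization[OF K inner_ell2_unit] by metis
  let ?H = "closure (span (range e))"
  have "inner (e (\<gamma> + \<delta>, i)) (e (\<gamma> + \<epsilon>, j)) = inner (e (\<delta>, i)) (e (\<epsilon>, j))" for \<gamma> \<delta> \<epsilon> i j
  proof -
    have "- (\<gamma> + \<epsilon>) + (\<gamma> + \<delta>) = - \<epsilon> + \<delta>" by (simp add: minus_add add.assoc[symmetric])
    then show ?thesis by (simp add: e K_def)
  qed
  then obtain \<pi> where rep: "unitary_rep ?H \<pi>" and \<pi>: "\<And>\<gamma> \<delta> j. \<pi> \<gamma> (e (\<delta>, j)) = e (\<gamma> + \<delta>, j)"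
    using unitary_rep_of_kernel[of e] by blast
  \<comment> \<open>The surplus indices carry the zero vector, so the closed span is generated by
    the orbits of the \<open>k\<close> components of \<open>z\<close>; cyclicity depends on
    this.\<close>
  have e0: "e (\<gamma>, j) = 0" if "\<not> j < k" for \<gamma> j
  proof -
    have "Matrix.mat k k (E j j 0) = 0\<^sub>m k k" using that by (intro eq_matI) (auto simp: E_def)
    moreover have "\<psi> (0\<^sub>m k k) = 0" using add[of "0\<^sub>m k k" "0\<^sub>m k k"] by simp
    ultimately have "inner (e (\<gamma>, j)) (e (\<gamma>, j)) = 0" by (simp add: e K_def \<kappa>_def)
    then show ?thesis by simp
  qed
  have eH: "e s \<in> ?H" for s
    by (meson closure_subset span_base rangeI subsetD)
  define z where "z = Matrix.vec k (\<lambda>j. e (0, j))"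
  have z: "z \<in> vecs_over ?H k" using eH by (auto simp: vecs_over_def z_def)
  \<comment> \<open>The orbit map of \<open>z\<close> on a single row. The rows of a matrix act
    independently of each other, so cyclicity in the power of the Hilbert space reduces to density
    of the range of \<open>R\<close>.\<close>
  define R where "R = (\<lambda>a. \<Sum>j<k. rep_alg \<pi> (a j) (e (0, j)))"
  have "span (range e) \<subseteq> range R"
  proof (rule span_minimal)
    show "range e \<subseteq> range R"
    proof (clarify, rename_tac \<gamma> j)
      fix \<gamma> and j :: nat
      have "e (\<gamma>, j) = R (\<lambda>j'. if j' = j then Poly_Mapping.single \<gamma> 1 else 0)"
        using e0[of j \<gamma>] by (cases "j < k") (simp_all add: R_def if_distrib[of "\<lambda>a. rep_alg \<pi> a _"] \<pi> cong: if_cong)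
      then show "e (\<gamma>, j) \<in> range R" by blast
    qed
    show "subspace (range R)"
    proof (rule subspaceI)
      have "0 = R (\<lambda>_. 0)" by (simp add: R_def)
      then show "0 \<in> range R" by blast
    next
      fix x y assume "x \<in> range R" "y \<in> range R"
      then obtain a b where "x = R a" "y = R b" by blast
      then have "x + y = R (\<lambda>j. a j + b j)" by (simp add: R_def rep_alg_add sum.distrib)
      then show "x + y \<in> range R" by blast
    next
      fix c x assume "x \<in> range R"
      then obtain a where "x = R a" by blast
      then have "c *\<^sub>R x = R (\<lambda>j. Poly_Mapping.single 0 c * a j)" by (simp add: R_def rep_alg_scale_left scaleR_sum_right)
      then show "c *\<^sub>R x \<in> range R" by blast
    qed
  qed
  then have HR: "?H \<subseteq> closure (range R)" by (rule closure_mono)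
  have cyc: "cyclic_vec ?H \<pi> k z"
    unfolding cyclic_vec_def
  proof (intro ballI allI impI)
    fix w and \<epsilon> :: real assume w: "w \<in> vecs_over ?H k" and \<epsilon>: "0 < \<epsilon>"
    \<comment> \<open>Dividing by \<open>Suc k\<close> rather than by \<open>k\<close> also covers
      \<open>k = 0\<close> and keeps the total strictly below \<open>\<epsilon>\<close>.\<close>
    have "\<exists>a. dist (R a) (w $ i) < \<epsilon> / real (Suc k)" if "i < k" for i
    proof -
      have "w $ i \<in> closure (range R)" using w that HR by (auto simp: vecs_over_def)
      then show ?thesis using \<epsilon> unfolding closure_approachable by (auto dest: spec[of _ "\<epsilon> / real (Suc k)"])
    qed
    then obtain a where a: "\<And>i. i < k \<Longrightarrow> dist (R (a i)) (w $ i) < \<epsilon> / real (Suc k)" by metis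
    define A where "A = Matrix.mat k k (\<lambda>(i, j). a i j)"
    have "rep_mat \<pi> A z $ i = R (a i)" if "i < k" for i
      using that by (simp add: R_def rep_mat_def A_def z_def)
    then have "L2_set (\<lambda>i. norm (rep_mat \<pi> A z $ i - w $ i)) {..<k} \<le> (\<Sum>i<k. dist (R (a i)) (w $ i))"
      by (intro order_trans[OF L2_set_le_sum]) (auto simp: dist_norm)
    also have "\<dots> \<le> (\<Sum>i<k. \<epsilon> / real (Suc k))" using a by (intro sum_mono less_imp_le) auto
    also have "\<dots> < \<epsilon>" using \<epsilon> by (simp add: field_simps)
    finally show "\<exists>a\<in>carrier_mat k k. L2_set (\<lambda>i. norm (rep_mat \<pi> a z $ i - w $ i)) {..<k} < \<epsilon>"
      by (intro bexI[of _ A]) (auto simp: A_def)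
  qed
  have "\<psi> a = vec_inner (rep_mat \<pi> a z) z" if a: "a \<in> carrier_mat k k" for a
  proof -
    have "vec_inner (rep_mat \<pi> a z) z = (\<Sum>i<k. \<Sum>j<k. inner (rep_alg \<pi> (a $$ (i, j)) (e (0, j))) (e (0, i)))"
      using a by (simp add: vec_inner_def rep_mat_def z_def inner_sum_left)
    also have "\<dots> = \<psi> a"
      unfolding expand[OF a]
      by (intro sum.cong refl) (simp add: rep_alg_def inner_sum_left \<pi> e K_def)
    finally show ?thesis ..
  qed
  with rep z cyc show ?thesis by (rule that)
qed

section \<open>The functional defined by a cocycle, and squares of rows\<close>

lemma cocycle_functional:
  fixes d :: "('g::group_add \<Rightarrow>\<^sub>0 real) mat" and H :: "'h::{real_inner,complete_space} set"
  assumes d: "d \<in> carrier_mat k l" and d': "d' \<in> carrier_mat m k"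
    and rep: "unitary_rep H \<pi>" and z: "z \<in> cocycles H \<pi> d'"
    and ker: "ker_conj d \<subseteq> split_conj_space d'"
    and fac: "\<And>s. s \<in> im_conj d \<Longrightarrow> s \<in> sums_of_squares l \<Longrightarrow> \<exists>t\<in>carrier_mat k k. s = conj_map d t \<and>
      (\<forall>\<Psi>. (\<forall>a\<in>carrier_mat k k. \<forall>b\<in>carrier_mat k k. \<Psi> (a + b) = \<Psi> a + \<Psi> b) \<longrightarrow>
       (\<forall>c\<in>carrier_mat l k. 0 \<le> \<Psi> (mat_star c * c)) \<longrightarrow> 0 \<le> (\<Psi> t :: real))"
  shows "\<exists>\<phi>. (\<forall>a \<in> carrier_mat k k. \<phi> (conj_map d a) = vec_inner (rep_mat \<pi> a z) z) \<and>
    linear_functional (im_conj d) \<phi> \<and> positive_functional l (im_conj d) \<phi> \<and> hermitian_functional (im_conj d) \<phi>"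
proof -
  interpret unitary_representation H \<pi> by unfold_locales (rule rep)
  define \<Psi> where "\<Psi> = (\<lambda>a. vec_inner (rep_mat \<pi> a z) z)"
  have zH: "z \<in> vecs_over H k" and z0: "rep_mat \<pi> d' z = 0\<^sub>v m" using z d' by (auto simp: cocycles_def)
  have dimz: "dim_vec z = k" using zH by (auto simp: vecs_over_def)
  have add: "\<Psi> (a + b) = \<Psi> a + \<Psi> b" if "a \<in> carrier_mat k k" "b \<in> carrier_mat k k" for a b
    unfolding \<Psi>_def using that by (rule vec_inner_rep_mat_add)
  have scale: "\<Psi> (Poly_Mapping.single 0 c \<cdot>\<^sub>m a) = c * \<Psi> a" if "a \<in> carrier_mat k k" for a c
    unfolding \<Psi>_def using that by (rule vec_inner_rep_mat_smult)
  have zero_left: "vec_inner (0\<^sub>v r) w = 0" for r and w :: "'h vec" by (simp add: vec_inner_def)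
  \<comment> \<open>Either summand brings \<open>rep_mat \<pi> d' z = 0\<close> into the inner
    product: \<open>y * d'\<close> in the first argument, and \<open>mat_star d' * x\<close> in the
    second one after taking adjoints.\<close>
  have split0: "\<Psi> a = 0" if "a \<in> split_conj_space d'" for a
  proof -
    have "\<exists>x y. x \<in> carrier_mat m k \<and> y \<in> carrier_mat k m \<and> a = mat_star d' * x + y * d'"
      using that unfolding split_conj_space_def carrier_matD[OF d'] mem_Collect_eq
      by (elim exE conjE) (intro exI conjI)
    then obtain x y where x: "x \<in> carrier_mat m k" and y: "y \<in> carrier_mat k m"
      and a: "a = mat_star d' * x + y * d'" by (elim exE conjE) (rule that)
    have "\<Psi> (mat_star d' * x) = vec_inner (rep_mat \<pi> x z) (rep_mat \<pi> d' z)"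
      unfolding \<Psi>_def by (rule vec_inner_mat_star_mult[OF d' x zH zH])
    also have "\<dots> = vec_inner (rep_mat \<pi> d' z) (rep_mat \<pi> x z)"
      using x d' by (intro vec_inner_commute) (simp add: rep_mat_def)
    finally have 1: "\<Psi> (mat_star d' * x) = 0" by (simp add: z0 zero_left)
    have "rep_mat \<pi> (y * d') z = rep_mat \<pi> y (0\<^sub>v m)" using rep_mat_mult[OF y d' zH] z0 by simp
    also have "\<dots> = 0\<^sub>v k"
    proof -
      have "rep_alg \<pi> c 0 = 0" for c using rep_alg_scale[OF H_zero, of c 0] by simp
      then show ?thesis using y by (intro eq_vecI) (simp_all add: rep_mat_def)
    qed
    finally have "\<Psi> (y * d') = 0" by (simp add: \<Psi>_def zero_left)
    with 1 show ?thesis unfolding a using x y d' by (subst add) auto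
  qed
  have wd: "\<Psi> a = \<Psi> b" if "a \<in> carrier_mat k k" "b \<in> carrier_mat k k" "conj_map d a = conj_map d b" for a b
  proof -
    let ?c = "a + Poly_Mapping.single 0 (-1) \<cdot>\<^sub>m b"
    have "conj_map d ?c = conj_map d b + Poly_Mapping.single 0 (-1) \<cdot>\<^sub>m conj_map d b"
      using that d by (simp add: conj_map_add[OF d] conj_map_smult[OF d])
    also have "\<dots> = 0\<^sub>m l l"
    proof -
      have "x + Poly_Mapping.single 0 (-1) * x = 0" for x :: "'g \<Rightarrow>\<^sub>0 real"
        by (simp add: single_uminus)
      then show ?thesis using conj_map_carrier[OF d that(2)] by (intro eq_matI) auto
    qed
    finally have "?c \<in> ker_conj d" using that d by (auto simp: ker_conj_def)
    then have "\<Psi> ?c = 0" using ker split0 by blast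
    then show ?thesis using that by (simp add: add scale)
  qed
  have pos: "0 \<le> \<Psi> (mat_star c * c)" if "c \<in> carrier_mat l k" for c
    using vec_inner_mat_star_mult[OF that that zH zH] by (simp add: \<Psi>_def vec_inner_self_nonneg)
  have herm: "\<Psi> (mat_star a) = \<Psi> a" if "a \<in> carrier_mat k k" for a
  proof -
    have "\<Psi> a = vec_inner z (rep_mat \<pi> (mat_star a) z)"
      unfolding \<Psi>_def by (rule vec_inner_adjoint[OF that zH zH])
    also have "\<dots> = \<Psi> (mat_star a)"
      unfolding \<Psi>_def using that dimz by (intro vec_inner_commute) (simp add: rep_mat_def)
    finally show ?thesis ..
  qed
  define \<phi> where "\<phi> = (\<lambda>b. \<Psi> (SOME a. a \<in> carrier_mat k k \<and> conj_map d a = b))"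
  have \<phi>: "\<phi> (conj_map d a) = \<Psi> a" if "a \<in> carrier_mat k k" for a
  proof -
    have "(SOME a'. a' \<in> carrier_mat k k \<and> conj_map d a' = conj_map d a) \<in> carrier_mat k k \<and>
        conj_map d (SOME a'. a' \<in> carrier_mat k k \<and> conj_map d a' = conj_map d a) = conj_map d a"
      by (rule someI[of _ a]) (simp add: that)
    then show ?thesis unfolding \<phi>_def using that by (intro wd) auto
  qed
  have im: "im_conj d = conj_map d ` carrier_mat k k" using d by (auto simp: im_conj_def)
  show ?thesis
  proof (intro exI[of _ \<phi>] conjI ballI)
    show "linear_functional (im_conj d) \<phi>"
      unfolding linear_functional_def im
      by (auto simp: conj_map_add[OF d, symmetric] conj_map_smult[OF d, symmetric] \<phi> add scale)
    show "hermitian_functional (im_conj d) \<phi>"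
      unfolding hermitian_functional_def im by (auto simp: conj_map_star[OF d] \<phi> herm)
    show "positive_functional l (im_conj d) \<phi>"
      unfolding positive_functional_def
    proof
      fix s assume "s \<in> im_conj d \<inter> sums_of_squares l"
      then obtain t where t: "t \<in> carrier_mat k k" "s = conj_map d t"
        and \<Psi>t: "\<forall>\<Psi>. (\<forall>a\<in>carrier_mat k k. \<forall>b\<in>carrier_mat k k. \<Psi> (a + b) = \<Psi> a + \<Psi> b) \<longrightarrow>
         (\<forall>c\<in>carrier_mat l k. 0 \<le> \<Psi> (mat_star c * c)) \<longrightarrow> 0 \<le> (\<Psi> t :: real)"
        using fac[of s] by auto
      \<comment> \<open>The value at \<open>s\<close> may be computed from any preimage, in
        particular from \<open>t\<close>, which is made up of squares; this holds although the
        preimage with which \<open>s\<close> was given need not be.\<close>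
      show "0 \<le> \<phi> s" unfolding t(2) \<phi>[OF t(1)] using spec[OF \<Psi>t, of \<Psi>] add pos by blast
    qed
  qed (simp add: \<phi> \<Psi>_def)
qed

text \<open>The row is padded with zero rows, because \<open>sums_of_squares\<close> is generated by
  square matrices while the GNS construction tests positivity on rows.\<close>

lemma row_square_in_sums_of_squares:
  assumes b: "b \<in> carrier_mat 1 l"
  shows "mat_star b * b \<in> sums_of_squares l"
proof -
  define a where "a = Matrix.mat l l (\<lambda>(i, j). if i = 0 then b $$ (0, j) else 0)"
  have a: "a \<in> carrier_mat l l" by (simp add: a_def)
  have "mat_star b * b = mat_star a * a + 0\<^sub>m l l"
  proof (rule eq_matI)
    fix i j assume "i < dim_row (mat_star a * a + 0\<^sub>m l l)" "j < dim_col (mat_star a * a + 0\<^sub>m l l)"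
    then have ij: "i < l" "j < l" by auto
    have "(mat_star a * a) $$ (i, j) = (\<Sum>r<l. if r = 0 then group_alg_star (b $$ (0, i)) * b $$ (0, j) else 0)"
      unfolding index_mat_mult_sum[OF mat_star_carrier[OF a] a ij] using ij
      by (intro sum.cong refl) (simp add: a_def)
    also have "\<dots> = (mat_star b * b) $$ (i, j)"
      unfolding index_mat_mult_sum[OF mat_star_carrier[OF b] b ij] using ij b by simp
    finally show "(mat_star b * b) $$ (i, j) = (mat_star a * a + 0\<^sub>m l l) $$ (i, j)"
      using ij a by simp
  qed (use a b in auto)
  also have "\<dots> \<in> sums_of_squares l" by (intro sums_of_squares.intros a)
  finally show ?thesis .
qed

section \<open>Oriented simplices\<close>

text \<open>Sorting by neighbour swaps: the next entry of \<open>ys\<close> is moved leftwards to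
  its place, behind a prefix \<open>us\<close> that is already in order.\<close>

lemma adjacent_swap_induct:
  assumes xs: "P xs" and eq: "mset xs = mset ys"
    and swap: "\<And>us x y vs. P (us @ x # y # vs) \<Longrightarrow> P (us @ y # x # vs)"
  shows "P ys"
proof -
  have move: "P (us @ a @ y # b) \<Longrightarrow> P (us @ y # a @ b)" for us a y b
  proof (induction a arbitrary: us)
    case (Cons x a)
    have "P ((us @ [x]) @ y # a @ b)" by (rule Cons.IH) (use Cons.prems in simp)
    then show ?case using swap[of us x y "a @ b"] by simp
  qed simp
  have "P (us @ xs) \<Longrightarrow> mset xs = mset ys \<Longrightarrow> P (us @ ys)" for us xs
  proof (induction ys arbitrary: us xs)
    case (Cons y ys)
    have "y \<in> set xs" using Cons.prems(2) by (metis list.set_intros(1) set_mset_mset)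
    then obtain a b where ab: "xs = a @ y # b" by (auto simp: in_set_conv_decomp)
    have "P ((us @ [y]) @ (a @ b))" using move[of us a y b] Cons.prems(1) ab by simp
    then have "P ((us @ [y]) @ ys)" by (rule Cons.IH) (use Cons.prems(2) ab in simp)
    then show ?case by simp
  qed simp
  from this[of "[]"] show ?thesis using xs eq by simp
qed

text \<open>Swaps of neighbours generate all permutations; restricting to them allows the condition
  to be checked by recursion along the list.\<close>

definition alternating :: "('v list \<Rightarrow> 'b::group_add) \<Rightarrow> bool" where
  "alternating F \<longleftrightarrow> (\<forall>us x y vs. F (us @ x # y # vs) = - F (us @ y # x # vs))"

lemma alternatingD: "alternating F \<Longrightarrow> F (us @ x # y # vs) = - F (us @ y # x # vs)"
  unfolding alternating_def by blast

text \<open>Two equal entries brought next to each other give F = -F, which forces 0 since integral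
  chains have no 2-torsion; the swaps carry this value back to the given order.\<close>

lemma alternating_not_distinct:
  fixes F :: "'v list \<Rightarrow> 'a \<Rightarrow>\<^sub>0 int"
  assumes F: "alternating F" and xs: "\<not> distinct xs"
  shows "F xs = 0"
proof -
  obtain us x vs ws where "xs = us @ [x] @ vs @ [x] @ ws" using xs not_distinct_decomp by metis
  then have m: "mset (x # x # us @ vs @ ws) = mset xs" by simp
  have neg: "F (x # x # us @ vs @ ws) = - F (x # x # us @ vs @ ws)"
    using alternatingD[OF F, of "[]" x x "us @ vs @ ws"] by simp
  have "F (x # x # us @ vs @ ws) = 0"
  proof (rule poly_mapping_eqI)
    fix i
    show "Poly_Mapping.lookup (F (x # x # us @ vs @ ws)) i = Poly_Mapping.lookup 0 i"
      using arg_cong[OF neg, of "\<lambda>f. Poly_Mapping.lookup f i"] by simp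
  qed
  then show ?thesis using m
  proof (rule adjacent_swap_induct[where P = "\<lambda>xs. F xs = 0"])
    fix us x y vs assume "F (us @ x # y # vs) = 0"
    then show "F (us @ y # x # vs) = 0" using alternatingD[OF F, of us x y vs] by simp
  qed
qed

text \<open>The comparison principle that replaces sign computations below: an identity between
  alternating expressions is verified on one ordering of each simplex, usually the chosen one, and
  lists with repetitions are included.\<close>

lemma alternating_eqI:
  fixes F G :: "'v list \<Rightarrow> 'a \<Rightarrow>\<^sub>0 int"
  assumes F: "alternating F" and G: "alternating G"
    and zs: "distinct zs" "F zs = G zs" and xs: "set xs = set zs"
  shows "F xs = G xs"
proof (cases "distinct xs")
  case True
  then have "mset zs = mset xs" using zs(1) xs set_eq_iff_mset_eq_distinct by metis
  with zs(2) show ?thesis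
  proof (rule adjacent_swap_induct)
    fix us x y vs assume "F (us @ x # y # vs) = G (us @ x # y # vs)"
    then show "F (us @ y # x # vs) = G (us @ y # x # vs)"
      using alternatingD[OF F, of us x y vs] alternatingD[OF G, of us x y vs] by simp
  qed
next
  case False
  then show ?thesis using F G by (simp add: alternating_not_distinct)
qed

text \<open>Composition with the transposition of the two positions matches the permutations counted
  on one side with those counted on the other and reverses every sign.\<close>

lemma rel_sign_swap: "rel_sign (us @ x # y # vs) zs = - rel_sign (us @ y # x # vs) zs"
proof -
  let ?xs = "us @ x # y # vs" and ?ys = "us @ y # x # vs"
  define k n where "k = length us" and "n = length ?xs"
  define t where "t = Transposition.transpose k (Suc k)"
  have t: "t permutes {..<n}" unfolding t_def by (rule permutes_swap_id) (auto simp: k_def n_def)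
  have tt: "t \<circ> t = id" by (simp add: t_def)
  have st: "sign t = -1" by (simp add: t_def sign_swap_id)
  have pt: "permute_list t ?xs = ?ys"
  proof (rule nth_equalityI)
    fix i assume "i < length (permute_list t ?xs)"
    then show "permute_list t ?xs ! i = ?ys ! i"
      using t by (auto simp: n_def permute_list_nth t_def Transposition.transpose_def k_def nth_append nth_Cons split: nat.splits)
  qed simp
  have comp: "permute_list (t \<circ> p) ?xs = permute_list p ?ys" if "p permutes {..<n}" for p
    using permute_list_compose[of p ?xs t] that t unfolding pt n_def by simp
  have sgn: "sign (t \<circ> p) = - sign p" if "p permutes {..<n}" for p
  proof -
    have "permutation t" "permutation p" using t that permutation_permutes finite_lessThan by blast+
    then show ?thesis by (simp add: sign_compose st)
  qed
  have "rel_sign ?xs zs = (\<Sum>p | p permutes {..<n} \<and> permute_list p ?ys = zs. - sign p)"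
    unfolding rel_sign_def n_def[symmetric]
  proof (rule sum.reindex_bij_witness[where i = "\<lambda>p. t \<circ> p" and j = "\<lambda>p. t \<circ> p"])
    fix p assume p: "p \<in> {p. p permutes {..<n} \<and> permute_list p ?xs = zs}"
    then have tp: "t \<circ> p permutes {..<n}" using t permutes_compose by blast
    show "t \<circ> (t \<circ> p) = p" using tt by (simp add: comp_assoc[symmetric])
    then show "t \<circ> p \<in> {p. p permutes {..<n} \<and> permute_list p ?ys = zs}"
      using p tp comp[OF tp] by simp
    show "- sign (t \<circ> p) = sign p" using p sgn by simp
  next
    fix p assume p: "p \<in> {p. p permutes {..<n} \<and> permute_list p ?ys = zs}"
    then have tp: "t \<circ> p permutes {..<n}" using t permutes_compose by blast
    show "t \<circ> (t \<circ> p) = p" using tt by (simp add: comp_assoc[symmetric])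
    show "t \<circ> p \<in> {p. p permutes {..<n} \<and> permute_list p ?xs = zs}" using p tp comp by simp
  qed
  also have "\<dots> = - rel_sign ?ys zs"
    by (simp add: rel_sign_def n_def sum_negf)
  finally show ?thesis .
qed

lemma rel_sign_self:
  assumes "distinct zs"
  shows "rel_sign zs zs = 1"
proof -
  have "p = id" if p: "p permutes {..<length zs}" "permute_list p zs = zs" for p
  proof
    fix i
    show "p i = id i"
    proof (cases "i < length zs")
      case True
      then have "zs ! p i = zs ! i" "p i < length zs"
        using p permute_list_nth[OF p(1) True] permutes_in_image[OF p(1)] by auto
      then show ?thesis using assms True by (simp add: nth_eq_iff_index_eq)
    next
      case False
      then show ?thesis using p(1) by (simp add: permutes_def)
    qed
  qed
  then have "{p. p permutes {..<length zs} \<and> permute_list p zs = zs} = {id}"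
    by (auto simp: permutes_id)
  then show ?thesis by (simp add: rel_sign_def)
qed

abbreviation osimplex :: "('v set \<Rightarrow> 'v list) \<Rightarrow> 'v list \<Rightarrow> 'v set \<Rightarrow>\<^sub>0 int" where
  "osimplex ori \<equiv> ordered_simplex ori 1"

lemma ordered_simplex_cmul: "ordered_simplex ori c xs = frag_cmul c (osimplex ori xs)"
  by (rule poly_mapping_eqI) (simp add: ordered_simplex_def lookup_single when_def)

lemma alternating_osimplex: "alternating (osimplex (ori :: 'v set \<Rightarrow> 'v list))"
  unfolding alternating_def
proof (intro allI)
  fix us vs :: "'v list" and x y
  have e: "set (us @ y # x # vs) = set (us @ x # y # vs)" by auto
  show "osimplex ori (us @ x # y # vs) = - osimplex ori (us @ y # x # vs)"
    unfolding ordered_simplex_def e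
    by (subst rel_sign_swap) (simp only: mult_1 single_uminus)
qed

definition del_at :: "nat \<Rightarrow> 'a list \<Rightarrow> 'a list" where
  "del_at i xs = take i xs @ drop (Suc i) xs"

text \<open>The alternating sum of the faces, by recursion with an accumulator for the vertices already
  passed; this form makes the effect of swapping neighbours visible.\<close>

primrec face_sum :: "('v set \<Rightarrow> 'v list) \<Rightarrow> 'v list \<Rightarrow> 'v list \<Rightarrow> 'v set \<Rightarrow>\<^sub>0 int" where
  "face_sum ori pre [] = 0"
| "face_sum ori pre (x # xs) = osimplex ori (pre @ xs) - face_sum ori (pre @ [x]) xs"

lemma face_sum_eq:
  "face_sum ori pre xs = (\<Sum>i<length xs. frag_cmul ((-1) ^ i) (osimplex ori (pre @ del_at i xs)))"
proof (induction xs arbitrary: pre)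
  case (Cons x xs)
  have "(\<Sum>i<length (x # xs). frag_cmul ((-1) ^ i) (osimplex ori (pre @ del_at i (x # xs)))) =
      osimplex ori (pre @ xs) + (\<Sum>i<length xs. frag_cmul ((-1) ^ Suc i) (osimplex ori (pre @ x # del_at i xs)))"
    unfolding length_Cons sum.lessThan_Suc_shift by (simp add: del_at_def)
  also have "\<dots> = osimplex ori (pre @ xs) - (\<Sum>i<length xs. frag_cmul ((-1) ^ i) (osimplex ori (pre @ x # del_at i xs)))"
    by (simp add: sum_negf[symmetric])
  finally show ?case using Cons.IH[of "pre @ [x]"] by simp
qed simp

lemma face_sum_swap_left: "face_sum ori (us @ x # y # vs) ws = - face_sum ori (us @ y # x # vs) ws"
proof (induction ws arbitrary: vs)
  case (Cons w ws)
  then show ?case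
    using alternatingD[OF alternating_osimplex, of ori us x y "vs @ ws"] Cons.IH[of "vs @ [w]"] by simp
qed simp

text \<open>The two faces omitting \<open>x\<close> or \<open>y\<close> stand next to each other
  with opposite signs, so the swap exchanges them up to sign. In every other face both vertices
  remain and the ordered simplex itself changes sign; for the faces omitting a later vertex this is
  \<open>face_sum_swap_left\<close>.\<close>

lemma face_sum_swap_right: "face_sum ori pre (us @ x # y # vs) = - face_sum ori pre (us @ y # x # vs)"
proof (induction us arbitrary: pre)
  case Nil
  then show ?case using face_sum_swap_left[of ori pre x y "[]" vs] by simp
next
  case (Cons u us)
  then show ?case
    using alternatingD[OF alternating_osimplex, of ori "pre @ us" x y vs] Cons.IH[of "pre @ [u]"] by simp
qed

lemma boundary_face_sum: "boundary ori \<sigma> = face_sum ori [] (ori \<sigma>)"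
  unfolding boundary_def face_sum_eq del_at_def by (intro sum.cong refl) (simp add: ordered_simplex_cmul[of _ "(-1) ^ _"])

abbreviation bd :: "('v set \<Rightarrow> 'v list) \<Rightarrow> ('v set \<Rightarrow>\<^sub>0 int) \<Rightarrow> ('v set \<Rightarrow>\<^sub>0 int)" where
  "bd ori \<equiv> frag_extend (boundary ori)"

lemma osimplex_ori: "distinct (ori \<sigma>) \<Longrightarrow> set (ori \<sigma>) = \<sigma> \<Longrightarrow> osimplex ori (ori \<sigma>) = frag_of \<sigma>"
  by (simp add: ordered_simplex_def rel_sign_self)

text \<open>Both sides alternate in \<open>xs\<close> and agree on the chosen ordering by the
  definition of the boundary. Lists with repetitions are covered too, as needed for approximations
  that collapse a simplex.\<close>

lemma bd_osimplex:
  assumes "distinct (ori (set xs))" "set (ori (set xs)) = set xs"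
  shows "bd ori (osimplex ori xs) = face_sum ori [] xs"
proof (rule alternating_eqI[OF _ _ assms(1)])
  show "alternating (\<lambda>xs. bd ori (osimplex ori xs))"
    unfolding alternating_def
  proof (intro allI)
    fix us x y vs
    show "bd ori (osimplex ori (us @ x # y # vs)) = - bd ori (osimplex ori (us @ y # x # vs))"
      using alternatingD[OF alternating_osimplex, of ori us x y vs] by (simp add: frag_extend_minus)
  qed
  show "alternating (face_sum ori [])" unfolding alternating_def by (intro allI face_sum_swap_right)
  show "bd ori (osimplex ori (ori (set xs))) = face_sum ori [] (ori (set xs))"
    using osimplex_ori[of ori "set xs", OF assms] by (simp add: boundary_face_sum)
qed (use assms in simp)

lemma osimplex_not_distinct: "\<not> distinct xs \<Longrightarrow> osimplex ori xs = 0"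
  by (rule alternating_not_distinct[OF alternating_osimplex])

lemma osimplex_pm:
  assumes "distinct xs" "distinct (ori (set xs))" "set (ori (set xs)) = set xs"
  shows "osimplex ori xs = frag_of (set xs) \<or> osimplex ori xs = - frag_of (set xs)"
proof -
  have "mset (ori (set xs)) = mset xs" using assms set_eq_iff_mset_eq_distinct by metis
  then show ?thesis
  proof (rule adjacent_swap_induct[where P = "\<lambda>ys. osimplex ori ys = frag_of (set xs) \<or> osimplex ori ys = - frag_of (set xs)", rotated])
    show "osimplex ori (ori (set xs)) = frag_of (set xs) \<or> osimplex ori (ori (set xs)) = - frag_of (set xs)"
      using osimplex_ori[of ori "set xs", OF assms(2,3)] by simp
    fix us x y vs assume "osimplex ori (us @ x # y # vs) = frag_of (set xs) \<or> osimplex ori (us @ x # y # vs) = - frag_of (set xs)"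
    then show "osimplex ori (us @ y # x # vs) = frag_of (set xs) \<or> osimplex ori (us @ y # x # vs) = - frag_of (set xs)"
      using alternatingD[OF alternating_osimplex, of ori us y x vs] by auto
  qed
qed

lemma keys_osimplex: "Poly_Mapping.keys (osimplex ori xs) \<subseteq> {set xs}"
  by (simp add: ordered_simplex_def)

section \<open>Simplicial approximation\<close>

lemma frag_extend_frag_extend:
  "frag_extend f (frag_extend g c) = frag_extend (\<lambda>x. frag_extend f (g x)) c"
  using subset_UNIV by (induction c rule: frag_induction) (auto simp: frag_extend_diff)

lemma length_del_at [simp]: "i < length xs \<Longrightarrow> length (del_at i xs) = length xs - 1"
  by (simp add: del_at_def)

lemma nth_del_at: "i < length xs \<Longrightarrow> j < length xs - 1 \<Longrightarrow> del_at i xs ! j = xs ! (if j < i then j else Suc j)"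
  by (auto simp: del_at_def nth_append min_def)

lemma set_del_at: "set (del_at i xs) \<subseteq> set xs"
  using set_take_subset[of i xs] set_drop_subset[of "Suc i" xs] by (auto simp: del_at_def)

lemma distinct_del_at: "distinct xs \<Longrightarrow> distinct (del_at i xs)"
  by (simp add: del_at_def set_take_disj_set_drop_if_distinct)

lemma del_at_neq_Nil: "2 \<le> length xs \<Longrightarrow> i < length xs \<Longrightarrow> del_at i xs \<noteq> []"
  by (metis length_del_at length_greater_0_conv one_le_numeral ordered_cancel_comm_monoid_diff_class.add_diff_inverse
      Suc_1 Suc_le_lessD zero_less_diff)

lemma face_sum_Nil_eq: "face_sum ori [] xs = (\<Sum>i<length xs. frag_cmul ((-1) ^ i) (osimplex ori (del_at i xs)))"
  by (simp add: face_sum_eq)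

text \<open>Accumulated vertices are never deleted; this isolates the one face that omits the first
  vertex of a list.\<close>

lemma keys_face_sum: "\<sigma> \<in> Poly_Mapping.keys (face_sum ori pre xs) \<Longrightarrow> set pre \<subseteq> \<sigma>"
proof (induction xs arbitrary: pre)
  case (Cons x xs)
  have "\<sigma> \<in> Poly_Mapping.keys (osimplex ori (pre @ xs)) \<union> Poly_Mapping.keys (face_sum ori (pre @ [x]) xs)"
    using Cons.prems keys_diff by fastforce
  then show ?case
    using Cons.IH[of "pre @ [x]"] keys_osimplex[of ori "pre @ xs"] by auto
qed simp

text \<open>The vertex of largest barycentric coordinate, to which a point is pushed by simplicial
  approximation. Ties are broken by a choice depending on the point alone, so a corner shared by
  several singular simplices goes to the same vertex.\<close>

definition main_vertex :: "('v \<Rightarrow> real) \<Rightarrow> 'v" where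
  "main_vertex x = (SOME v. \<forall>w. x w \<le> x v)"

locale oriented_complex =
  fixes X :: "'v set set" and ori :: "'v set \<Rightarrow> 'v list"
  assumes complex: "abstract_complex X"
    and ori_distinct: "\<sigma> \<in> X \<Longrightarrow> distinct (ori \<sigma>)"
    and ori_set: "\<sigma> \<in> X \<Longrightarrow> set (ori \<sigma>) = \<sigma>"
begin

lemma X_finite: "\<sigma> \<in> X \<Longrightarrow> finite \<sigma>" and X_nonempty: "\<sigma> \<in> X \<Longrightarrow> \<sigma> \<noteq> {}"
  and X_subset: "\<sigma> \<in> X \<Longrightarrow> \<rho> \<subseteq> \<sigma> \<Longrightarrow> \<rho> \<noteq> {} \<Longrightarrow> \<rho> \<in> X"
  using complex unfolding abstract_complex_def by blast+

lemma bd_osimplex_X: "set xs \<in> X \<Longrightarrow> bd ori (osimplex ori xs) = face_sum ori [] xs"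
  by (rule bd_osimplex) (simp_all add: ori_distinct ori_set)

lemma osimplex_pm_X: "set xs \<in> X \<Longrightarrow> distinct xs \<Longrightarrow>
    osimplex ori xs = frag_of (set xs) \<or> osimplex ori xs = - frag_of (set xs)"
  by (rule osimplex_pm) (simp_all add: ori_distinct ori_set)

lemma osimplex_ori_X: "\<sigma> \<in> X \<Longrightarrow> osimplex ori (ori \<sigma>) = frag_of \<sigma>"
  by (simp add: osimplex_ori ori_distinct ori_set)

lemma sum_simplex_points_le_1:
  assumes "\<sigma> \<in> X" "x \<in> simplex_points \<sigma>" "finite S"
  shows "sum x S \<le> 1"
proof -
  have "sum x S = sum x (S \<inter> \<sigma>)"
    using assms by (intro sum.mono_neutral_right) (auto simp: simplex_points_def)
  also have "\<dots> \<le> sum x \<sigma>"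
    using assms X_finite by (intro sum_mono2) (auto simp: simplex_points_def)
  also have "\<dots> = 1" using assms by (simp add: simplex_points_def)
  finally show ?thesis .
qed

lemma main_vertex_max:
  assumes "\<sigma> \<in> X" "x \<in> simplex_points \<sigma>"
  shows "x w \<le> x (main_vertex x)"
proof -
  have fin: "finite (x ` \<sigma>)" and "x ` \<sigma> \<noteq> {}"
    using X_finite[OF assms(1)] X_nonempty[OF assms(1)] by auto
  then have "Max (x ` \<sigma>) \<in> x ` \<sigma>" by (rule Max_in)
  then obtain v where v0: "v \<in> \<sigma>" "Max (x ` \<sigma>) = x v" by blast
  have v: "x w \<le> x v" if "w \<in> \<sigma>" for w
    unfolding v0(2)[symmetric] using fin that by simp
  have "\<forall>w. x w \<le> x v"
  proof
    fix w show "x w \<le> x v"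
    proof (cases "w \<in> \<sigma>")
      case False
      then have "x w = 0" using assms by (auto simp: simplex_points_def)
      then show ?thesis using assms by (simp add: simplex_points_def)
    qed (rule v)
  qed
  then show ?thesis unfolding main_vertex_def by (rule someI2) simp
qed

lemma main_vertex_in:
  assumes "\<sigma> \<in> X" "x \<in> simplex_points \<sigma>"
  shows "main_vertex x \<in> \<sigma>"
proof (rule ccontr)
  assume "main_vertex x \<notin> \<sigma>"
  then have "x (main_vertex x) = 0" using assms by (auto simp: simplex_points_def)
  then have "x w \<le> 0" for w using main_vertex_max[OF assms] by metis
  then have "sum x \<sigma> \<le> 0" by (simp add: sum_nonpos)
  then show False using assms by (simp add: simplex_points_def)
qed

text \<open>Some coordinate in \<open>\<sigma>\<close> exceeds the total mass outside \<open>\<sigma>\<close>, so the largest one is attained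
  in \<open>\<sigma>\<close>.\<close>

definition nbhd :: "'v set \<Rightarrow> ('v \<Rightarrow> real) set" where
  "nbhd \<sigma> = {x \<in> topspace (realization X). \<exists>v\<in>\<sigma>. 1 - sum x \<sigma> < x v}"

lemma main_vertex_nbhd:
  assumes "\<sigma> \<in> X" "x \<in> nbhd \<sigma>"
  shows "main_vertex x \<in> \<sigma>"
proof (rule ccontr)
  assume n: "main_vertex x \<notin> \<sigma>"
  obtain \<rho> where r: "\<rho> \<in> X" "x \<in> simplex_points \<rho>" using assms(2) by (auto simp: nbhd_def topspace_realization)
  obtain v where v: "1 - sum x \<sigma> < x v" using assms(2) by (auto simp: nbhd_def)
  have "sum x (insert (main_vertex x) \<sigma>) \<le> 1" by (rule sum_simplex_points_le_1[OF r]) (simp add: X_finite assms)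
  then have "x (main_vertex x) < x v" using n v X_finite[OF assms(1)] by simp
  then show False using main_vertex_max[OF r, of v] by simp
qed

lemma openin_nbhd: "openin (realization X) (nbhd \<sigma>)"
  unfolding openin_realization realization_open_def
proof (intro conjI ballI)
  show "nbhd \<sigma> \<subseteq> (\<Union>\<sigma>\<in>X. simplex_points \<sigma>)" by (auto simp: nbhd_def topspace_realization)
  fix \<tau> assume t: "\<tau> \<in> X"
  have "open {x :: 'v \<Rightarrow> real. 1 - sum x \<sigma> < x v}" for v
    by (intro open_Collect_less continuous_intros continuous_on_product_coordinates)
  then have "open (\<Union>v\<in>\<sigma>. {x :: 'v \<Rightarrow> real. 1 - sum x \<sigma> < x v})" by blast
  then have "openin (top_of_set (simplex_points \<tau>)) (simplex_points \<tau> \<inter> (\<Union>v\<in>\<sigma>. {x. 1 - sum x \<sigma> < x v}))"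
    by (rule openin_open_Int)
  moreover have "nbhd \<sigma> \<inter> simplex_points \<tau> = simplex_points \<tau> \<inter> (\<Union>v\<in>\<sigma>. {x. 1 - sum x \<sigma> < x v})"
    using t by (auto simp: nbhd_def topspace_realization)
  ultimately show "openin (top_of_set (simplex_points \<tau>)) (nbhd \<sigma> \<inter> simplex_points \<tau>)" by simp
qed

lemma nbhd_cover: "topspace (realization X) \<subseteq> \<Union>(nbhd ` X)"
proof
  fix x assume x: "x \<in> topspace (realization X)"
  then obtain \<sigma> where s: "\<sigma> \<in> X" "x \<in> simplex_points \<sigma>" by (auto simp: topspace_realization)
  then have sx: "sum x \<sigma> = 1" "\<And>v. 0 \<le> x v" by (auto simp: simplex_points_def)
  then obtain v where "v \<in> \<sigma>" "x v \<noteq> 0" by (metis sum.neutral zero_neq_one)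
  then have "x \<in> nbhd \<sigma>" using x sx(1) sx(2)[of v] by (auto simp: nbhd_def intro!: bexI[of _ v])
  then show "x \<in> \<Union>(nbhd ` X)" using s by blast
qed

lemma continuous_map_simplex_points:
  assumes "\<sigma> \<in> X"
  shows "continuous_map (top_of_set (simplex_points \<sigma>)) (realization X) id"
  unfolding continuous_map_def
proof (intro conjI allI impI)
  show "id \<in> topspace (top_of_set (simplex_points \<sigma>)) \<rightarrow> topspace (realization X)"
    using assms by (auto simp: topspace_realization)
  fix U assume "openin (realization X) U"
  then have "openin (top_of_set (simplex_points \<sigma>)) (U \<inter> simplex_points \<sigma>)"
    using assms by (simp add: openin_realization realization_open_def)
  moreover have "{x \<in> topspace (top_of_set (simplex_points \<sigma>)). id x \<in> U} = U \<inter> simplex_points \<sigma>" by auto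
  ultimately show "openin (top_of_set (simplex_points \<sigma>)) {x \<in> topspace (top_of_set (simplex_points \<sigma>)). id x \<in> U}"
    by simp
qed

text \<open>Restricted to the standard simplex because singular simplices are extensional functions.
  Summing over positions instead of vertices gives the right weights also when the list has
  repetitions.\<close>

definition affine_simplex :: "'v list \<Rightarrow> (nat \<Rightarrow> real) \<Rightarrow> 'v \<Rightarrow> real" where
  "affine_simplex xs = restrict (\<lambda>t v. \<Sum>j<length xs. if xs ! j = v then t j else 0) (standard_simplex (length xs - 1))"

lemma affine_simplex_points:
  assumes xs: "xs \<noteq> []" and t: "t \<in> standard_simplex (length xs - 1)"
  shows "affine_simplex xs t \<in> simplex_points (set xs)"
  unfolding simplex_points_def
proof (intro CollectI conjI allI)
  let ?f = "affine_simplex xs t"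
  have f: "?f v = (\<Sum>j<length xs. if xs ! j = v then t j else 0)" for v using t by (simp add: affine_simplex_def)
  show "0 \<le> ?f v" for v unfolding f using t by (intro sum_nonneg) (auto simp: standard_simplex_def)
  show "{v. ?f v \<noteq> 0} \<subseteq> set xs"
  proof (clarify, rule ccontr)
    fix v assume v: "?f v \<noteq> 0" "v \<notin> set xs"
    then have "?f v = 0" unfolding f by (intro sum.neutral) auto
    then show False using v by simp
  qed
  have "sum ?f (set xs) = (\<Sum>j<length xs. \<Sum>v\<in>set xs. if xs ! j = v then t j else 0)"
    unfolding f by (rule sum.swap)
  also have "\<dots> = (\<Sum>j<length xs. t j)" by (intro sum.cong refl) (simp add: sum.delta)
  also have "{..<length xs} = {..length xs - 1}" using xs by (cases xs) auto
  finally show "sum ?f (set xs) = 1" using t by (simp add: standard_simplex_def)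
qed

lemma continuous_affine_simplex:
  assumes xs: "set xs \<in> X"
  shows "continuous_map (subtopology (powertop_real UNIV) (standard_simplex (length xs - 1)))
    (top_of_set (simplex_points (set xs))) (affine_simplex xs)"
proof -
  have ne: "xs \<noteq> []" using X_nonempty[OF xs] by auto
  have "continuous_on (standard_simplex (length xs - 1)) (\<lambda>t v. \<Sum>j<length xs. if xs ! j = v then t j else 0)"
  proof (rule continuous_on_coordinatewise_then_product)
    fix v
    have "continuous_on (standard_simplex (length xs - 1)) (\<lambda>t. if xs ! j = v then t j else 0)" for j
      by (cases "xs ! j = v") (auto intro: continuous_on_product_coordinates continuous_on_subset)
    then show "continuous_on (standard_simplex (length xs - 1)) (\<lambda>t. \<Sum>j<length xs. if xs ! j = v then t j else 0)"
      by (intro continuous_on_sum)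
  qed
  then have "continuous_on (standard_simplex (length xs - 1)) (affine_simplex xs)"
    by (rule continuous_on_cong[THEN iffD1, rotated -1]) (auto simp: affine_simplex_def)
  then have "continuous_map (top_of_set (standard_simplex (length xs - 1))) (top_of_set (simplex_points (set xs))) (affine_simplex xs)"
    using affine_simplex_points[OF ne] by (auto simp: continuous_map_in_subtopology)
  then show ?thesis by (simp add: euclidean_product_topology)
qed

lemma singular_affine_simplex:
  assumes xs: "set xs \<in> X"
  shows "singular_simplex (length xs - 1) (subtopology (realization X) (simplex_points (set xs))) (affine_simplex xs)"
  unfolding singular_simplex_def
proof
  have ne: "xs \<noteq> []" using X_nonempty[OF xs] by auto
  show "continuous_map (subtopology (powertop_real UNIV) (standard_simplex (length xs - 1)))
     (subtopology (realization X) (simplex_points (set xs))) (affine_simplex xs)"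
    unfolding continuous_map_in_subtopology
    using continuous_map_compose[OF continuous_affine_simplex[OF xs] continuous_map_simplex_points[OF xs]]
      affine_simplex_points[OF ne] by auto
qed (simp add: affine_simplex_def)

abbreviation corner :: "nat \<Rightarrow> nat \<Rightarrow> real" where
  "corner i \<equiv> \<lambda>j. if j = i then 1 else 0"

definition corners :: "nat \<Rightarrow> ((nat \<Rightarrow> real) \<Rightarrow> 'v \<Rightarrow> real) \<Rightarrow> 'v list" where
  "corners p s = map (\<lambda>i. main_vertex (s (corner i))) [0..<Suc p]"

lemma nth_corners: "j \<le> q \<Longrightarrow> corners q u ! j = main_vertex (u (corner j))"
  unfolding corners_def by (subst nth_map) (simp_all del: upt_Suc)

lemma length_corners [simp]: "length (corners p s) = Suc p" by (simp add: corners_def)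

text \<open>Simplicial approximation; this commutes with the boundary only on singular simplices so small
  that their corners span a simplex of \<open>X\<close>.\<close>

abbreviation approx :: "nat \<Rightarrow> ('v \<Rightarrow> real) chain \<Rightarrow> 'v set \<Rightarrow>\<^sub>0 int" where
  "approx p \<equiv> frag_extend (\<lambda>s. osimplex ori (corners p s))"

lemma simplical_face_corner: "simplical_face k (corner i) = corner (if i < k then i else Suc i)"
  by (auto simp: simplical_face_def fun_eq_iff)

lemma corners_face:
  assumes "1 \<le> p" "k \<le> p"
  shows "corners (p - 1) (singular_face p k s) = del_at k (corners p s)"
proof (rule nth_equalityI)
  show "length (corners (p - 1) (singular_face p k s)) = length (del_at k (corners p s))" using assms by simp
  fix i assume "i < length (corners (p - 1) (singular_face p k s))"
  then have i: "i \<le> p - 1" "i < p" using assms by auto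
  have "singular_face p k s (corner i) = s (corner (if i < k then i else Suc i))"
    using i by (simp add: singular_face_def simplical_face_corner)
  then show "corners (p - 1) (singular_face p k s) ! i = del_at k (corners p s) ! i"
    using i assms by (simp add: nth_corners nth_del_at)
qed

text \<open>Deleting the corner at position \<open>k\<close> corresponds to taking the singular face
  \<open>k\<close>, with the same sign. Degree 0 is excluded: there the face of a vertex is the
  empty list, whereas the singular boundary is 0.\<close>

lemma bd_approx:
  assumes "1 \<le> p" and good: "\<And>s. s \<in> Poly_Mapping.keys c \<Longrightarrow> set (corners p s) \<in> X"
  shows "bd ori (approx p c) = approx (p - 1) (chain_boundary p c)"
proof -
  have "bd ori (approx p c) = frag_extend (\<lambda>s. bd ori (osimplex ori (corners p s))) c"
    by (rule frag_extend_frag_extend)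
  also have "\<dots> = frag_extend (\<lambda>s. approx (p - 1) (\<Sum>k\<le>p. frag_cmul ((-1) ^ k) (frag_of (singular_face p k s)))) c"
  proof (rule frag_extend_eq)
    fix s assume "s \<in> Poly_Mapping.keys c"
    then have "bd ori (osimplex ori (corners p s)) = face_sum ori [] (corners p s)"
      by (intro bd_osimplex_X good)
    also have "\<dots> = (\<Sum>k\<le>p. frag_cmul ((-1) ^ k) (osimplex ori (del_at k (corners p s))))"
      by (simp add: face_sum_Nil_eq lessThan_Suc_atMost)
    also have "\<dots> = approx (p - 1) (\<Sum>k\<le>p. frag_cmul ((-1) ^ k) (frag_of (singular_face p k s)))"
      using assms(1) by (simp add: frag_extend_sum frag_extend_cmul corners_face[symmetric])
    finally show "bd ori (osimplex ori (corners p s)) =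
      approx (p - 1) (\<Sum>k\<le>p. frag_cmul ((-1) ^ k) (frag_of (singular_face p k s)))" .
  qed
  also have "\<dots> = approx (p - 1) (chain_boundary p c)"
    using assms(1) by (simp add: chain_boundary_def frag_extend_frag_extend)
  finally show ?thesis .
qed

lemma affine_simplex_corner:
  assumes "i < length xs"
  shows "affine_simplex xs (corner i) = (\<lambda>v. if v = xs ! i then 1 else 0)"
proof
  fix v
  have "corner i \<in> standard_simplex (length xs - 1)" using assms by simp
  then have "affine_simplex xs (corner i) v = (\<Sum>j<length xs. if xs ! j = v then corner i j else 0)"
    by (simp add: affine_simplex_def)
  also have "\<dots> = (\<Sum>j<length xs. if j = i then (if v = xs ! i then 1 else 0) else 0)"
    by (intro sum.cong) auto
  also have "\<dots> = (if v = xs ! i then 1 else 0)" using assms by simp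
  finally show "affine_simplex xs (corner i) v = (if v = xs ! i then 1 else 0)" .
qed

lemma corners_affine_simplex:
  assumes "set xs \<in> X"
  shows "corners (length xs - 1) (affine_simplex xs) = xs"
proof (rule nth_equalityI)
  have ne: "xs \<noteq> []" using X_nonempty[OF assms] by auto
  then show len: "length (corners (length xs - 1) (affine_simplex xs)) = length xs" by simp
  fix i assume "i < length (corners (length xs - 1) (affine_simplex xs))"
  then have i: "i < length xs" "i < Suc (length xs - 1)" using len by auto
  have "main_vertex (\<lambda>v. if v = xs ! i then 1 else 0 :: real) = xs ! i"
    unfolding main_vertex_def by (rule some_equality) (auto split: if_splits dest: spec[of _ "xs ! i"])
  then show "corners (length xs - 1) (affine_simplex xs) ! i = xs ! i"
    using i by (simp add: nth_corners affine_simplex_corner)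
qed

lemma singular_face_affine_simplex:
  assumes "2 \<le> length xs" "k < length xs"
  shows "singular_face (length xs - 1) k (affine_simplex xs) = affine_simplex (del_at k xs)"
proof
  fix t
  let ?S = "standard_simplex (length xs - 1 - 1)"
  show "singular_face (length xs - 1) k (affine_simplex xs) t = affine_simplex (del_at k xs) t"
  proof (cases "t \<in> ?S")
    case True
    have "simplical_face k t \<in> standard_simplex (length xs - 1)"
      using assms True by (intro simplical_face_in_standard_simplex) auto
    then have "singular_face (length xs - 1) k (affine_simplex xs) t =
        (\<lambda>v. \<Sum>j<length xs. if xs ! j = v then simplical_face k t j else 0)"
      using True by (simp add: singular_face_def affine_simplex_def)
    also have "\<dots> = (\<lambda>v. \<Sum>j<length xs - 1. if del_at k xs ! j = v then t j else 0)"
    proof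
      fix v
      let ?h = "\<lambda>j. if j < k then j else Suc j"
      have img: "?h ` {..<length xs - 1} = {..<length xs} - {k}"
      proof (intro equalityI subsetI)
        fix j assume j: "j \<in> {..<length xs} - {k}"
        show "j \<in> ?h ` {..<length xs - 1}"
        proof (cases "j < k")
          case True
          then show ?thesis using assms j by (intro image_eqI[of _ _ j]) auto
        next
          case False
          then show ?thesis using j by (intro image_eqI[of _ _ "j - 1"]) auto
        qed
      qed (use assms in auto)
      have inj: "inj_on ?h {..<length xs - 1}" by (auto simp: inj_on_def split: if_splits)
      have "(\<Sum>j<length xs. if xs ! j = v then simplical_face k t j else 0) =
          (\<Sum>j\<in>{..<length xs} - {k}. if xs ! j = v then simplical_face k t j else 0)"
        by (intro sum.mono_neutral_right) (auto simp: simplical_face_def)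
      also have "\<dots> = (\<Sum>j<length xs - 1. if xs ! ?h j = v then simplical_face k t (?h j) else 0)"
        unfolding img[symmetric] by (subst sum.reindex[OF inj]) simp
      also have "\<dots> = (\<Sum>j<length xs - 1. if del_at k xs ! j = v then t j else 0)"
        using assms by (intro sum.cong) (auto simp: nth_del_at simplical_face_def)
      finally show "(\<Sum>j<length xs. if xs ! j = v then simplical_face k t j else 0) =
        (\<Sum>j<length xs - 1. if del_at k xs ! j = v then t j else 0)" .
    qed
    also have "\<dots> = affine_simplex (del_at k xs) t" using True assms by (simp add: affine_simplex_def)
    finally show ?thesis .
  next
    case False
    then show ?thesis using assms by (simp add: singular_face_def affine_simplex_def)
  qed
qed

lemma chain_boundary_affine_simplex:
  assumes "2 \<le> length xs"
  shows "chain_boundary (length xs - 1) (frag_of (affine_simplex xs)) =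
    (\<Sum>k<length xs. frag_cmul ((-1) ^ k) (frag_of (affine_simplex (del_at k xs))))"
proof -
  have "{..length xs - 1} = {..<length xs}" using assms by (cases xs) auto
  then show ?thesis using assms by (simp add: chain_boundary_of singular_face_affine_simplex del: One_nat_def)
qed

end

section \<open>Iterated subdivision, Sperner's lemma, and acyclicity of singular chains\<close>

context oriented_complex
begin

abbreviation sd :: "nat \<Rightarrow> nat \<Rightarrow> ('v \<Rightarrow> real) chain \<Rightarrow> ('v \<Rightarrow> real) chain" where
  "sd N p \<equiv> singular_subdivision p ^^ N"

lemma sd_add: "sd N p (a + b) = sd N p a + sd N p b"
  by (induction N) (simp_all add: singular_subdivision_add)

lemma sd_cmul: "sd N p (frag_cmul m a) = frag_cmul m (sd N p a)"
  by (induction N) (simp_all add: singular_subdivision_def frag_extend_cmul)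

lemma sd_sum: "sd N p (sum f I) = (\<Sum>i\<in>I. sd N p (f i))"
  by (induction I rule: infinite_finite_induct) (simp_all add: sd_add)

lemma sd_extend: "sd N p (frag_extend f c) = frag_extend (\<lambda>x. sd N p (f x)) c"
  unfolding frag_extend_def by (simp add: sd_sum sd_cmul)

lemma singular_chain_sd: "singular_chain p T c \<Longrightarrow> singular_chain p T (sd N p c)"
  by (induction N) (simp_all add: singular_chain_singular_subdivision)

lemma chain_boundary_sd: "singular_chain p T c \<Longrightarrow> chain_boundary p (sd N p c) = sd N (p - 1) (chain_boundary p c)"
  by (induction N) (simp_all add: chain_boundary_singular_subdivision[OF singular_chain_sd])

lemma singular_chain_affine_simplex:
  "set xs \<in> X \<Longrightarrow> singular_chain (length xs - 1) (subtopology (realization X) (simplex_points (set xs))) (frag_of (affine_simplex xs))"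
  using singular_affine_simplex by (simp add: singular_chain_of)

lemma corners_simplex:
  assumes \<sigma>: "\<sigma> \<in> X" and s: "singular_simplex p (subtopology (realization X) (simplex_points \<sigma>)) s"
  shows "set (corners p s) \<subseteq> \<sigma>" "set (corners p s) \<in> X"
proof -
  have "s t \<in> simplex_points \<sigma>" if "t \<in> standard_simplex p" for t
    using s that unfolding singular_simplex_def continuous_map_def by auto
  then have "main_vertex (s (corner i)) \<in> \<sigma>" if "i \<le> p" for i
    using that by (intro main_vertex_in[OF \<sigma>]) simp
  then show sub: "set (corners p s) \<subseteq> \<sigma>" by (auto simp: corners_def)
  have "corners p s \<noteq> []" by (metis length_corners list.size(3) nat.distinct(1))
  then show "set (corners p s) \<in> X" by (intro X_subset[OF \<sigma> sub]) simp
qed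

text \<open>The face omitting the first vertex cannot cancel, since every other face contains that
  vertex. Hence a multiplicity can be read off from boundaries.\<close>

lemma face_sum_nonzero:
  assumes "set xs \<in> X" "distinct xs" "2 \<le> length xs"
  shows "face_sum ori [] xs \<noteq> 0"
proof -
  obtain x ys where xs: "xs = x # ys" "ys \<noteq> []" using assms(3) by (cases xs; cases "tl xs") auto
  have ysX: "set ys \<in> X" using assms(1) xs by (intro X_subset[OF assms(1)]) auto
  have "set ys \<notin> Poly_Mapping.keys (face_sum ori [x] ys)"
    using keys_face_sum[of "set ys" ori "[x]" ys] assms(2) xs by auto
  then have "Poly_Mapping.lookup (face_sum ori [] xs) (set ys) = Poly_Mapping.lookup (osimplex ori ys) (set ys)"
    using xs by (simp add: lookup_minus in_keys_iff)
  also have "\<dots> \<noteq> 0" using osimplex_pm_X[OF ysX] assms(2) xs by auto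
  finally show ?thesis by auto
qed

text \<open>Sperner's lemma: the approximation of a subdivided simplex is a multiple of that simplex, and
  comparing boundaries shows by induction on the dimension that the multiplicity is 1.\<close>

lemma approx_sd_affine_simplex:
  assumes "set xs \<in> X" "distinct xs"
  shows "approx (length xs - 1) (sd N (length xs - 1) (frag_of (affine_simplex xs))) = osimplex ori xs"
  using assms
proof (induction "length xs - 1" arbitrary: xs)
  case 0
  have "singular_chain 0 (realization X) (frag_of (affine_simplex xs))"
    using singular_chain_affine_simplex[OF 0(2)] 0(1) by (metis singular_chain_subtopology)
  then have "sd N 0 (frag_of (affine_simplex xs)) = frag_of (affine_simplex xs)"
    by (induction N) (simp_all add: singular_subdivision_zero)
  then show ?case using corners_affine_simplex[OF 0(2)] 0(1) by simp
next
  case (Suc p)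
  let ?\<sigma> = "set xs" and ?c = "sd N (length xs - 1) (frag_of (affine_simplex xs))"
  let ?T = "subtopology (realization X) (simplex_points ?\<sigma>)"
  have len: "length xs = Suc (Suc p)" "length xs - 1 = Suc p" using Suc(2) by auto
  have sc: "singular_chain (length xs - 1) ?T ?c"
    by (intro singular_chain_sd singular_chain_affine_simplex Suc)
  have ss: "singular_simplex (length xs - 1) ?T s" if "s \<in> Poly_Mapping.keys ?c" for s
    using sc that by (auto simp: singular_chain_def)
  \<comment> \<open>The corners of a small simplex are vertices of \<open>?\<sigma>\<close>: if they
    are distinct, counting shows that all vertices occur; if not, the simplex contributes 0.\<close>
  have "Poly_Mapping.keys (osimplex ori (corners (length xs - 1) s)) \<subseteq> {?\<sigma>}" if s: "s \<in> Poly_Mapping.keys ?c" for s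
  proof (cases "distinct (corners (length xs - 1) s)")
    case True
    have "set (corners (length xs - 1) s) = ?\<sigma>"
    proof (rule card_subset_eq)
      show "set (corners (length xs - 1) s) \<subseteq> ?\<sigma>" using corners_simplex(1)[OF Suc(3) ss[OF s]] .
      show "card (set (corners (length xs - 1) s)) = card ?\<sigma>"
        using distinct_card[OF True] distinct_card[OF Suc(4)] len by simp
    qed simp
    then show ?thesis using keys_osimplex[of ori "corners (length xs - 1) s"] by simp
  qed (simp add: osimplex_not_distinct)
  then have "Poly_Mapping.keys (approx (length xs - 1) ?c) \<subseteq> {?\<sigma>}"
    using keys_frag_extend[of "\<lambda>s. osimplex ori (corners (length xs - 1) s)" ?c] by blast
  then have off: "Poly_Mapping.lookup (approx (length xs - 1) ?c) \<rho> = 0" if "\<rho> \<noteq> ?\<sigma>" for \<rho>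
    using that by (auto simp: in_keys_iff)
  define l where "l = Poly_Mapping.lookup (approx (length xs - 1) ?c) ?\<sigma>"
  have "approx (length xs - 1) ?c = frag_cmul l (frag_of ?\<sigma>)"
    using off by (intro poly_mapping_eqI) (auto simp: lookup_single when_def l_def)
  moreover have "frag_cmul l (frag_of ?\<sigma>) = frag_cmul (- l) (- frag_of ?\<sigma>)"
    by (rule poly_mapping_eqI) simp
  ultimately have "\<exists>m. approx (length xs - 1) ?c = frag_cmul m (osimplex ori xs)"
    using osimplex_pm_X[OF Suc(3,4)] by metis
  then obtain m where m: "approx (length xs - 1) ?c = frag_cmul m (osimplex ori xs)" ..
  have IH: "approx p (sd N p (frag_of (affine_simplex (del_at k xs)))) = osimplex ori (del_at k xs)"
    if k: "k < length xs" for k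
  proof -
    have "set (del_at k xs) \<in> X"
      using del_at_neq_Nil[of xs k] k len by (intro X_subset[OF Suc(3) set_del_at]) simp
    then show ?thesis using Suc(1)[of "del_at k xs"] len k distinct_del_at[OF Suc(4)] by simp
  qed
  have "bd ori (approx (length xs - 1) ?c) = approx p (chain_boundary (length xs - 1) ?c)"
    using bd_approx[of "length xs - 1" ?c] corners_simplex(2)[OF Suc(3) ss] len by simp
  also have "chain_boundary (length xs - 1) ?c = sd N p (chain_boundary (length xs - 1) (frag_of (affine_simplex xs)))"
    using chain_boundary_sd[OF singular_chain_affine_simplex[OF Suc(3)]] len by simp
  also have "chain_boundary (length xs - 1) (frag_of (affine_simplex xs)) =
      (\<Sum>k<length xs. frag_cmul ((-1) ^ k) (frag_of (affine_simplex (del_at k xs))))"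
    by (rule chain_boundary_affine_simplex) (use len in simp)
  also have "approx p (sd N p \<dots>) = face_sum ori [] xs"
    unfolding face_sum_Nil_eq sd_sum sd_cmul frag_extend_sum[OF finite_lessThan] o_def frag_extend_cmul
    by (intro sum.cong refl) (simp add: IH)
  finally have b: "bd ori (approx (length xs - 1) ?c) = face_sum ori [] xs" .
  have "frag_cmul m (face_sum ori [] xs) = face_sum ori [] xs"
    using b unfolding m by (simp add: frag_extend_cmul bd_osimplex_X[OF Suc(3)])
  then have "frag_cmul (m - 1) (face_sum ori [] xs) = 0" by (simp add: frag_cmul_diff_distrib)
  then have "m = 1" using face_sum_nonzero[OF Suc(3,4)] len by simp
  then show ?case using m by simp
qed

text \<open>Inherited from singular chains by approximating an affine simplex without subdividing
  it: all corners lie in one simplex, so the approximation commutes with both boundaries. Length 3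
  makes both degrees positive, as \<open>bd_approx\<close> requires.\<close>

lemma bd_bd:
  assumes "set xs \<in> X" "3 \<le> length xs"
  shows "bd ori (face_sum ori [] xs) = 0"
proof -
  let ?c = "frag_of (affine_simplex xs)" and ?T = "subtopology (realization X) (simplex_points (set xs))"
  have sc: "singular_chain (length xs - 1) ?T ?c" by (rule singular_chain_affine_simplex[OF assms(1)])
  have good: "set (corners q s) \<in> X" if "singular_chain q ?T c" "s \<in> Poly_Mapping.keys c" for q c s
    using corners_simplex(2)[OF assms(1), of q s] that by (auto simp: singular_chain_def)
  have b: "singular_chain (length xs - 2) ?T (chain_boundary (length xs - 1) ?c)"
    using singular_chain_boundary[OF sc] by (simp add: numeral_2_eq_2)
  have "face_sum ori [] xs = bd ori (approx (length xs - 1) ?c)"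
    using corners_affine_simplex[OF assms(1)] bd_osimplex_X[OF assms(1)] by simp
  also have "\<dots> = approx (length xs - 2) (chain_boundary (length xs - 1) ?c)"
    using bd_approx[of "length xs - 1" ?c] good[OF sc] assms(2) by (simp add: numeral_2_eq_2)
  finally have "bd ori (face_sum ori [] xs) = approx (length xs - 2 - 1) (chain_boundary (length xs - 2) (chain_boundary (length xs - 1) ?c))"
    using bd_approx[OF _ good[OF b]] assms(2) by simp
  also have "chain_boundary (length xs - 2) (chain_boundary (length xs - 1) ?c) = 0"
    using chain_boundary_boundary[OF sc] by (simp add: numeral_2_eq_2)
  finally show ?thesis by simp
qed

text \<open>A contraction makes a cycle homologous to its image under a constant map. In positive
  degree this image is a cycle in a one-point space, hence a boundary there; in degree 0 it vanishes
  because the two simplices have the same constant image.\<close>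

lemma singular_acyclic:
  assumes cs: "contractible_space (realization X)"
    and c: "singular_chain p (realization X) c" "chain_boundary p c = 0"
    and p: "p = 0 \<Longrightarrow> c = frag_of s - frag_of t"
  obtains e where "singular_chain (Suc p) (realization X) e" "chain_boundary (Suc p) e = c"
proof -
  let ?R = "realization X"
  obtain a where a: "homotopic_with (\<lambda>x. True) ?R ?R id (\<lambda>x. a)"
    using cs unfolding contractible_space_def by blast
  then have h: "homotopic_with (\<lambda>h. h \<in> {} \<rightarrow> {}) ?R ?R id (\<lambda>x. a)" by simp
  have cyc: "singular_relcycle p ?R {} c" using c by (simp add: singular_cycle)
  have hom: "homologous_rel p ?R {} (chain_map p id c) (chain_map p (\<lambda>x. a) c)"
    by (rule homotopic_imp_homologous_rel_chain_maps[OF h cyc])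
  have id: "chain_map p id c = c" using c(1) by (rule chain_map_ident)
  have "singular_relboundary p ?R {} (chain_map p (\<lambda>x. a) c)"
  proof (cases "p = 0")
    case True
    then have "chain_map p (\<lambda>x. a) c = 0"
      using p by (simp add: chain_map_diff simplex_map_def o_def)
    then show ?thesis by simp
  next
    case False
    show ?thesis
    proof (cases "topspace ?R = {}")
      case True
      then have "c = 0" using c(1) singular_chain_empty by metis
      then show ?thesis by simp
    next
      case ne: False
      then have "a \<in> topspace ?R"
        using homotopic_with_imp_continuous_maps[OF a] by (auto simp: continuous_map_def)
      then have ta: "topspace (subtopology ?R {a}) = {a}" by auto
      have "singular_relcycle p (subtopology ?R {a}) {} (chain_map p (\<lambda>x. a) c)"
        using \<open>a \<in> topspace ?R\<close> by (intro singular_relcycle_chain_map[OF cyc]) auto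
      then have "singular_relboundary p (subtopology ?R {a}) {} (chain_map p (\<lambda>x. a) c)"
        using singular_boundary_eq_cycle_singleton[OF ta] False by simp
      then show ?thesis using singular_boundary_mono[of "{a}" UNIV p ?R] by simp
    qed
  qed
  moreover have "singular_relboundary p ?R {} (chain_map p id c - chain_map p (\<lambda>x. a) c)"
    using hom by (simp add: homologous_rel_def)
  ultimately have "singular_relboundary p ?R {} (chain_map p id c)"
    using singular_relboundary_add by fastforce
  then show ?thesis using that unfolding id singular_boundary by blast
qed

end

section \<open>Acyclicity of the simplicial chains and an integral chain contraction\<close>

lemma frag_extend_diff_fun: "frag_extend (\<lambda>x. f x - g x) c = frag_extend f c - frag_extend g c"
  using subset_UNIV by (induction c rule: frag_induction) (auto simp: frag_extend_diff)

context oriented_complex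
begin

lemma keys_osimplex_simplices:
  assumes "set xs \<in> X"
  shows "Poly_Mapping.keys (osimplex ori xs) \<subseteq> simplices X (length xs - 1)"
proof (cases "distinct xs")
  case True
  have "xs \<noteq> []" using X_nonempty[OF assms] by auto
  then have "set xs \<in> simplices X (length xs - 1)"
    using assms distinct_card[OF True] by (simp add: simplices_def)
  then show ?thesis using keys_osimplex[of ori xs] by blast
qed (simp add: osimplex_not_distinct)

lemma length_ori: "\<sigma> \<in> simplices X p \<Longrightarrow> length (ori \<sigma>) = Suc p"
  using ori_distinct ori_set distinct_card by (fastforce simp: simplices_def)

lemma keys_boundary_simplices:
  assumes "\<sigma> \<in> simplices X (Suc p)"
  shows "Poly_Mapping.keys (boundary ori \<sigma>) \<subseteq> simplices X p"
proof
  have s: "\<sigma> \<in> X" using assms by (simp add: simplices_def)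
  fix \<rho> assume "\<rho> \<in> Poly_Mapping.keys (boundary ori \<sigma>)"
  then have "\<rho> \<in> (\<Union>i<length (ori \<sigma>). Poly_Mapping.keys (frag_cmul ((-1) ^ i) (osimplex ori (del_at i (ori \<sigma>)))))"
    unfolding boundary_face_sum[of ori \<sigma>] face_sum_Nil_eq by (rule subsetD[OF keys_sum])
  then obtain i where i: "i < length (ori \<sigma>)" "\<rho> \<in> Poly_Mapping.keys (frag_cmul ((-1) ^ i) (osimplex ori (del_at i (ori \<sigma>))))"
    by blast
  then have r: "\<rho> \<in> Poly_Mapping.keys (osimplex ori (del_at i (ori \<sigma>)))" by simp
  have len: "length (ori \<sigma>) = Suc (Suc p)" using length_ori[OF assms] .
  have "del_at i (ori \<sigma>) \<noteq> []" using i len by (intro del_at_neq_Nil) auto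
  then have "set (del_at i (ori \<sigma>)) \<in> X"
    using set_del_at[of i "ori \<sigma>"] by (intro X_subset[OF s]) (auto simp: ori_set[OF s])
  from keys_osimplex_simplices[OF this] show "\<rho> \<in> simplices X p" using r i len by auto
qed

lemma bd_boundary:
  assumes "\<sigma> \<in> simplices X (Suc (Suc p))"
  shows "bd ori (boundary ori \<sigma>) = 0"
proof -
  have s: "\<sigma> \<in> X" using assms by (simp add: simplices_def)
  have "bd ori (face_sum ori [] (ori \<sigma>)) = 0"
  proof (rule bd_bd)
    show "set (ori \<sigma>) \<in> X" using ori_set[OF s] s by metis
    show "3 \<le> length (ori \<sigma>)" unfolding length_ori[OF assms] by simp
  qed
  then show ?thesis by (simp only: boundary_face_sum[of ori \<sigma>])
qed

lemma osimplex_sign: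
  assumes "set xs \<in> X" "distinct xs"
  obtains \<epsilon> where "\<epsilon> * \<epsilon> = 1" "osimplex ori xs = frag_cmul \<epsilon> (frag_of (set xs))"
    "\<epsilon> = Poly_Mapping.lookup (osimplex ori xs) (set xs)"
proof -
  have "osimplex ori xs = frag_cmul 1 (frag_of (set xs)) \<or> osimplex ori xs = frag_cmul (-1) (frag_of (set xs))"
    using osimplex_pm_X[OF assms] by simp
  then show ?thesis
  proof
    assume "osimplex ori xs = frag_cmul 1 (frag_of (set xs))"
    then show ?thesis by (intro that[of 1]) simp_all
  next
    assume "osimplex ori xs = frag_cmul (-1) (frag_of (set xs))"
    then show ?thesis by (intro that[of "-1"]) simp_all
  qed
qed

lemma osimplex_single:
  assumes "{v} \<in> X"
  shows "osimplex ori [v] = frag_of {v}"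
proof -
  have "length (ori {v}) = 1" using ori_distinct[OF assms] ori_set[OF assms] distinct_card by fastforce
  then obtain w where w: "ori {v} = [w]" by (cases "ori {v}") auto
  then have "ori {v} = [v]" using ori_set[OF assms] by simp
  then show ?thesis using osimplex_ori_X[OF assms] by simp
qed

text \<open>Singular simplices depend on the order of the vertices: the realization is a chain map once
  all simplices are ordered according to one linear order of the vertices in \<open>V\<close>.\<close>

lemma realization_chain_map:
  fixes V :: "'v set"
  assumes V: "finite V"
  obtains \<iota> where
    "\<And>\<sigma> p. \<sigma> \<in> simplices X p \<Longrightarrow> \<sigma> \<subseteq> V \<Longrightarrow> singular_chain p (realization X) (\<iota> \<sigma>)"
    "\<And>\<sigma> p. \<sigma> \<in> simplices X (Suc p) \<Longrightarrow> \<sigma> \<subseteq> V \<Longrightarrow>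
       chain_boundary (Suc p) (\<iota> \<sigma>) = frag_extend \<iota> (boundary ori \<sigma>)"
    "\<And>\<sigma> p N. \<sigma> \<in> simplices X p \<Longrightarrow> \<sigma> \<subseteq> V \<Longrightarrow> approx p (sd N p (\<iota> \<sigma>)) = frag_of \<sigma>"
    "\<And>v. {v} \<in> X \<Longrightarrow> v \<in> V \<Longrightarrow> \<iota> {v} = frag_of (affine_simplex [v])"
proof -
  obtain f :: "'v \<Rightarrow> nat" where f: "inj_on f V" using V finite_imp_inj_to_nat_seg by metis
  define srt where "srt = (\<lambda>\<sigma>. map (inv_into V f) (sorted_list_of_set (f ` \<sigma>)))"
  \<comment> \<open>The coefficient is the sign between the sorted and the chosen ordering. Being
    its own inverse, it serves for translating in either direction.\<close>
  define \<iota> where "\<iota> = (\<lambda>\<sigma>. frag_cmul (Poly_Mapping.lookup (osimplex ori (srt \<sigma>)) \<sigma>) (frag_of (affine_simplex (srt \<sigma>))))"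
  have srt_eq: "srt (set ys) = ys" if "distinct ys" "set ys \<subseteq> V" "sorted (map f ys)" for ys
  proof -
    have "distinct (map f ys)" using that f by (simp add: distinct_map inj_on_subset)
    then have "sorted_list_of_set (f ` set ys) = map f ys"
      using that(3) sorted_list_of_set.idem_if_sorted_distinct[of "map f ys"] by simp
    then show ?thesis unfolding srt_def using that(2) f by (auto intro!: map_idI simp: o_def)
  qed
  have srt: "set (srt \<sigma>) = \<sigma> \<and> distinct (srt \<sigma>) \<and> sorted (map f (srt \<sigma>))" if "\<sigma> \<subseteq> V" for \<sigma>
  proof -
    have fin: "finite (f ` \<sigma>)" using that V finite_subset by blast
    have "map f (srt \<sigma>) = sorted_list_of_set (f ` \<sigma>)"
      unfolding srt_def map_map using that fin by (intro map_idI) (auto intro!: f_inv_into_f)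
    moreover have "set (srt \<sigma>) = \<sigma>" unfolding srt_def using fin that f by (auto simp: inv_into_f_f subset_eq image_image)
    ultimately show ?thesis by (metis distinct_map distinct_sorted_list_of_set sorted_sorted_list_of_set)
  qed
  have key: "frag_extend \<iota> (osimplex ori ys) = frag_of (affine_simplex ys)"
    if ys: "distinct ys" "set ys \<subseteq> V" "sorted (map f ys)" "set ys \<in> X" for ys
  proof -
    obtain \<epsilon> where e: "\<epsilon> * \<epsilon> = 1" "osimplex ori ys = frag_cmul \<epsilon> (frag_of (set ys))"
      "\<epsilon> = Poly_Mapping.lookup (osimplex ori ys) (set ys)" by (rule osimplex_sign[OF ys(4,1)])
    have "frag_extend \<iota> (osimplex ori ys) = frag_cmul \<epsilon> (\<iota> (set ys))" unfolding e(2) by (simp add: frag_extend_cmul)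
    also have "\<iota> (set ys) = frag_cmul \<epsilon> (frag_of (affine_simplex ys))" unfolding \<iota>_def srt_eq[OF ys(1-3)] e(3) ..
    finally show ?thesis using e(1) by simp
  qed
  have \<iota>: "\<exists>ys \<epsilon>. set ys = \<sigma> \<and> distinct ys \<and> sorted (map f ys) \<and> length ys = Suc p \<and> \<epsilon> * \<epsilon> = 1 \<and>
      frag_of \<sigma> = frag_cmul \<epsilon> (osimplex ori ys) \<and> \<iota> \<sigma> = frag_cmul \<epsilon> (frag_of (affine_simplex ys))"
    if s: "\<sigma> \<in> simplices X p" "\<sigma> \<subseteq> V" for \<sigma> p
  proof -
    have sX: "\<sigma> \<in> X" "card \<sigma> = Suc p" using s by (auto simp: simplices_def)
    note r = srt[OF s(2)]
    have se: "set (srt \<sigma>) = \<sigma>" and d: "distinct (srt \<sigma>)" using r by auto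
    have rX: "set (srt \<sigma>) \<in> X" using se sX(1) by simp
    obtain \<epsilon> where e: "\<epsilon> * \<epsilon> = 1" "osimplex ori (srt \<sigma>) = frag_cmul \<epsilon> (frag_of \<sigma>)"
      "\<epsilon> = Poly_Mapping.lookup (osimplex ori (srt \<sigma>)) \<sigma>" by (rule osimplex_sign[OF rX d, unfolded se])
    have "frag_of \<sigma> = frag_cmul \<epsilon> (osimplex ori (srt \<sigma>))" unfolding e(2) using e(1) by simp
    moreover have "\<iota> \<sigma> = frag_cmul \<epsilon> (frag_of (affine_simplex (srt \<sigma>)))" unfolding \<iota>_def e(3) ..
    moreover have "length (srt \<sigma>) = Suc p" using r sX distinct_card by metis
    ultimately show ?thesis using r e(1) by (intro exI[of _ "srt \<sigma>"] exI[of _ \<epsilon>]) simp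
  qed
  show ?thesis
  proof (rule that[of \<iota>])
    fix \<sigma> p N assume s: "\<sigma> \<in> simplices X p" "\<sigma> \<subseteq> V"
    then have sX: "\<sigma> \<in> X" by (simp add: simplices_def)
    obtain ys \<epsilon> where ys: "set ys = \<sigma>" "distinct ys" "length ys = Suc p" "\<epsilon> * \<epsilon> = 1"
      "frag_of \<sigma> = frag_cmul \<epsilon> (osimplex ori ys)" "\<iota> \<sigma> = frag_cmul \<epsilon> (frag_of (affine_simplex ys))"
      using \<iota>[OF s] by blast
    show "singular_chain p (realization X) (\<iota> \<sigma>)"
      unfolding ys(6) using singular_chain_affine_simplex[of ys] ys sX
      by (intro singular_chain_cmul) (simp add: singular_chain_subtopology)
    show "approx p (sd N p (\<iota> \<sigma>)) = frag_of \<sigma>"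
      unfolding ys(6) sd_cmul frag_extend_cmul
      using approx_sd_affine_simplex[of ys N] ys sX by simp
  next
    fix \<sigma> p assume s: "\<sigma> \<in> simplices X (Suc p)" "\<sigma> \<subseteq> V"
    then have sX: "\<sigma> \<in> X" by (simp add: simplices_def)
    obtain ys \<epsilon> where ys: "set ys = \<sigma>" "distinct ys" "length ys = Suc (Suc p)" "\<epsilon> * \<epsilon> = 1" "sorted (map f ys)"
      "frag_of \<sigma> = frag_cmul \<epsilon> (osimplex ori ys)" "\<iota> \<sigma> = frag_cmul \<epsilon> (frag_of (affine_simplex ys))"
      using \<iota>[OF s] by blast
    \<comment> \<open>This is where a common vertex order matters: a face of a sorted simplex is
      again sorted, so its image carries the same parametrization as the face of the affine
      simplex.\<close>
    have face: "frag_extend \<iota> (osimplex ori (del_at k ys)) = frag_of (affine_simplex (del_at k ys))" if k: "k < length ys" for k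
    proof (rule key)
      show "distinct (del_at k ys)" using ys(2) by (rule distinct_del_at)
      show "set (del_at k ys) \<subseteq> V" using set_del_at[of k ys] ys(1) s(2) by blast
      have "map f (del_at k ys) = del_at k (map f ys)" by (simp add: del_at_def take_map drop_map)
      then show "sorted (map f (del_at k ys))" using ys(5) k
        by (auto simp: sorted_iff_nth_mono nth_del_at)
      show "set (del_at k ys) \<in> X"
        using set_del_at[of k ys] ys(1,3) del_at_neq_Nil[of ys k] k by (intro X_subset[OF sX]) auto
    qed
    have "boundary ori \<sigma> = bd ori (frag_of \<sigma>)" by simp
    also have "\<dots> = frag_cmul \<epsilon> (face_sum ori [] ys)"
      unfolding ys(6) using ys(1) sX by (simp add: frag_extend_cmul bd_osimplex_X)
    finally have "frag_extend \<iota> (boundary ori \<sigma>) = frag_cmul \<epsilon> (\<Sum>k<length ys. frag_cmul ((-1) ^ k) (frag_of (affine_simplex (del_at k ys))))"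
      by (simp add: face_sum_Nil_eq frag_extend_cmul frag_extend_sum face del: frag_cmul_cmul)
    also have "\<dots> = chain_boundary (Suc p) (\<iota> \<sigma>)"
      using chain_boundary_affine_simplex[of ys] ys(3,7) by (simp add: chain_boundary_cmul)
    finally show "chain_boundary (Suc p) (\<iota> \<sigma>) = frag_extend \<iota> (boundary ori \<sigma>)" ..
  next
    fix v assume v: "{v} \<in> X" "v \<in> V"
    then show "\<iota> {v} = frag_of (affine_simplex [v])"
      using key[of "[v]"] osimplex_single[OF v(1)] by simp
  qed
qed

lemma simplicial_acyclic:
  assumes cs: "contractible_space (realization X)"
    and c: "Poly_Mapping.keys c \<subseteq> simplices X p"
    and cyc: "p \<noteq> 0 \<Longrightarrow> bd ori c = 0"
    and p0: "p = 0 \<Longrightarrow> c = frag_of {v} - frag_of {w} \<and> {v} \<in> X \<and> {w} \<in> X"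
  obtains e where "Poly_Mapping.keys e \<subseteq> simplices X (Suc p)" "bd ori e = c"
proof -
  have "finite (\<Union>(Poly_Mapping.keys c))"
    using c X_finite by (intro finite_Union) (auto simp: simplices_def)
  \<comment> \<open>In degree 0 with \<open>v = w\<close> the chain is zero and has no vertices, so
    \<open>v\<close> and \<open>w\<close> are added by hand.\<close>
  then have V: "finite (\<Union>(Poly_Mapping.keys c) \<union> {v, w})" (is "finite ?V") by simp
  obtain \<iota> where \<iota>: "\<And>\<sigma> p. \<sigma> \<in> simplices X p \<Longrightarrow> \<sigma> \<subseteq> ?V \<Longrightarrow> singular_chain p (realization X) (\<iota> \<sigma>)"
    "\<And>\<sigma> p. \<sigma> \<in> simplices X (Suc p) \<Longrightarrow> \<sigma> \<subseteq> ?V \<Longrightarrow>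
       chain_boundary (Suc p) (\<iota> \<sigma>) = frag_extend \<iota> (boundary ori \<sigma>)"
    "\<And>\<sigma> p N. \<sigma> \<in> simplices X p \<Longrightarrow> \<sigma> \<subseteq> ?V \<Longrightarrow> approx p (sd N p (\<iota> \<sigma>)) = frag_of \<sigma>"
    "\<And>v. {v} \<in> X \<Longrightarrow> v \<in> ?V \<Longrightarrow> \<iota> {v} = frag_of (affine_simplex [v])"
    by (rule realization_chain_map[OF V]) blast
  have cV: "\<sigma> \<in> simplices X p" "\<sigma> \<subseteq> ?V" if "\<sigma> \<in> Poly_Mapping.keys c" for \<sigma>
    using that c by auto
  have sc: "singular_chain p (realization X) (frag_extend \<iota> c)"
    by (rule singular_chain_extend, rule \<iota>(1)) (use cV in blast)+
  have "chain_boundary p (frag_extend \<iota> c) = 0"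
  proof (cases p)
    case (Suc q)
    have "chain_boundary p (frag_extend \<iota> c) = frag_extend (\<lambda>\<sigma>. chain_boundary p (\<iota> \<sigma>)) c"
      using Suc by (simp add: chain_boundary_def frag_extend_frag_extend)
    also have "\<dots> = frag_extend (\<lambda>\<sigma>. frag_extend \<iota> (boundary ori \<sigma>)) c"
      using \<iota>(2) cV Suc by (intro frag_extend_eq) auto
    also have "\<dots> = frag_extend \<iota> (bd ori c)" by (simp add: frag_extend_frag_extend)
    finally show ?thesis using cyc Suc by simp
  qed (simp add: chain_boundary_def)
  moreover have "frag_extend \<iota> c = frag_of (affine_simplex [v]) - frag_of (affine_simplex [w])" if "p = 0"
    using p0[OF that] \<iota>(4)[of v] \<iota>(4)[of w] by (simp add: frag_extend_diff)
  ultimately obtain e where e: "singular_chain (Suc p) (realization X) e" "chain_boundary (Suc p) e = frag_extend \<iota> c"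
    using singular_acyclic[OF cs sc] by metis
  \<comment> \<open>The sets \<open>nbhd \<sigma>\<close> form an open cover, so after enough
    subdivisions every simplex of the filling lies in one of them; its corners then go to vertices
    of that \<open>\<sigma>\<close> and span a face.\<close>
  obtain N where N: "\<And>m s. N \<le> m \<Longrightarrow> s \<in> Poly_Mapping.keys (sd m (Suc p) e) \<Longrightarrow>
      \<exists>U\<in>nbhd ` X. s \<in> standard_simplex (Suc p) \<rightarrow> U"
    using sufficient_iterated_singular_subdivision_exists[OF _ nbhd_cover e(1)] openin_nbhd by blast
  have good: "set (corners (Suc p) s) \<in> X" if s: "s \<in> Poly_Mapping.keys (sd N (Suc p) e)" for s
  proof -
    obtain \<sigma> where \<sigma>: "\<sigma> \<in> X" "s \<in> standard_simplex (Suc p) \<rightarrow> nbhd \<sigma>" using N[OF _ s] by auto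
    have "main_vertex (s (corner i)) \<in> \<sigma>" if "i \<le> Suc p" for i
      using \<sigma>(2) that by (intro main_vertex_nbhd[OF \<sigma>(1)]) (auto simp: Pi_iff)
    then have sub: "set (corners (Suc p) s) \<subseteq> \<sigma>" by (auto simp: corners_def)
    have "corners (Suc p) s \<noteq> []" by (metis length_corners list.size(3) nat.distinct(1))
    then show ?thesis by (intro X_subset[OF \<sigma>(1) sub]) simp
  qed
  show ?thesis
  proof (rule that)
    have "Poly_Mapping.keys (osimplex ori (corners (Suc p) s)) \<subseteq> simplices X (Suc p)"
      if "s \<in> Poly_Mapping.keys (sd N (Suc p) e)" for s
      using keys_osimplex_simplices[OF good[OF that]] by simp
    then show "Poly_Mapping.keys (approx (Suc p) (sd N (Suc p) e)) \<subseteq> simplices X (Suc p)"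
      using keys_frag_extend[of "\<lambda>s. osimplex ori (corners (Suc p) s)" "sd N (Suc p) e"] by blast
    have "bd ori (approx (Suc p) (sd N (Suc p) e)) = approx p (chain_boundary (Suc p) (sd N (Suc p) e))"
      using bd_approx[OF _ good] by simp
    also have "\<dots> = approx p (sd N p (frag_extend \<iota> c))"
      using chain_boundary_sd[OF e(1)] e(2) by simp
    also have "\<dots> = frag_extend (\<lambda>\<sigma>. approx p (sd N p (\<iota> \<sigma>))) c"
      by (simp only: sd_extend frag_extend_frag_extend)
    also have "\<dots> = frag_extend frag_of c"
      using \<iota>(3) cV by (intro frag_extend_eq) auto
    finally show "bd ori (approx (Suc p) (sd N (Suc p) e)) = c" by (simp add: frag_expansion[symmetric])
  qed
qed

text \<open>The equations of a chain homotopy s between the identity and the augmentation at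
  \<open>b0\<close>: \<partial>s = id - b0 on vertices and \<partial>s + s\<partial> = id in
  positive degrees. The recursion supplies the next cycle to be filled.\<close>

primrec contraction :: "'v \<Rightarrow> nat \<Rightarrow> 'v set \<Rightarrow> 'v set \<Rightarrow>\<^sub>0 int" where
  "contraction b0 0 \<sigma> =
     (SOME e. Poly_Mapping.keys e \<subseteq> simplices X 1 \<and> bd ori e = frag_of \<sigma> - frag_of {b0})"
| "contraction b0 (Suc p) \<sigma> =
     (SOME e. Poly_Mapping.keys e \<subseteq> simplices X (Suc (Suc p)) \<and>
        bd ori e = frag_of \<sigma> - frag_extend (contraction b0 p) (boundary ori \<sigma>))"

lemma contraction:
  assumes cs: "contractible_space (realization X)" and b0: "{b0} \<in> X" and \<sigma>: "\<sigma> \<in> simplices X p"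
  shows "Poly_Mapping.keys (contraction b0 p \<sigma>) \<subseteq> simplices X (Suc p) \<and>
    bd ori (contraction b0 p \<sigma>) = frag_of \<sigma> -
      (case p of 0 \<Rightarrow> frag_of {b0} | Suc q \<Rightarrow> frag_extend (contraction b0 q) (boundary ori \<sigma>))"
  using \<sigma>
proof (induction p arbitrary: \<sigma>)
  case 0
  then obtain v where v: "\<sigma> = {v}" "{v} \<in> X" by (auto simp: simplices_def card_Suc_eq)
  have "Poly_Mapping.keys (frag_of {v} - frag_of {b0}) \<subseteq> simplices X 0"
    using v b0 by (intro order_trans[OF keys_diff]) (auto simp: simplices_def)
  then obtain e where "Poly_Mapping.keys e \<subseteq> simplices X (Suc 0)" "bd ori e = frag_of {v} - frag_of {b0}"
    using simplicial_acyclic[OF cs, of "frag_of {v} - frag_of {b0}" 0 v b0] v b0 by auto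
  then have "Poly_Mapping.keys e \<subseteq> simplices X 1 \<and> bd ori e = frag_of \<sigma> - frag_of {b0}"
    using v by simp
  from someI[of "\<lambda>e. Poly_Mapping.keys e \<subseteq> simplices X 1 \<and> bd ori e = frag_of \<sigma> - frag_of {b0}", OF this]
  show ?case by simp
next
  case (Suc p)
  let ?c = "frag_of \<sigma> - frag_extend (contraction b0 p) (boundary ori \<sigma>)"
  have kb: "\<rho> \<in> simplices X p" if "\<rho> \<in> Poly_Mapping.keys (boundary ori \<sigma>)" for \<rho>
    using keys_boundary_simplices[OF Suc.prems] that by blast
  have "Poly_Mapping.keys (frag_extend (contraction b0 p) (boundary ori \<sigma>)) \<subseteq> simplices X (Suc p)"
    using keys_frag_extend[of "contraction b0 p" "boundary ori \<sigma>"] Suc.IH kb by blast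
  then have k: "Poly_Mapping.keys ?c \<subseteq> simplices X (Suc p)"
    using Suc.prems by (intro order_trans[OF keys_diff]) auto
  have "bd ori (frag_extend (contraction b0 p) (boundary ori \<sigma>)) =
      frag_extend (\<lambda>\<rho>. frag_of \<rho> - (case p of 0 \<Rightarrow> frag_of {b0} | Suc q \<Rightarrow> frag_extend (contraction b0 q) (boundary ori \<rho>))) (boundary ori \<sigma>)"
    unfolding frag_extend_frag_extend using Suc.IH kb by (intro frag_extend_eq) blast
  also have "\<dots> = boundary ori \<sigma> -
      frag_extend (\<lambda>\<rho>. case p of 0 \<Rightarrow> frag_of {b0} | Suc q \<Rightarrow> frag_extend (contraction b0 q) (boundary ori \<rho>)) (boundary ori \<sigma>)"
    by (simp add: frag_extend_diff_fun frag_expansion[symmetric])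
  \<comment> \<open>For an edge the end points have opposite signs, so the two copies of
    \<open>{b0}\<close> cancel; in higher degrees the term contains the boundary of a
    boundary.\<close>
  also have "frag_extend (\<lambda>\<rho>. case p of 0 \<Rightarrow> frag_of {b0} | Suc q \<Rightarrow> frag_extend (contraction b0 q) (boundary ori \<rho>)) (boundary ori \<sigma>) = 0"
  proof (cases p)
    case 0
    have s: "\<sigma> \<in> X" using Suc.prems by (simp add: simplices_def)
    have "length (ori \<sigma>) = 2" using length_ori[OF Suc.prems] 0 by simp
    then obtain a b where ab: "ori \<sigma> = [a, b]" by (auto simp: length_Suc_conv numeral_2_eq_2)
    then have "{a} \<in> X" "{b} \<in> X" using ori_set[OF s] X_subset[OF s] by auto
    then have "boundary ori \<sigma> = frag_of {b} - frag_of {a}"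
      by (simp add: boundary_face_sum ab osimplex_single)
    then show ?thesis using 0 by (simp add: frag_extend_diff)
  next
    case q: (Suc q)
    then have "frag_extend (\<lambda>\<rho>. frag_extend (contraction b0 q) (boundary ori \<rho>)) (boundary ori \<sigma>) =
        frag_extend (contraction b0 q) (bd ori (boundary ori \<sigma>))"
      by (simp add: frag_extend_frag_extend)
    then show ?thesis using bd_boundary[of \<sigma> q] Suc.prems q by simp
  qed
  finally have "bd ori ?c = 0" by (simp add: frag_extend_diff)
  then obtain e where "Poly_Mapping.keys e \<subseteq> simplices X (Suc (Suc p))" "bd ori e = ?c"
    using simplicial_acyclic[OF cs k] by auto
  then have "Poly_Mapping.keys e \<subseteq> simplices X (Suc (Suc p)) \<and> bd ori e = ?c" by blast
  from someI[of "\<lambda>e. Poly_Mapping.keys e \<subseteq> simplices X (Suc (Suc p)) \<and> bd ori e = ?c", OF this]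
  show ?case by simp
qed

end

section \<open>Coordinates over the group algebra\<close>

text \<open>The real-linear extension of \<open>F\<close> from group elements to the group algebra;
  it commutes with the left multiplication by \<Gamma> only if \<open>F\<close> does. Scalars are
  written as ring elements so that products can be rearranged in the ring.\<close>

definition lin_ext :: "('g \<Rightarrow> 'g \<Rightarrow>\<^sub>0 real) \<Rightarrow> ('g::monoid_add \<Rightarrow>\<^sub>0 real) \<Rightarrow> 'g \<Rightarrow>\<^sub>0 real" where
  "lin_ext F a = (\<Sum>\<gamma>\<in>Poly_Mapping.keys a. Poly_Mapping.single 0 (Poly_Mapping.lookup a \<gamma>) * F \<gamma>)"

lemma lin_ext_superset:
  assumes "finite S" "Poly_Mapping.keys a \<subseteq> S"
  shows "lin_ext F a = (\<Sum>\<gamma>\<in>S. Poly_Mapping.single 0 (Poly_Mapping.lookup a \<gamma>) * F \<gamma>)"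
  unfolding lin_ext_def using assms by (intro sum.mono_neutral_left) (auto simp: in_keys_iff)

lemma lin_ext_zero [simp]: "lin_ext F 0 = 0" by (simp add: lin_ext_def)

lemma lin_ext_single [simp]: "lin_ext F (Poly_Mapping.single \<gamma> c) = Poly_Mapping.single 0 c * F \<gamma>"
  by (subst lin_ext_superset[of "{\<gamma>}"]) auto

lemma lin_ext_add: "lin_ext F (a + b) = lin_ext F a + lin_ext F b"
proof -
  let ?S = "Poly_Mapping.keys a \<union> Poly_Mapping.keys b"
  have "lin_ext F c = (\<Sum>\<gamma>\<in>?S. Poly_Mapping.single 0 (Poly_Mapping.lookup c \<gamma>) * F \<gamma>)" if "c \<in> {a, b, a + b}" for c
    using that keys_add[of a b] by (intro lin_ext_superset) auto
  then show ?thesis by (simp add: lookup_add single_add distrib_right sum.distrib)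
qed

lemma lin_ext_sum: "lin_ext F (sum f S) = (\<Sum>s\<in>S. lin_ext F (f s))"
  by (induction S rule: infinite_finite_induct) (simp_all add: lin_ext_add)

lemma lin_ext_minus: "lin_ext F (- a) = - lin_ext F a"
  using lin_ext_add[of F a "- a"] by (simp add: eq_neg_iff_add_eq_0 add.commute)

lemma lin_ext_diff: "lin_ext F (a - b) = lin_ext F a - lin_ext F b"
  using lin_ext_add[of F a "- b"] by (simp add: lin_ext_minus)

lemma lin_ext_scale: "lin_ext F (Poly_Mapping.single 0 c * a) = Poly_Mapping.single 0 c * lin_ext F a"
  by (induction a rule: poly_mapping_single_induct)
    (simp_all add: mult_single distrib_left lin_ext_add mult.assoc[symmetric])

lemma lin_ext_id: "lin_ext (\<lambda>\<gamma>. Poly_Mapping.single \<gamma> 1) a = a"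
  by (induction a rule: poly_mapping_single_induct) (simp_all add: mult_single lin_ext_add)

lemma lin_ext_mult_right: "lin_ext (\<lambda>\<gamma>. F \<gamma> * b) a = lin_ext F a * b"
  by (simp add: lin_ext_def sum_distrib_right mult.assoc)

lemma lin_ext_mult_left: "lin_ext F a = a * b" if "\<And>\<gamma>. F \<gamma> = Poly_Mapping.single \<gamma> 1 * b"
proof -
  have "lin_ext F a = lin_ext (\<lambda>\<gamma>. Poly_Mapping.single \<gamma> 1) a * b"
    unfolding lin_ext_mult_right[symmetric] using that by presburger
  then show ?thesis by (simp add: lin_ext_id)
qed

lemma lin_ext_diff_fun: "lin_ext (\<lambda>\<gamma>. F \<gamma> - G \<gamma>) a = lin_ext F a - lin_ext G a"
  by (simp add: lin_ext_def right_diff_distrib sum_subtractf)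

lemma lin_ext_zero_fun: "lin_ext (\<lambda>\<gamma>. 0) a = 0"
  by (simp add: lin_ext_def)

lemma lookup_single_mult:
  fixes x :: "'g::group_add \<Rightarrow>\<^sub>0 'b::semiring_0"
  shows "Poly_Mapping.lookup (Poly_Mapping.single \<delta> c * x) \<gamma> = c * Poly_Mapping.lookup x (- \<delta> + \<gamma>)"
proof (induction x rule: poly_mapping_single_induct)
  case (single \<epsilon> b)
  have "\<delta> + \<epsilon> = \<gamma> \<longleftrightarrow> \<epsilon> = - \<delta> + \<gamma>" by (metis add.assoc add.left_neutral left_minus add_left_cancel)
  then show ?case by (simp add: mult_single lookup_single when_def)
qed (simp add: distrib_left lookup_add)

section \<open>Equivariance of the boundary and coordinates with respect to orbit
  representatives\<close>

locale equivariant_complex =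
  fixes X :: "'v set set" and act :: "'g::group_add \<Rightarrow> 'v \<Rightarrow> 'v"
    and ori :: "'v set \<Rightarrow> 'v list" and \<tau> :: "nat \<Rightarrow> nat \<Rightarrow> 'v set" and m :: nat
  assumes type_F: "type_F_complex m X act"
    and orientation: "invariant_orientation X act ori"
    and reps: "orbit_representatives m X act \<tau>"

sublocale equivariant_complex \<subseteq> oriented_complex X ori
  using type_F orientation by unfold_locales (auto simp: type_F_complex_def invariant_orientation_def)

context equivariant_complex
begin

abbreviation "k \<equiv> num_orbits X act"
abbreviation "d \<equiv> codifferential X act ori \<tau>"

lemma act_act: "\<sigma> \<in> X \<Longrightarrow> act \<gamma> ` act \<delta> ` \<sigma> = act (\<gamma> + \<delta>) ` \<sigma>"
  unfolding image_image using type_F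
  by (intro image_cong) (auto simp: type_F_complex_def simplicial_action_def)

lemma act_0: "\<sigma> \<in> X \<Longrightarrow> act 0 ` \<sigma> = \<sigma>"
  using type_F by (force simp: type_F_complex_def simplicial_action_def)

lemma act_X: "\<sigma> \<in> X \<Longrightarrow> act \<gamma> ` \<sigma> \<in> X"
  using type_F by (simp add: type_F_complex_def simplicial_action_def)

lemma free: "\<sigma> \<in> X \<Longrightarrow> act \<gamma> ` \<sigma> = \<sigma> \<Longrightarrow> \<gamma> = 0"
  using type_F by (auto simp: type_F_complex_def free_action_def)

lemma act_inj: "inj_on (act \<gamma>) (\<Union>X)"
proof (rule inj_on_inverseI)
  fix v assume "v \<in> \<Union>X"
  then have "act (- \<gamma> + \<gamma>) v = act (- \<gamma>) (act \<gamma> v)" "act 0 v = v"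
    using type_F unfolding type_F_complex_def simplicial_action_def by blast+
  then show "act (- \<gamma>) (act \<gamma> v) = v" by simp
qed

lemma act_eq_iff: "\<sigma> \<in> X \<Longrightarrow> \<rho> \<in> X \<Longrightarrow> act \<gamma> ` \<sigma> = act \<gamma> ` \<rho> \<longleftrightarrow> \<sigma> = \<rho>"
  using act_inj[of \<gamma>] by (intro inj_on_image_eq_iff) auto

lemma act_simplices: "\<sigma> \<in> simplices X p \<Longrightarrow> act \<gamma> ` \<sigma> \<in> simplices X p"
  using act_X[of \<sigma> \<gamma>] card_image[OF inj_on_subset[OF act_inj[of \<gamma>], of \<sigma>]] by (auto simp: simplices_def)

lemma \<tau>_simplices: "p \<le> m \<Longrightarrow> i < k p \<Longrightarrow> \<tau> p i \<in> simplices X p"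
  using reps by (simp add: orbit_representatives_def)

lemma \<tau>_X: "p \<le> m \<Longrightarrow> i < k p \<Longrightarrow> \<tau> p i \<in> X"
  using \<tau>_simplices by (simp add: simplices_def)

lemma simplex_representative:
  assumes p: "p \<le> m" and s: "\<sigma> \<in> simplices X p"
  obtains i \<gamma> where "i < k p" "\<sigma> = act \<gamma> ` \<tau> p i"
proof -
  have "simplex_orbit act \<sigma> \<in> (\<lambda>i. simplex_orbit act (\<tau> p i)) ` {..<k p}"
    using reps p s by (auto simp: orbit_representatives_def orbits_def bij_betw_def)
  then obtain i where i: "i < k p" "simplex_orbit act \<sigma> = simplex_orbit act (\<tau> p i)" by blast
  have "act 0 ` \<sigma> \<in> simplex_orbit act \<sigma>" unfolding simplex_orbit_def by (rule rangeI)
  then have "\<sigma> \<in> simplex_orbit act (\<tau> p i)" using s i(2) act_0 by (simp add: simplices_def)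
  then show ?thesis using that i(1) unfolding simplex_orbit_def by blast
qed

text \<open>The orbit determines the index, and freeness determines the group element: the
  translates of the representatives are a basis of the chains without repetitions.\<close>

lemma representative_unique:
  assumes p: "p \<le> m" and ij: "i < k p" "j < k p" and eq: "act \<gamma> ` \<tau> p i = act \<delta> ` \<tau> p j"
  shows "i = j \<and> \<gamma> = \<delta>"
proof -
  note t = \<tau>_X[OF p ij(1)] \<tau>_X[OF p ij(2)]
  have e: "act (\<epsilon> + \<gamma>) ` \<tau> p i = act (\<epsilon> + \<delta>) ` \<tau> p j" for \<epsilon>
    using eq act_act[OF t(1)] act_act[OF t(2)] by metis
  have "simplex_orbit act (\<tau> p i) = simplex_orbit act (\<tau> p j)"
    unfolding simplex_orbit_def
  proof (intro equalityI subsetI; elim imageE; clarify)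
    fix \<epsilon>
    show "act \<epsilon> ` \<tau> p i \<in> range (\<lambda>\<gamma>. act \<gamma> ` \<tau> p j)"
      using e[of "\<epsilon> - \<gamma>"] by auto
    show "act \<epsilon> ` \<tau> p j \<in> range (\<lambda>\<gamma>. act \<gamma> ` \<tau> p i)"
      using e[of "\<epsilon> - \<delta>"] by (auto simp: image_iff) metis
  qed
  then have j: "i = j" using reps p ij by (auto simp: orbit_representatives_def bij_betw_def inj_on_def)
  have "act (- \<delta> + \<gamma>) ` \<tau> p i = \<tau> p i" using e[of "- \<delta>"] j act_0 t by simp
  then have "- \<delta> + \<gamma> = 0" using free[OF t(1)] by simp
  then show ?thesis using j by (metis add.inverse_inverse eq_neg_iff_add_eq_0 neg_eq_iff_add_eq_0)
qed

lemma inj_act_\<tau>: "p \<le> m \<Longrightarrow> i < k p \<Longrightarrow> inj (\<lambda>\<gamma>. act \<gamma> ` \<tau> p i)"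
  by (rule injI) (use representative_unique[of p i i] in simp)

lemma osimplex_act:
  assumes s: "\<sigma> \<in> X" and xs: "set xs \<subseteq> \<sigma>" "xs \<noteq> []"
  shows "osimplex ori (map (act \<gamma>) xs) = frag_extend (frag_of \<circ> image (act \<gamma>)) (osimplex ori xs)"
proof -
  define \<rho> where "\<rho> = set xs"
  have r: "\<rho> \<in> X" using X_subset[OF s] xs by (simp add: \<rho>_def)
  \<comment> \<open>The integers \<open>rel_sign\<close> are wrapped as chains on a one-point set so
    that \<open>alternating_eqI\<close> applies; on the chosen ordering the two agree because the
    orientation is invariant.\<close>
  let ?F = "\<lambda>xs. Poly_Mapping.single () (rel_sign (map (act \<gamma>) xs) (ori (act \<gamma> ` \<rho>)))"
  let ?G = "\<lambda>xs. Poly_Mapping.single () (rel_sign xs (ori \<rho>))"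
  have "?F xs = ?G xs"
  proof (rule alternating_eqI[of ?F ?G "ori \<rho>" xs])
    show "alternating ?F"
      unfolding alternating_def
    proof (intro allI)
      fix us x y vs
      show "?F (us @ x # y # vs) = - ?F (us @ y # x # vs)"
        using rel_sign_swap[of "map (act \<gamma>) us" "act \<gamma> x" "act \<gamma> y" "map (act \<gamma>) vs" "ori (act \<gamma> ` \<rho>)"]
        by (simp add: single_uminus)
    qed
    show "alternating ?G"
      unfolding alternating_def
    proof (intro allI)
      fix us x y vs
      show "?G (us @ x # y # vs) = - ?G (us @ y # x # vs)"
        using rel_sign_swap[of us x y vs "ori \<rho>"] by (simp add: single_uminus)
    qed
    show "distinct (ori \<rho>)" "set xs = set (ori \<rho>)" using r by (simp_all add: ori_distinct ori_set \<rho>_def)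
    show "?F (ori \<rho>) = ?G (ori \<rho>)"
      using orientation r rel_sign_self[OF ori_distinct[OF r]] by (simp add: invariant_orientation_def)
  qed
  then have "rel_sign (map (act \<gamma>) xs) (ori (act \<gamma> ` \<rho>)) = rel_sign xs (ori \<rho>)"
    by (metis lookup_single_eq)
  then have "osimplex ori (map (act \<gamma>) xs) = frag_cmul (rel_sign xs (ori \<rho>)) (frag_of (act \<gamma> ` \<rho>))"
    unfolding ordered_simplex_def \<rho>_def by (intro poly_mapping_eqI) (simp add: lookup_single when_def)
  also have "\<dots> = frag_extend (frag_of \<circ> image (act \<gamma>)) (frag_cmul (rel_sign xs (ori \<rho>)) (frag_of \<rho>))"
    by (simp add: frag_extend_cmul)
  also have "frag_cmul (rel_sign xs (ori \<rho>)) (frag_of \<rho>) = osimplex ori xs"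
    unfolding ordered_simplex_def \<rho>_def by (intro poly_mapping_eqI) (simp add: lookup_single when_def)
  finally show ?thesis .
qed

lemma boundary_act:
  assumes s: "\<sigma> \<in> simplices X (Suc p)"
  shows "boundary ori (act \<gamma> ` \<sigma>) = frag_extend (frag_of \<circ> image (act \<gamma>)) (boundary ori \<sigma>)"
proof -
  have sX: "\<sigma> \<in> X" using s by (simp add: simplices_def)
  have set: "set (map (act \<gamma>) (ori \<sigma>)) = act \<gamma> ` \<sigma>" by (simp add: ori_set[OF sX])
  have ne: "ori \<sigma> \<noteq> []" using length_ori[OF s] by auto
  have "osimplex ori (map (act \<gamma>) (ori \<sigma>)) = frag_of (act \<gamma> ` \<sigma>)"
    using osimplex_act[OF sX _ ne, of \<gamma>] by (simp add: ori_set[OF sX] osimplex_ori_X[OF sX])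
  then have "boundary ori (act \<gamma> ` \<sigma>) = bd ori (osimplex ori (map (act \<gamma>) (ori \<sigma>)))" by simp
  also have "\<dots> = face_sum ori [] (map (act \<gamma>) (ori \<sigma>))"
    by (rule bd_osimplex_X) (simp only: set act_X[OF sX])
  also have "\<dots> = (\<Sum>i<length (ori \<sigma>). frag_cmul ((-1) ^ i) (osimplex ori (map (act \<gamma>) (del_at i (ori \<sigma>)))))"
    by (simp add: face_sum_Nil_eq del_at_def take_map drop_map)
  also have "\<dots> = (\<Sum>i<length (ori \<sigma>). frag_cmul ((-1) ^ i) (frag_extend (frag_of \<circ> image (act \<gamma>)) (osimplex ori (del_at i (ori \<sigma>)))))"
  proof (intro sum.cong refl arg_cong[of _ _ "frag_cmul _"] osimplex_act[OF sX])
    fix i assume "i \<in> {..<length (ori \<sigma>)}"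
    then show "del_at i (ori \<sigma>) \<noteq> []" using length_ori[OF s] by (intro del_at_neq_Nil) auto
    show "set (del_at i (ori \<sigma>)) \<subseteq> \<sigma>" using set_del_at[of i "ori \<sigma>"] by (simp add: ori_set[OF sX])
  qed
  also have "\<dots> = frag_extend (frag_of \<circ> image (act \<gamma>)) (boundary ori \<sigma>)"
    unfolding boundary_face_sum[of ori \<sigma>] face_sum_Nil_eq
    by (subst frag_extend_sum) (simp_all add: frag_extend_cmul o_def)
  finally show ?thesis .
qed

lemma lookup_boundary_act:
  assumes s: "\<sigma> \<in> simplices X (Suc p)" and r: "\<rho> \<in> X"
  shows "Poly_Mapping.lookup (boundary ori (act \<gamma> ` \<sigma>)) (act \<gamma> ` \<rho>) = Poly_Mapping.lookup (boundary ori \<sigma>) \<rho>"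
proof -
  let ?B = "boundary ori \<sigma>"
  have "Poly_Mapping.lookup (boundary ori (act \<gamma> ` \<sigma>)) (act \<gamma> ` \<rho>) =
      (\<Sum>\<rho>'\<in>Poly_Mapping.keys ?B. Poly_Mapping.lookup ?B \<rho>' * (if act \<gamma> ` \<rho>' = act \<gamma> ` \<rho> then 1 else 0))"
    unfolding boundary_act[OF s] frag_extend_def
    by (auto simp: lookup_sum lookup_single when_def intro!: sum.cong)
  also have "\<dots> = (\<Sum>\<rho>'\<in>Poly_Mapping.keys ?B. if \<rho>' = \<rho> then Poly_Mapping.lookup ?B \<rho> else 0)"
  proof (intro sum.cong refl)
    fix \<rho>' assume "\<rho>' \<in> Poly_Mapping.keys ?B"
    then have "\<rho>' \<in> X" using keys_boundary_simplices[OF s] by (auto simp: simplices_def)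
    then show "Poly_Mapping.lookup ?B \<rho>' * (if act \<gamma> ` \<rho>' = act \<gamma> ` \<rho> then 1 else 0) =
        (if \<rho>' = \<rho> then Poly_Mapping.lookup ?B \<rho> else 0)"
      using act_eq_iff[OF _ r] by simp
  qed
  also have "\<dots> = Poly_Mapping.lookup ?B \<rho>" by (simp add: in_keys_iff)
  finally show ?thesis .
qed

text \<open>The coordinates of an integral chain with respect to the basis \<open>\<tau>\<close> of the free
  $\mathbb{R}\Gamma$-module of chains.  \<^const>\<open>Poly_Mapping.map_key\<close> is meaningful for injective
  functions only, that is, for \<open>i < k p\<close>.\<close>

definition coord :: "nat \<Rightarrow> ('v set \<Rightarrow>\<^sub>0 int) \<Rightarrow> nat \<Rightarrow> 'g \<Rightarrow>\<^sub>0 real" where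
  "coord p c i = Poly_Mapping.map of_int (Poly_Mapping.map_key (\<lambda>\<gamma>. act \<gamma> ` \<tau> p i) c)"

lemma lookup_coord:
  "p \<le> m \<Longrightarrow> i < k p \<Longrightarrow> Poly_Mapping.lookup (coord p c i) \<gamma> = of_int (Poly_Mapping.lookup c (act \<gamma> ` \<tau> p i))"
  unfolding coord_def by (simp add: map.rep_eq map_key.rep_eq inj_act_\<tau> when_def)

lemma coord_diff: "p \<le> m \<Longrightarrow> i < k p \<Longrightarrow> coord p (a - b) i = coord p a i - coord p b i"
  by (rule poly_mapping_eqI) (simp add: lookup_coord lookup_minus)

lemma coord_zero: "p \<le> m \<Longrightarrow> i < k p \<Longrightarrow> coord p 0 i = 0"
  by (rule poly_mapping_eqI) (simp add: lookup_coord)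

lemma coord_frag_of:
  assumes "p \<le> m" "i < k p" "j < k p"
  shows "coord p (frag_of (act \<gamma> ` \<tau> p j)) i = (if i = j then Poly_Mapping.single \<gamma> 1 else 0)"
proof (rule poly_mapping_eqI)
  fix \<delta>
  have iff: "act \<gamma> ` \<tau> p j = act \<delta> ` \<tau> p i \<longleftrightarrow> i = j \<and> \<gamma> = \<delta>"
  proof
    assume "act \<gamma> ` \<tau> p j = act \<delta> ` \<tau> p i"
    from representative_unique[OF assms(1,3,2) this] show "i = j \<and> \<gamma> = \<delta>" by simp
  qed simp
  have "Poly_Mapping.lookup (frag_of (act \<gamma> ` \<tau> p j)) (act \<delta> ` \<tau> p i) = (if i = j \<and> \<gamma> = \<delta> then 1 else 0)"
    by (simp only: lookup_single when_def iff)
  then show "Poly_Mapping.lookup (coord p (frag_of (act \<gamma> ` \<tau> p j)) i) \<delta> =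
      Poly_Mapping.lookup (if i = j then Poly_Mapping.single \<gamma> 1 else 0) \<delta>"
    unfolding lookup_coord[OF assms(1,2)] by (auto simp: lookup_single when_def)
qed

lemma d_carrier: "d p \<in> carrier_mat (k (Suc p)) (k p)"
  by (simp add: codifferential_def)

lemma d_index:
  assumes "Suc p \<le> m" "i < k (Suc p)" "j < k p"
  shows "d p $$ (i, j) = coord p (boundary ori (\<tau> (Suc p) i)) j"
proof (rule poly_mapping_eqI)
  fix \<gamma>
  let ?c = "boundary_coeff act ori \<tau> p i j"
  have c: "?c \<delta> = Poly_Mapping.lookup (boundary ori (\<tau> (Suc p) i)) (act \<delta> ` \<tau> p j)" for \<delta>
    by (simp add: boundary_coeff_def)
  have "finite {\<delta>. act \<delta> ` \<tau> p j \<in> Poly_Mapping.keys (boundary ori (\<tau> (Suc p) i))}"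
    using inj_act_\<tau>[of p j] assms by (intro finite_vimageI[unfolded vimage_def]) auto
  then have fin: "finite {\<delta>. ?c \<delta> \<noteq> 0}" by (simp add: c in_keys_iff)
  have "Poly_Mapping.lookup (d p $$ (i, j)) \<gamma> = (\<Sum>\<delta> | ?c \<delta> \<noteq> 0. if \<delta> = \<gamma> then of_int (?c \<gamma>) else 0)"
    using assms by (auto simp: codifferential_def lookup_sum lookup_single when_def intro!: sum.cong)
  also have "\<dots> = of_int (?c \<gamma>)" using fin by (simp add: sum.delta)
  also have "\<dots> = Poly_Mapping.lookup (coord p (boundary ori (\<tau> (Suc p) i)) j) \<gamma>"
    using assms by (simp add: lookup_coord c)
  finally show "Poly_Mapping.lookup (d p $$ (i, j)) \<gamma> = Poly_Mapping.lookup (coord p (boundary ori (\<tau> (Suc p) i)) j) \<gamma>" .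
qed

lemma coord_boundary_act:
  assumes "Suc p \<le> m" "i < k (Suc p)" "j < k p"
  shows "coord p (boundary ori (act \<delta> ` \<tau> (Suc p) i)) j = Poly_Mapping.single \<delta> 1 * d p $$ (i, j)"
proof (rule poly_mapping_eqI)
  fix \<gamma>
  have t: "\<tau> p j \<in> X" using assms by (intro \<tau>_X) auto
  have "act \<gamma> ` \<tau> p j = act \<delta> ` act (- \<delta> + \<gamma>) ` \<tau> p j" by (simp add: act_act[OF t] add.assoc[symmetric])
  then have "Poly_Mapping.lookup (boundary ori (act \<delta> ` \<tau> (Suc p) i)) (act \<gamma> ` \<tau> p j) =
      Poly_Mapping.lookup (boundary ori (\<tau> (Suc p) i)) (act (- \<delta> + \<gamma>) ` \<tau> p j)"
    using lookup_boundary_act[OF \<tau>_simplices[OF assms(1,2)] act_X[OF t]] by simp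
  then show "Poly_Mapping.lookup (coord p (boundary ori (act \<delta> ` \<tau> (Suc p) i)) j) \<gamma> =
      Poly_Mapping.lookup (Poly_Mapping.single \<delta> 1 * d p $$ (i, j)) \<gamma>"
    using assms by (simp add: lookup_coord lookup_single_mult d_index)
qed

text \<open>The group acts on coordinates by left multiplication, so the equivariant boundary
  becomes right multiplication of rows by a matrix. It is enough to treat a single translate of a
  representative.\<close>

lemma coord_bd:
  assumes "Suc p \<le> m" "j < k p" "Poly_Mapping.keys c \<subseteq> simplices X (Suc p)"
  shows "coord p (bd ori c) j = (\<Sum>i<k (Suc p). coord (Suc p) c i * d p $$ (i, j))"
  using assms(3)
proof (induction c rule: frag_induction)
  case zero
  show ?case using assms by (simp add: coord_zero)
next
  case (one \<sigma>)
  obtain i0 \<delta> where s: "i0 < k (Suc p)" "\<sigma> = act \<delta> ` \<tau> (Suc p) i0"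
    using simplex_representative[OF assms(1) one] by blast
  have "(\<Sum>i<k (Suc p). coord (Suc p) (frag_of \<sigma>) i * d p $$ (i, j)) =
      (\<Sum>i<k (Suc p). if i = i0 then Poly_Mapping.single \<delta> 1 * d p $$ (i0, j) else 0)"
    using assms s by (intro sum.cong refl) (simp add: coord_frag_of)
  also have "\<dots> = Poly_Mapping.single \<delta> 1 * d p $$ (i0, j)" using s(1) by simp
  finally show ?case using coord_boundary_act[OF assms(1) s(1) assms(2)] s(2) by simp
next
  case (diff a b)
  then show ?case using assms by (simp add: frag_extend_diff coord_diff left_diff_distrib sum_subtractf)
qed

lemma d_d:
  assumes "Suc (Suc p) \<le> m"
  shows "d (Suc p) * d p = 0\<^sub>m (k (Suc (Suc p))) (k p)"
proof (rule eq_matI)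
  fix i j assume "i < dim_row (0\<^sub>m (k (Suc (Suc p))) (k p))" "j < dim_col (0\<^sub>m (k (Suc (Suc p))) (k p))"
  then have ij: "i < k (Suc (Suc p))" "j < k p" by auto
  have t: "\<tau> (Suc (Suc p)) i \<in> simplices X (Suc (Suc p))" using \<tau>_simplices assms ij by simp
  have "(d (Suc p) * d p) $$ (i, j) = (\<Sum>l<k (Suc p). d (Suc p) $$ (i, l) * d p $$ (l, j))"
    by (rule index_mat_mult_sum[OF d_carrier d_carrier ij])
  also have "\<dots> = (\<Sum>l<k (Suc p). coord (Suc p) (boundary ori (\<tau> (Suc (Suc p)) i)) l * d p $$ (l, j))"
    using assms ij by (intro sum.cong refl) (simp add: d_index)
  also have "\<dots> = coord p (bd ori (boundary ori (\<tau> (Suc (Suc p)) i))) j"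
    using assms ij keys_boundary_simplices[OF t] by (intro coord_bd[symmetric]) auto
  also have "\<dots> = 0" using bd_boundary[OF t] assms ij by (simp add: coord_zero)
  finally show "(d (Suc p) * d p) $$ (i, j) = 0\<^sub>m (k (Suc (Suc p))) (k p) $$ (i, j)" using ij by simp
qed (use d_carrier[of p] d_carrier[of "Suc p"] in auto)

text \<open>The real-linear extension of the integral contraction; being built from one value for each
  simplex, it is not equivariant.\<close>

definition contract :: "'v \<Rightarrow> nat \<Rightarrow> (nat \<Rightarrow> 'g \<Rightarrow>\<^sub>0 real) \<Rightarrow> nat \<Rightarrow> 'g \<Rightarrow>\<^sub>0 real" where
  "contract b0 p v l = (\<Sum>i<k p. lin_ext (\<lambda>\<gamma>. coord (Suc p) (contraction b0 p (act \<gamma> ` \<tau> p i)) l) (v i))"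

lemma contract_diff: "contract b0 p (\<lambda>i. v i - w i) l = contract b0 p v l - contract b0 p w l"
  unfolding contract_def by (simp add: lin_ext_diff sum_subtractf)

lemma contract_coord:
  assumes "Suc p \<le> m" "l < k (Suc p)" "Poly_Mapping.keys c \<subseteq> simplices X p"
  shows "contract b0 p (coord p c) l = coord (Suc p) (frag_extend (contraction b0 p) c) l"
  using assms(3)
proof (induction c rule: frag_induction)
  case zero
  show ?case using assms by (simp add: coord_zero contract_def)
next
  case (one \<sigma>)
  obtain i0 \<delta> where s: "i0 < k p" "\<sigma> = act \<delta> ` \<tau> p i0"
    using simplex_representative[of p \<sigma>] one assms(1) by auto
  have "contract b0 p (coord p (frag_of \<sigma>)) l =
      (\<Sum>i<k p. if i = i0 then coord (Suc p) (contraction b0 p \<sigma>) l else 0)"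
    unfolding contract_def using assms s by (intro sum.cong refl) (simp add: coord_frag_of)
  then show ?case using s(1) by simp
next
  case (diff a b)
  have "contract b0 p (coord p (a - b)) l = contract b0 p (\<lambda>i. coord p a i - coord p b i) l"
    unfolding contract_def using assms by (intro sum.cong refl) (simp add: coord_diff)
  then show ?case using diff assms by (simp add: contract_diff frag_extend_diff coord_diff)
qed

text \<open>The homotopy identity of \<open>contraction\<close>, taken at every translate of a
  representative and extended real-linearly to arbitrary rows. Right multiplication by the entries
  of \<open>d p\<close> passes through \<open>lin_ext\<close>, which keeps the scalars on the
  left.\<close>

lemma contract_d:
  assumes b0: "{b0} \<in> X" and p: "Suc p \<le> m" and j: "j < k p"
  shows "(\<Sum>l<k (Suc p). contract b0 p v l * d p $$ (l, j)) = v j -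
    (\<Sum>i<k p. lin_ext (\<lambda>\<gamma>. coord p (case p of 0 \<Rightarrow> frag_of {b0}
       | Suc q \<Rightarrow> frag_extend (contraction b0 q) (boundary ori (act \<gamma> ` \<tau> p i))) j) (v i))"
    (is "_ = v j - (\<Sum>i<k p. lin_ext (?R i) (v i))")
proof -
  have cs: "contractible_space (realization X)"
    using type_F by (simp add: type_F_complex_def contractible_complex_def)
  have "(\<Sum>l<k (Suc p). contract b0 p v l * d p $$ (l, j)) =
      (\<Sum>i<k p. \<Sum>l<k (Suc p). lin_ext (\<lambda>\<gamma>. coord (Suc p) (contraction b0 p (act \<gamma> ` \<tau> p i)) l * d p $$ (l, j)) (v i))"
    unfolding contract_def sum_distrib_right lin_ext_mult_right by (rule sum.swap)
  also have "\<dots> = (\<Sum>i<k p. lin_ext (\<lambda>\<gamma>. (if j = i then Poly_Mapping.single \<gamma> 1 else 0) - ?R i \<gamma>) (v i))"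
  proof (intro sum.cong refl)
    fix i assume "i \<in> {..<k p}"
    then have i: "i < k p" by simp
    have "(\<Sum>l<k (Suc p). lin_ext (\<lambda>\<gamma>. coord (Suc p) (contraction b0 p (act \<gamma> ` \<tau> p i)) l * d p $$ (l, j)) (v i)) =
        lin_ext (\<lambda>\<gamma>. \<Sum>l<k (Suc p). coord (Suc p) (contraction b0 p (act \<gamma> ` \<tau> p i)) l * d p $$ (l, j)) (v i)"
      unfolding lin_ext_def sum_distrib_left by (rule sum.swap)
    also have "\<dots> = lin_ext (\<lambda>\<gamma>. (if j = i then Poly_Mapping.single \<gamma> 1 else 0) - ?R i \<gamma>) (v i)"
    proof (rule arg_cong[of _ _ "\<lambda>F. lin_ext F (v i)"], rule ext)
      fix \<gamma>
      have s: "act \<gamma> ` \<tau> p i \<in> simplices X p" using p i by (intro act_simplices \<tau>_simplices) auto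
      note c = contraction[OF cs b0 s]
      have "(\<Sum>l<k (Suc p). coord (Suc p) (contraction b0 p (act \<gamma> ` \<tau> p i)) l * d p $$ (l, j)) =
          coord p (bd ori (contraction b0 p (act \<gamma> ` \<tau> p i))) j"
        using c p j by (intro coord_bd[symmetric]) auto
      also have "\<dots> = coord p (frag_of (act \<gamma> ` \<tau> p i)) j - ?R i \<gamma>"
        using c p j by (simp add: coord_diff)
      also have "coord p (frag_of (act \<gamma> ` \<tau> p i)) j = (if j = i then Poly_Mapping.single \<gamma> 1 else 0)"
        using p i j by (intro coord_frag_of) auto
      finally show "(\<Sum>l<k (Suc p). coord (Suc p) (contraction b0 p (act \<gamma> ` \<tau> p i)) l * d p $$ (l, j)) =
        (if j = i then Poly_Mapping.single \<gamma> 1 else 0) - ?R i \<gamma>" .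
    qed
    finally show "(\<Sum>l<k (Suc p). lin_ext (\<lambda>\<gamma>. coord (Suc p) (contraction b0 p (act \<gamma> ` \<tau> p i)) l * d p $$ (l, j)) (v i)) =
      lin_ext (\<lambda>\<gamma>. (if j = i then Poly_Mapping.single \<gamma> 1 else 0) - ?R i \<gamma>) (v i)" .
  qed
  also have "\<dots> = (\<Sum>i<k p. if j = i then v i else 0) - (\<Sum>i<k p. lin_ext (?R i) (v i))"
    unfolding lin_ext_diff_fun sum_subtractf
    by (intro arg_cong2[of _ _ _ _ "(-)"] sum.cong refl) (simp_all add: lin_ext_id lin_ext_zero_fun)
  also have "(\<Sum>i<k p. if j = i then v i else 0) = v j" using j by simp
  finally show ?thesis .
qed

section \<open>Exactness of the complex of rows, including the augmentation\<close>

lemma base_vertex: obtains b0 where "{b0} \<in> X"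
proof -
  obtain \<sigma> where s: "\<sigma> \<in> X" using type_F by (auto simp: type_F_complex_def contractible_complex_def)
  then obtain v where "v \<in> \<sigma>" using X_nonempty by blast
  then have "{v} \<in> X" using X_subset[OF s, of "{v}"] by simp
  then show ?thesis by (rule that)
qed

text \<open>The remainder in \<open>contract_d\<close> is the contraction applied to the boundary of
  \<open>v\<close>. It is rewritten until \<open>v\<close> enters only through the products
  \<open>v i * d p $$ (i, l)\<close>, whose sums over \<open>i\<close> vanish; the contraction of
  \<open>v\<close> is then the row sought.\<close>

lemma exact_Suc:
  assumes p: "Suc (Suc p) \<le> m"
    and v: "\<And>l. l < k p \<Longrightarrow> (\<Sum>i<k (Suc p). v i * d p $$ (i, l)) = 0"
  shows "\<exists>c. \<forall>j<k (Suc p). v j = (\<Sum>l<k (Suc (Suc p)). c l * d (Suc p) $$ (l, j))"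
proof -
  obtain b0 where b0: "{b0} \<in> X" by (rule base_vertex)
  have "v j = (\<Sum>l<k (Suc (Suc p)). contract b0 (Suc p) v l * d (Suc p) $$ (l, j))" if j: "j < k (Suc p)" for j
  proof -
    have "lin_ext (\<lambda>\<gamma>. coord (Suc p) (frag_extend (contraction b0 p) (boundary ori (act \<gamma> ` \<tau> (Suc p) i))) j) (v i) =
        (\<Sum>l<k p. lin_ext (\<lambda>\<delta>. coord (Suc p) (contraction b0 p (act \<delta> ` \<tau> p l)) j) (v i * d p $$ (i, l)))"
      if i: "i < k (Suc p)" for i
    proof -
      have "coord (Suc p) (frag_extend (contraction b0 p) (boundary ori (act \<gamma> ` \<tau> (Suc p) i))) j =
          (\<Sum>l<k p. lin_ext (\<lambda>\<delta>. coord (Suc p) (contraction b0 p (act \<delta> ` \<tau> p l)) j) (Poly_Mapping.single \<gamma> 1 * d p $$ (i, l)))" for \<gamma>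
      proof -
        have s: "act \<gamma> ` \<tau> (Suc p) i \<in> simplices X (Suc p)" using p i by (intro act_simplices \<tau>_simplices) auto
        have "coord (Suc p) (frag_extend (contraction b0 p) (boundary ori (act \<gamma> ` \<tau> (Suc p) i))) j =
            contract b0 p (coord p (boundary ori (act \<gamma> ` \<tau> (Suc p) i))) j"
          using p j keys_boundary_simplices[OF s] by (intro contract_coord[symmetric]) auto
        then show ?thesis unfolding contract_def using p i by (simp add: coord_boundary_act)
      qed
      then have "lin_ext (\<lambda>\<gamma>. coord (Suc p) (frag_extend (contraction b0 p) (boundary ori (act \<gamma> ` \<tau> (Suc p) i))) j) (v i) =
          (\<Sum>l<k p. lin_ext (\<lambda>\<gamma>. lin_ext (\<lambda>\<delta>. coord (Suc p) (contraction b0 p (act \<delta> ` \<tau> p l)) j) (Poly_Mapping.single \<gamma> 1 * d p $$ (i, l))) (v i))"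
        unfolding lin_ext_def[of _ "v i"] by (simp add: sum_distrib_left sum.swap[of _ "{..<k p}"])
      also have "\<dots> = (\<Sum>l<k p. lin_ext (\<lambda>\<delta>. coord (Suc p) (contraction b0 p (act \<delta> ` \<tau> p l)) j) (v i * d p $$ (i, l)))"
      proof (intro sum.cong refl)
        fix l
        let ?L = "lin_ext (\<lambda>\<delta>. coord (Suc p) (contraction b0 p (act \<delta> ` \<tau> p l)) j)"
        have "lin_ext (\<lambda>\<gamma>. ?L (Poly_Mapping.single \<gamma> 1 * d p $$ (i, l))) (v i) =
            ?L (lin_ext (\<lambda>\<gamma>. Poly_Mapping.single \<gamma> 1 * d p $$ (i, l)) (v i))"
          unfolding lin_ext_def[of _ "v i"] lin_ext_sum lin_ext_scale ..
        also have "lin_ext (\<lambda>\<gamma>. Poly_Mapping.single \<gamma> 1 * d p $$ (i, l)) (v i) = v i * d p $$ (i, l)"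
          by (rule lin_ext_mult_left) simp
        finally show "lin_ext (\<lambda>\<gamma>. ?L (Poly_Mapping.single \<gamma> 1 * d p $$ (i, l))) (v i) = ?L (v i * d p $$ (i, l))" .
      qed
      finally show ?thesis .
    qed
    then have "(\<Sum>i<k (Suc p). lin_ext (\<lambda>\<gamma>. coord (Suc p) (frag_extend (contraction b0 p) (boundary ori (act \<gamma> ` \<tau> (Suc p) i))) j) (v i)) =
        (\<Sum>i<k (Suc p). \<Sum>l<k p. lin_ext (\<lambda>\<delta>. coord (Suc p) (contraction b0 p (act \<delta> ` \<tau> p l)) j) (v i * d p $$ (i, l)))"
      by (intro sum.cong refl) simp
    also have "\<dots> = (\<Sum>l<k p. lin_ext (\<lambda>\<delta>. coord (Suc p) (contraction b0 p (act \<delta> ` \<tau> p l)) j) (\<Sum>i<k (Suc p). v i * d p $$ (i, l)))"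
      unfolding lin_ext_sum by (rule sum.swap)
    also have "\<dots> = 0" using v by (intro sum.neutral) simp
    finally show ?thesis using contract_d[OF b0 p j, of v] by simp
  qed
  then show ?thesis by blast
qed

text \<open>In degree 0 the remainder is the augmentation of \<open>v\<close> times the base vertex.
  The augmentation, the sum of all coefficients, appears as the trivial representation on the reals
  evaluated at 1.\<close>

lemma exact_0:
  assumes m: "1 \<le> m" and v: "(\<Sum>i<k 0. rep_alg (\<lambda>_ x. x) (v i) (1::real)) = 0"
  shows "\<exists>c. \<forall>j<k 0. v j = (\<Sum>l<k 1. c l * d 0 $$ (l, j))"
proof -
  obtain b0 where b0: "{b0} \<in> X" by (rule base_vertex)
  have "v j = (\<Sum>l<k 1. contract b0 0 v l * d 0 $$ (l, j))" if j: "j < k 0" for j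
  proof -
    have "lin_ext (\<lambda>\<gamma>. x) a = Poly_Mapping.single 0 (rep_alg (\<lambda>_ x. x) a 1) * x" for x a :: "'g \<Rightarrow>\<^sub>0 real"
      by (induction a rule: poly_mapping_single_induct) (simp_all add: lin_ext_add rep_alg_add single_add distrib_right)
    then have "(\<Sum>i<k 0. lin_ext (\<lambda>\<gamma>. coord 0 (frag_of {b0}) j) (v i)) =
        (\<Sum>i<k 0. Poly_Mapping.single 0 (rep_alg (\<lambda>_ x. x) (v i) 1)) * coord 0 (frag_of {b0}) j"
      by (simp add: sum_distrib_right)
    also have "(\<Sum>i<k 0. Poly_Mapping.single (0 :: 'g) (rep_alg (\<lambda>_ x. x) (v i) 1 :: real)) =
        Poly_Mapping.single 0 (\<Sum>i<k 0. rep_alg (\<lambda>_ x. x) (v i) 1)"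
      by (rule poly_mapping_eqI) (simp add: lookup_sum lookup_single when_def)
    finally show ?thesis using contract_d[OF b0 _ j, of v] v m by simp
  qed
  then show ?thesis by blast
qed

text \<open>A vertex has augmentation 1 whichever translate of a representative it is, and the end
  points of an edge occur with opposite signs.\<close>

lemma augmentation_d:
  assumes m: "1 \<le> m" and i: "i < k 1"
  shows "(\<Sum>j<k 0. rep_alg (\<lambda>_ x. x) (d 0 $$ (i, j)) (1::real)) = 0"
proof -
  have t: "\<tau> 1 i \<in> simplices X (Suc 0)" using \<tau>_simplices[of 1 i] m i by simp
  then have tX: "\<tau> 1 i \<in> X" by (simp add: simplices_def)
  have "length (ori (\<tau> 1 i)) = 2" using length_ori[OF t] by simp
  then obtain a b where ab: "ori (\<tau> 1 i) = [a, b]" by (auto simp: length_Suc_conv numeral_2_eq_2)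
  then have "{a} \<subseteq> \<tau> 1 i" "{b} \<subseteq> \<tau> 1 i" using ori_set[OF tX] by auto
  then have X: "{a} \<in> X" "{b} \<in> X" by (auto intro: X_subset[OF tX])
  then have B: "boundary ori (\<tau> 1 i) = frag_of {b} - frag_of {a}"
    by (simp add: boundary_face_sum ab osimplex_single del: One_nat_def)
  have one: "(\<Sum>j<k 0. rep_alg (\<lambda>_ x. x) (coord 0 (frag_of {c}) j) (1::real)) = 1" if "{c} \<in> X" for c
  proof -
    have "{c} \<in> simplices X 0" using that by (simp add: simplices_def)
    then obtain j0 \<gamma> where j0: "j0 < k 0" "{c} = act \<gamma> ` \<tau> 0 j0" using simplex_representative[of 0 "{c}"] by auto
    have "(\<Sum>j<k 0. rep_alg (\<lambda>_ x. x) (coord 0 (frag_of {c}) j) (1::real)) = (\<Sum>j<k 0. if j = j0 then 1 else 0)"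
      unfolding j0(2) using j0(1) by (intro sum.cong refl) (simp add: coord_frag_of)
    then show ?thesis using j0(1) by simp
  qed
  have "d 0 $$ (i, j) + coord 0 (frag_of {a}) j = coord 0 (frag_of {b}) j" if "j < k 0" for j
    using d_index[of 0 i j] m i that B by (simp add: coord_diff)
  then have "(\<Sum>j<k 0. rep_alg (\<lambda>_ x. x) (d 0 $$ (i, j) + coord 0 (frag_of {a}) j) (1::real)) = 1"
    using one[OF X(2)] by simp
  then show ?thesis using one[OF X(1)] by (simp add: rep_alg_add sum.distrib)
qed

end

section \<open>The canonical trace, and factoring sums of squares through a codifferential\<close>

lemma lookup_star_mult_0:
  "Poly_Mapping.lookup (group_alg_star x * y) 0 = (\<Sum>\<gamma>\<in>Poly_Mapping.keys x. Poly_Mapping.lookup x \<gamma> * Poly_Mapping.lookup y \<gamma>)"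
proof -
  have "group_alg_star x = (\<Sum>\<gamma>\<in>Poly_Mapping.keys x. Poly_Mapping.single (- \<gamma>) (Poly_Mapping.lookup x \<gamma>))"
    using arg_cong[OF poly_mapping_sum_singles[of x], of group_alg_star]
    by (simp add: group_alg_star_sum group_alg_star_single)
  then show ?thesis by (simp add: sum_distrib_right lookup_sum lookup_single_mult)
qed

lemma lookup_star_mult_self_nonneg: "0 \<le> Poly_Mapping.lookup (group_alg_star x * x) 0"
  by (simp add: lookup_star_mult_0 sum_nonneg)

text \<open>The coefficient at the identity is the canonical trace of the group algebra; on a square
  it is the sum of the squared coefficients, which makes it faithful.\<close>

lemma lookup_star_mult_self_eq_0: "Poly_Mapping.lookup (group_alg_star x * x) 0 = 0 \<Longrightarrow> x = 0"
  by (rule poly_mapping_eqI) (auto simp: lookup_star_mult_0 sum_nonneg_eq_0_iff in_keys_iff)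

lemma lookup_mat_star_mult_diag:
  assumes y: "y \<in> carrier_mat r c" and a: "a < c"
  shows "Poly_Mapping.lookup ((mat_star y * y) $$ (a, a)) 0 =
    (\<Sum>i<r. Poly_Mapping.lookup (group_alg_star (y $$ (i, a)) * y $$ (i, a)) 0)"
  unfolding index_mat_mult_sum[OF mat_star_carrier[OF y] y a a] lookup_sum
  using y a by (intro sum.cong refl) simp

lemma unitary_rep_trivial: "unitary_rep (UNIV :: real set) (\<lambda>_ x. x)"
  by (simp add: unitary_rep_def)

lemma conj_map_zero: "a \<in> carrier_mat k k \<Longrightarrow> conj_map (0\<^sub>m k l) a = 0\<^sub>m l l"
  unfolding conj_map_def by (subst right_mult_zero_mat[of _ l k]) (auto intro: mult_carrier_mat[of _ l k])

context equivariant_complex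
begin

text \<open>The rows of \<open>c\<close> are subject to separate equations, so each may come from an
  arbitrary, not necessarily equivariant choice.\<close>

lemma factor_rows:
  assumes b: "b \<in> carrier_mat r (k p)"
    and ex: "\<And>i. i < r \<Longrightarrow> \<exists>c. \<forall>j<k p. b $$ (i, j) = (\<Sum>l<k (Suc p). c l * d p $$ (l, j))"
  shows "\<exists>c\<in>carrier_mat r (k (Suc p)). b = c * d p"
proof -
  obtain c where c: "\<And>i j. i < r \<Longrightarrow> j < k p \<Longrightarrow> b $$ (i, j) = (\<Sum>l<k (Suc p). c i l * d p $$ (l, j))"
    using ex by metis
  define C where "C = Matrix.mat r (k (Suc p)) (\<lambda>(i, l). c i l)"
  have C: "C \<in> carrier_mat r (k (Suc p))" by (simp add: C_def)
  have "b = C * d p"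
  proof (rule eq_matI)
    fix i j assume "i < dim_row (C * d p)" "j < dim_col (C * d p)"
    then have ij: "i < r" "j < k p" using C d_carrier[of p] by auto
    show "b $$ (i, j) = (C * d p) $$ (i, j)"
      unfolding index_mat_mult_sum[OF C d_carrier ij] c[OF ij] using ij by (intro sum.cong) (simp_all add: C_def)
  qed (use b C d_carrier[of p] in auto)
  with C show ?thesis by blast
qed

lemma im_conj_d: "im_conj (d p) = conj_map (d p) ` carrier_mat (k (Suc p)) (k (Suc p))"
  using d_carrier[of p] by (auto simp: im_conj_def)

text \<open>If $\sum b_i^* b_i = d^* a d$, then each row of each $b_i$ is a real cycle of \<open>X\<close>, hence a
  boundary: testing against $d_{p-1}$, or against the augmentation if $p = 0$, shows this with a
  positive functional that vanishes on $d^* a d$.\<close>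

lemma im_conj_sums_of_squares:
  assumes p: "Suc p \<le> m" and s: "s \<in> im_conj (d p)" "s \<in> sums_of_squares (k p)"
  shows "\<exists>t\<in>carrier_mat (k (Suc p)) (k (Suc p)). s = conj_map (d p) t \<and>
    (\<forall>\<Psi>. (\<forall>a\<in>carrier_mat (k (Suc p)) (k (Suc p)). \<forall>b\<in>carrier_mat (k (Suc p)) (k (Suc p)). \<Psi> (a + b) = \<Psi> a + \<Psi> b) \<longrightarrow>
       (\<forall>c\<in>carrier_mat (k p) (k (Suc p)). 0 \<le> \<Psi> (mat_star c * c)) \<longrightarrow> 0 \<le> (\<Psi> t :: real))"
proof (cases p)
  case 0
  interpret triv: unitary_representation "UNIV :: real set" "\<lambda>_ :: 'g. \<lambda>x. x"
    by unfold_locales (rule unitary_rep_trivial)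
  define ones where "ones = Matrix.vec (k p) (\<lambda>_. 1 :: real)"
  have ones: "ones \<in> vecs_over UNIV (k p)" by (simp add: ones_def vecs_over_def)
  \<comment> \<open>Test functional in degree 0: on a square \<open>mat_star b * b\<close> it is the
    squared norm of the vector of augmentations of the rows of \<open>b\<close>.\<close>
  define T where "T = (\<lambda>s :: ('g \<Rightarrow>\<^sub>0 real) mat. vec_inner (rep_mat (\<lambda>_ x. x) s ones) ones)"
  have Tb: "T (mat_star b * c) = vec_inner (rep_mat (\<lambda>_ x. x) c ones) (rep_mat (\<lambda>_ x. x) b ones)"
    if "b \<in> carrier_mat r (k p)" "c \<in> carrier_mat r (k p)" for b c r
    unfolding T_def using that ones by (intro triv.vec_inner_mat_star_mult)
  show ?thesis
  proof (rule sums_of_squares_factor[where T = T])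
    show "T (a + b) = T a + T b" if "a \<in> carrier_mat (k p) (k p)" "b \<in> carrier_mat (k p) (k p)" for a b
      unfolding T_def using that by (rule vec_inner_rep_mat_add)
    show "0 \<le> T (mat_star b * b)" if "b \<in> carrier_mat (k p) (k p)" for b
      unfolding Tb[OF that that] by (rule vec_inner_self_nonneg)
    show "\<exists>c\<in>carrier_mat (k p) (k (Suc p)). b = c * d p"
      if b: "b \<in> carrier_mat (k p) (k p)" and T: "T (mat_star b * b) = 0" for b
    proof (rule factor_rows[OF b])
      fix i assume i: "i < k p"
      have "rep_mat (\<lambda>_ x. x) b ones = 0\<^sub>v (dim_vec (rep_mat (\<lambda>_ x. x) b ones))"
        using T unfolding Tb[OF b b] by (rule vec_inner_self_eq_0)
      then have "rep_mat (\<lambda>_ x. x) b ones $ i = 0" using b i by (simp add: rep_mat_def vec_eq_iff)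
      then have "(\<Sum>j<k 0. rep_alg (\<lambda>_ x. x) (b $$ (i, j)) (1 :: real)) = 0"
        using b i 0 by (simp add: rep_mat_def ones_def)
      then show "\<exists>c. \<forall>j<k p. b $$ (i, j) = (\<Sum>l<k (Suc p). c l * d p $$ (l, j))"
        using exact_0[of "\<lambda>j. b $$ (i, j)"] p 0 by simp
    qed
    obtain a where a: "a \<in> carrier_mat (k (Suc p)) (k (Suc p))" "s = conj_map (d p) a" using s(1) by (auto simp: im_conj_d)
    have ad: "a * d p \<in> carrier_mat (k (Suc p)) (k p)" using a d_carrier[of p] by (metis mult_carrier_mat)
    have "rep_mat (\<lambda>_ x. x) (d p) ones = 0\<^sub>v (k (Suc p))"
    proof (rule eq_vecI)
      fix i assume "i < dim_vec (0\<^sub>v (k (Suc p)) :: real vec)"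
      then have i: "i < k 1" using 0 by simp
      have "rep_mat (\<lambda>_ x. x) (d p) ones $ i = (\<Sum>j<k 0. rep_alg (\<lambda>_ x. x) (d 0 $$ (i, j)) (1::real))"
        using i d_carrier[of p] 0 by (simp add: rep_mat_def ones_def)
      then show "rep_mat (\<lambda>_ x. x) (d p) ones $ i = 0\<^sub>v (k (Suc p)) $ i"
        using augmentation_d[OF _ i] p 0 i by simp
    qed (use d_carrier[of p] in \<open>simp add: rep_mat_def\<close>)
    moreover have "vec_inner w (0\<^sub>v (k (Suc p))) = 0" if "dim_vec w = k (Suc p)" for w :: "real vec"
      using that by (simp add: vec_inner_def)
    moreover have "dim_vec (rep_mat (\<lambda>_ x. x) (a * d p) ones) = k (Suc p)"
      using a(1) by (simp add: rep_mat_def)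
    ultimately have "T (mat_star (d p) * (a * d p)) = 0"
      unfolding Tb[OF d_carrier ad] by simp
    moreover have "mat_star (d p) * (a * d p) = s"
      unfolding a(2) conj_map_def using a(1) d_carrier[of p]
      by (intro assoc_mult_mat[symmetric, of _ "k p" "k (Suc p)" _ "k (Suc p)" _ "k p"]) auto
    ultimately show "T s = 0" by simp
  qed (use d_carrier s in auto)
next
  case (Suc q)
  note e = d_carrier[of q, folded Suc]
  \<comment> \<open>Test functional in positive degree: the trace of
    \<open>conj_map (d q) s\<close>, that is, the identity coefficients summed along the diagonal.
    On \<open>mat_star b * b\<close> it is the sum of the squared coefficients of all entries of
    \<open>b * d q\<close>.\<close>
  define T where "T = (\<lambda>s. \<Sum>a<k q. Poly_Mapping.lookup (conj_map (d q) s $$ (a, a)) 0)"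
  have Tb: "T (mat_star b * b) = (\<Sum>a<k q. \<Sum>r<k p. Poly_Mapping.lookup (group_alg_star ((b * d q) $$ (r, a)) * (b * d q) $$ (r, a)) 0)"
    if b: "b \<in> carrier_mat (k p) (k p)" for b
    unfolding T_def conj_map_square[OF e b]
    by (intro sum.cong refl lookup_mat_star_mult_diag[OF mult_carrier_mat[OF b e]]) simp
  show ?thesis
  proof (rule sums_of_squares_factor[where T = T])
    show "T (a + b) = T a + T b" if "a \<in> carrier_mat (k p) (k p)" "b \<in> carrier_mat (k p) (k p)" for a b
      unfolding T_def using that conj_map_carrier[OF e that(1)] conj_map_carrier[OF e that(2)]
      by (simp add: conj_map_add[OF e] lookup_add sum.distrib)
    show "0 \<le> T (mat_star b * b)" if "b \<in> carrier_mat (k p) (k p)" for b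
      unfolding Tb[OF that] by (intro sum_nonneg lookup_star_mult_self_nonneg)
    show "\<exists>c\<in>carrier_mat (k p) (k (Suc p)). b = c * d p"
      if b: "b \<in> carrier_mat (k p) (k p)" and T: "T (mat_star b * b) = 0" for b
    proof (rule factor_rows[OF b])
      fix i assume i: "i < k p"
      have "(\<Sum>j<k (Suc q). b $$ (i, j) * d q $$ (j, l)) = 0" if l: "l < k q" for l
      proof -
        have "Poly_Mapping.lookup (group_alg_star ((b * d q) $$ (i, l)) * (b * d q) $$ (i, l)) 0 = 0"
          using T i l unfolding Tb[OF b]
          by (simp add: sum_nonneg_eq_0_iff sum_nonneg lookup_star_mult_self_nonneg del: index_mult_mat(1))
        then have "(b * d q) $$ (i, l) = 0" by (rule lookup_star_mult_self_eq_0)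
        then show ?thesis using index_mat_mult_sum[OF b e i l] Suc by simp
      qed
      then show "\<exists>c. \<forall>j<k p. b $$ (i, j) = (\<Sum>l<k (Suc p). c l * d p $$ (l, j))"
        using exact_Suc[of q "\<lambda>j. b $$ (i, j)"] p Suc by simp
    qed
    obtain a where a: "a \<in> carrier_mat (k (Suc p)) (k (Suc p))" "s = conj_map (d p) a" using s(1) by (auto simp: im_conj_d)
    have "conj_map (d q) s = conj_map (d p * d q) a"
      unfolding a(2) by (rule conj_map_conj_map[OF d_carrier e a(1)])
    also have "d p * d q = 0\<^sub>m (k (Suc p)) (k q)" using d_d[of q] p Suc by simp
    finally show "T s = 0" unfolding T_def using conj_map_zero[OF a(1)] by simp
  qed (use d_carrier s in auto)
qed

section \<open>From positive functionals to cyclic cocycles, and back\<close>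

lemma functional_imp_cocycle:
  assumes p: "Suc (Suc p) \<le> m"
    and lin: "linear_functional (im_conj (d p)) \<phi>" and herm: "hermitian_functional (im_conj (d p)) \<phi>"
    and pos: "positive_functional (k p) (im_conj (d p)) \<phi>"
  shows "\<exists>(H :: ('g \<times> nat) ell2 set) \<pi>. unitary_rep H \<pi> \<and>
    (\<exists>z \<in> cocycles H \<pi> (d (Suc p)). cyclic_vec H \<pi> (k (Suc p)) z \<and>
      (\<forall>a \<in> carrier_mat (k (Suc p)) (k (Suc p)). \<phi> (conj_map (d p) a) = vec_inner (rep_mat \<pi> a z) z))"
proof -
  let ?M = "carrier_mat (k (Suc p)) (k (Suc p)) :: ('g \<Rightarrow>\<^sub>0 real) mat set"
  define \<psi> where "\<psi> = (\<lambda>a. \<phi> (conj_map (d p) a))"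
  have im: "conj_map (d p) a \<in> im_conj (d p)" if "a \<in> ?M" for a using that by (simp add: im_conj_d)
  have add: "\<psi> (a + b) = \<psi> a + \<psi> b" if "a \<in> ?M" "b \<in> ?M" for a b
    using lin im[OF that(1)] im[OF that(2)] unfolding \<psi>_def conj_map_add[OF d_carrier that] linear_functional_def by blast
  have scale: "\<psi> (Poly_Mapping.single 0 c \<cdot>\<^sub>m a) = c * \<psi> a" if "a \<in> ?M" for a c
    using lin im[OF that] unfolding \<psi>_def conj_map_smult[OF d_carrier that] linear_functional_def by blast
  have hermi: "\<psi> (mat_star a) = \<psi> a" if "a \<in> ?M" for a
    using herm im[OF that] unfolding \<psi>_def conj_map_star[OF d_carrier that, symmetric] hermitian_functional_def by blast
  have posi: "0 \<le> \<psi> (mat_star v * v)" if v: "v \<in> carrier_mat 1 (k (Suc p))" for v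
  proof -
    have "v * d p \<in> carrier_mat 1 (k p)" using v d_carrier by (rule mult_carrier_mat)
    then have "conj_map (d p) (mat_star v * v) \<in> sums_of_squares (k p)"
      unfolding conj_map_square[OF d_carrier v] by (rule row_square_in_sums_of_squares)
    moreover have "mat_star v * v \<in> ?M" using v by auto
    ultimately show ?thesis using pos im unfolding \<psi>_def positive_functional_def by blast
  qed
  obtain H :: "('g \<times> nat) ell2 set" and \<pi> z where H: "unitary_rep H \<pi>" "z \<in> vecs_over H (k (Suc p))"
    "cyclic_vec H \<pi> (k (Suc p)) z" "\<And>a. a \<in> ?M \<Longrightarrow> \<psi> a = vec_inner (rep_mat \<pi> a z) z"
    using gns_construction[of "k (Suc p)" \<psi>, OF add scale hermi posi] by metis
  interpret unitary_representation H \<pi> by unfold_locales (rule H(1))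
  let ?D = "d (Suc p)"
  have DD: "mat_star ?D * ?D \<in> ?M" using d_carrier[of "Suc p"] by auto
  have "vec_inner (rep_mat \<pi> ?D z) (rep_mat \<pi> ?D z) = \<psi> (mat_star ?D * ?D)"
    unfolding H(4)[OF DD] by (rule vec_inner_mat_star_mult[OF d_carrier d_carrier H(2) H(2), symmetric])
  also have "\<dots> = \<phi> (mat_star (?D * d p) * (?D * d p))"
    unfolding \<psi>_def by (simp only: conj_map_square[OF d_carrier d_carrier])
  also have "mat_star (?D * d p) * (?D * d p) = 0\<^sub>m (k p) (k p)"
    unfolding d_d[OF p] by (rule right_mult_zero_mat) auto
  also have "\<phi> (0\<^sub>m (k p) (k p)) = 0"
  proof -
    have "\<psi> (0\<^sub>m (k (Suc p)) (k (Suc p))) = 0"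
      using add[of "0\<^sub>m (k (Suc p)) (k (Suc p))" "0\<^sub>m (k (Suc p)) (k (Suc p))"] by simp
    then show ?thesis using d_carrier[of p] by (simp add: \<psi>_def conj_map_def)
  qed
  finally have "rep_mat \<pi> ?D z = 0\<^sub>v (dim_vec (rep_mat \<pi> ?D z))" by (rule vec_inner_self_eq_0)
  then have "z \<in> cocycles H \<pi> ?D"
    using H(2) d_carrier[of "Suc p"] by (simp add: cocycles_def rep_mat_def)
  then show ?thesis using H unfolding \<psi>_def by blast
qed

lemma cocycle_imp_functional:
  fixes H :: "'h::{real_inner,complete_space} set"
  assumes p: "Suc (Suc p) \<le> m" and ker: "split_conj_space (d (Suc p)) = ker_conj (d p)"
    and rep: "unitary_rep H \<pi>" and z: "z \<in> cocycles H \<pi> (d (Suc p))"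
  shows "\<exists>\<phi>. (\<forall>a \<in> carrier_mat (k (Suc p)) (k (Suc p)). \<phi> (conj_map (d p) a) = vec_inner (rep_mat \<pi> a z) z) \<and>
    linear_functional (im_conj (d p)) \<phi> \<and> positive_functional (k p) (im_conj (d p)) \<phi> \<and>
    hermitian_functional (im_conj (d p)) \<phi>"
  using p ker by (intro cocycle_functional[OF d_carrier d_carrier rep z] im_conj_sums_of_squares) auto

end

theorem theorem4p3:
  fixes X :: "'v set set"
    and act :: "'g::group_add \<Rightarrow> 'v \<Rightarrow> 'v"
    and ori :: "'v set \<Rightarrow> 'v list"
    and \<tau> :: "nat \<Rightarrow> nat \<Rightarrow> 'v set"
    and n :: nat
  defines "k \<equiv> num_orbits X act"
    and "d \<equiv> codifferential X act ori \<tau>"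
  assumes "n \<ge> 1"
    and "type_F_complex (n + 1) X act"
    and "invariant_orientation X act ori"
    and "orbit_representatives (n + 1) X act \<tau>"
  shows
    "(\<forall>\<phi>. linear_functional (im_conj (d (n - 1))) \<phi> \<and>
          hermitian_functional (im_conj (d (n - 1))) \<phi> \<and>
          positive_functional (k (n - 1)) (im_conj (d (n - 1))) \<phi> \<longrightarrow>
        (\<exists>(H :: ('g \<times> nat) ell2 set) \<pi>. unitary_rep H \<pi> \<and>
          (\<exists>z \<in> cocycles H \<pi> (d n). cyclic_vec H \<pi> (k n) z \<and>
            (\<forall>a \<in> carrier_mat (k n) (k n).
              \<phi> (conj_map (d (n - 1)) a) = vec_inner (rep_mat \<pi> a z) z)))) \<and>
     (split_conj_space (d n) = ker_conj (d (n - 1)) \<longrightarrow>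
        (\<forall>(H :: 'h::{real_inner,complete_space} set) \<pi>. unitary_rep H \<pi> \<longrightarrow>
          (\<forall>z \<in> cocycles H \<pi> (d n).
            \<exists>\<phi>. (\<forall>a \<in> carrier_mat (k n) (k n).
                   \<phi> (conj_map (d (n - 1)) a) = vec_inner (rep_mat \<pi> a z) z) \<and>
                 linear_functional (im_conj (d (n - 1))) \<phi> \<and>
                 positive_functional (k (n - 1)) (im_conj (d (n - 1))) \<phi> \<and>
                 hermitian_functional (im_conj (d (n - 1))) \<phi>)))"
proof -
  have complex: "equivariant_complex X act ori \<tau> (n + 1)"
    using assms by unfold_locales
  \<comment> \<open>Writing n as a successor removes the truncated subtraction: \<open>d p\<close>
    is the lower codifferential, \<open>d (Suc p)\<close> the upper one, and the finiteness bound n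
    + 1 is \<open>Suc (Suc p)\<close>.\<close>
  obtain p where n: "n = Suc p" using \<open>n \<ge> 1\<close> by (cases n) auto
  have p: "Suc (Suc p) \<le> n + 1" and n1: "n - 1 = p" by (simp_all add: n)
  show ?thesis
    unfolding k_def d_def n1 unfolding n
  proof (intro conjI allI impI ballI)
    fix \<phi> :: "('g \<Rightarrow>\<^sub>0 real) mat \<Rightarrow> real"
    assume "linear_functional (im_conj (codifferential X act ori \<tau> p)) \<phi> \<and>
      hermitian_functional (im_conj (codifferential X act ori \<tau> p)) \<phi> \<and>
      positive_functional (num_orbits X act p) (im_conj (codifferential X act ori \<tau> p)) \<phi>"
    then show "\<exists>(H :: ('g \<times> nat) ell2 set) \<pi>. unitary_rep H \<pi> \<and>
        (\<exists>z \<in> cocycles H \<pi> (codifferential X act ori \<tau> (Suc p)). cyclic_vec H \<pi> (num_orbits X act (Suc p)) z \<and>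
          (\<forall>a \<in> carrier_mat (num_orbits X act (Suc p)) (num_orbits X act (Suc p)).
            \<phi> (conj_map (codifferential X act ori \<tau> p) a) = vec_inner (rep_mat \<pi> a z) z))"
      by (intro equivariant_complex.functional_imp_cocycle[OF complex p]) auto
  next
    fix H :: "'h set" and \<pi> z
    assume "split_conj_space (codifferential X act ori \<tau> (Suc p)) = ker_conj (codifferential X act ori \<tau> p)"
      "unitary_rep H \<pi>" "z \<in> cocycles H \<pi> (codifferential X act ori \<tau> (Suc p))"
    then show "\<exists>\<phi>. (\<forall>a \<in> carrier_mat (num_orbits X act (Suc p)) (num_orbits X act (Suc p)).
           \<phi> (conj_map (codifferential X act ori \<tau> p) a) = vec_inner (rep_mat \<pi> a z) z) \<and>
         linear_functional (im_conj (codifferential X act ori \<tau> p)) \<phi> \<and>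
         positive_functional (num_orbits X act p) (im_conj (codifferential X act ori \<tau> p)) \<phi> \<and>
         hermitian_functional (im_conj (codifferential X act ori \<tau> p)) \<phi>"
      by (rule equivariant_complex.cocycle_imp_functional[OF complex p])
  qed
qed

end
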